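(* Let $f$ be a transcendental entire function of finite order $\rho$ with a finite non-zero Borel exceptional value $d$. Let $\alpha\in\mathbb{C}\setminus\{0\}$ be a constant, and let $\beta$ and $b_j$ $(j=0,1,\ldots,m)$ be entire functions that are $\lambda$-small functions of $f$. Let $$L(z,f)=\sum_{j=0}^{m} b_j(z)\, f^{(k_j)}(z+c_j),$$ where the $c_j$ are distinct complex numbers and the $k_j$ are non-negative integers, and assume $L(z,f)\not\equiv 0$. Put $\Phi_2(z)=L(z,f)-\alpha f(z)^2$ and $I_1=\{0\le j\le m : k_j=0\}$. Then the following hold. (i) If $\beta\not\equiv\left(\sum_{j\in I_1} b_j\right)d-\alpha d^2$, then $\Phi_2-\beta$ has sufficiently many zeros to satisfy $\lambda(\Phi_2-\beta)=\rho$. (ii) If $\beta\equiv\left(\sum_{j\in I_1} b_j\right)d-\alpha d^2$, then one of the following holds: (a) $\beta$ is a Borel exceptional small function of $\Phi_2$, and $$\frac{\beta-\Phi_2}{(f-d)^2}=\alpha=\frac{L(z,f)-\alpha d^2-\beta}{2d(f-d)};$$ (b) $\Phi_2-\beta$ has sufficiently many zeros to satisfy $$N\left(r,\frac{1}{\Phi_2-\beta}\right)=T(r,f)+S_\lambda(r,f).$$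
   Context: Standard notation of Nevanlinna theory is used: $T(r,\cdot)$ is the characteristic function and $N(r,\cdot)$ the integrated counting function. $\rho(f)$ denotes the order of growth of $f$. For a meromorphic function $g\not\equiv 0$, $\lambda(g)$ (with a function as argument) denotes the exponent of convergence of the zeros of $g$, i.e. $\limsup_{r\to\infty}\frac{\log^+ N(r,1/g)}{\log r}$. This is different from the real number $\lambda$ in "$\lambda$-small" and $S_\lambda$. $S(r,f)$ denotes any quantity satisfying $S(r,f)=o(T(r,f))$ as $r\to\infty$ outside a possible exceptional set $F$ of finite logarithmic measure. $\lambda$-small function: let $f$ be a meromorphic function of finite order $\rho$ and let $\lambda<\rho$ be a real number. A meromorphic function $a$ on $\mathbb{C}$ is a $\lambda$-small function of $f$ if for every $\varepsilon\in(0,\rho-\lambda)$ one has $T(r,a)=O(r^{\lambda+\varepsilon})+S(r,f)$ outside a possible exceptional set $F$ of finite logarithmic measure. A quantity of the form of this right-hand side, $O(r^{\lambda+\varepsilon})+S(r,f)$, is denoted $S_\lambda(r,f)$. In the claim, all $\lambda$-small functions are taken with respect to a common $\lambda<\rho$. A small function (in particular a constant) $\beta$ is called a Borel exceptional small function (value) of a function $g$ of finite order if $\lambda(g-\beta)<\rho(g)$. *)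

theory Defs
  imports
    "HOL-Complex_Analysis.Complex_Analysis"
    "HOL-Library.Landau_Symbols"
begin

definition log_plus :: "real \<Rightarrow> real" where
  "log_plus x = ln (max 1 x)"

section \<open>Nevanlinna functions\<close>

text \<open>
  Meromorphic functions are total functions that are \<open>meromorphic_on UNIV\<close>; their values at poles
  are arbitrary. This does not affect the functions below: the proximity function ignores the
  finitely many poles on a circle, and \<^const>\<open>is_pole\<close> and \<^const>\<open>zorder\<close> only depend on punctured
  neighbourhoods. In particular \<open>N(r, 1/g)\<close> can be written as \<open>counting_int (\<lambda>z. 1 / g z) r\<close>, although
  \<open>1 / 0 = 0\<close>.
\<close>

definition proximity :: "(complex \<Rightarrow> complex) \<Rightarrow> real \<Rightarrow> real" where
  "proximity f r =
     1 / (2 * pi) * integral {0..2 * pi} (\<lambda>\<theta>. log_plus (norm (f (of_real r * cis \<theta>))))"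

text \<open>The number of poles in the closed disc, counted with multiplicity.\<close>

definition counting :: "(complex \<Rightarrow> complex) \<Rightarrow> real \<Rightarrow> nat" where
  "counting f r = (\<Sum>z | norm z \<le> r \<and> is_pole f z. nat (- zorder f z))"

definition counting_int :: "(complex \<Rightarrow> complex) \<Rightarrow> real \<Rightarrow> real" where
  "counting_int f r =
     integral {0..r} (\<lambda>t. (real (counting f t) - real (counting f 0)) / t)
       + real (counting f 0) * ln r"

definition characteristic :: "(complex \<Rightarrow> complex) \<Rightarrow> real \<Rightarrow> real" where
  "characteristic f r = proximity f r + counting_int f r"

definition growth_order :: "(complex \<Rightarrow> complex) \<Rightarrow> ereal" where
  "growth_order f = Limsup at_top (\<lambda>r. ereal (log_plus (characteristic f r) / ln r))"

text \<open>The exponent of convergence of the zeros, meaningful for \<open>g\<close> not identically zero.\<close>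

definition zero_exponent :: "(complex \<Rightarrow> complex) \<Rightarrow> ereal" where
  "zero_exponent g =
     Limsup at_top (\<lambda>r. ereal (log_plus (counting_int (\<lambda>z. 1 / g z) r) / ln r))"

section \<open>Small quantities and small functions\<close>

definition finite_log_measure :: "real set \<Rightarrow> bool" where
  "finite_log_measure F \<longleftrightarrow>
     F \<in> sets lebesgue \<and> set_nn_integral lebesgue (F \<inter> {1..}) (\<lambda>t. ennreal (1 / t)) < \<infinity>"

definition at_top_outside :: "real set \<Rightarrow> real filter" where
  "at_top_outside F = inf at_top (principal (- F))"

text \<open>The quantity \<open>u(r)\<close> is an \<open>S(r, f)\<close>.\<close>

definition S_quantity :: "(complex \<Rightarrow> complex) \<Rightarrow> (real \<Rightarrow> real) \<Rightarrow> bool" where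
  "S_quantity f u \<longleftrightarrow>
     (\<exists>F. finite_log_measure F \<and> u \<in> o[at_top_outside F](characteristic f))"

text \<open>
  The quantity \<open>u(r)\<close> is an \<open>S\<^sub>\<lambda>(r, f)\<close>, where \<open>lam\<close> stands for \<open>\<lambda>\<close>. This is meant for \<open>f\<close> of finite
  order \<open>\<rho>\<close> and \<open>lam < \<rho>\<close>, so that \<open>\<epsilon>\<close> ranges over \<open>(0, \<rho> - lam)\<close>.
\<close>

definition S_lam_quantity :: "real \<Rightarrow> (complex \<Rightarrow> complex) \<Rightarrow> (real \<Rightarrow> real) \<Rightarrow> bool" where
  "S_lam_quantity lam f u \<longleftrightarrow>
     (\<forall>\<epsilon>. 0 < \<epsilon> \<and> ereal (lam + \<epsilon>) < growth_order f \<longrightarrow>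
        (\<exists>F v w. finite_log_measure F \<and> v \<in> O[at_top_outside F](\<lambda>r. r powr (lam + \<epsilon>)) \<and>
           S_quantity f w \<and> (\<forall>\<^sub>F r in at_top_outside F. u r = v r + w r)))"

definition lam_small_function :: "real \<Rightarrow> (complex \<Rightarrow> complex) \<Rightarrow> (complex \<Rightarrow> complex) \<Rightarrow> bool" where
  "lam_small_function lam f a \<longleftrightarrow>
     a meromorphic_on UNIV \<and> S_lam_quantity lam f (characteristic a)"

definition small_function :: "(complex \<Rightarrow> complex) \<Rightarrow> (complex \<Rightarrow> complex) \<Rightarrow> bool" where
  "small_function f a \<longleftrightarrow> a meromorphic_on UNIV \<and> S_quantity f (characteristic a)"

text \<open>
  For meromorphic functions, \<open>g \<equiv> \<beta>\<close> means equality up to a set without limit points. The case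
  \<open>g \<equiv> \<beta>\<close> is excluded because the exponent of convergence of \<open>g - \<beta>\<close> is then undefined.
\<close>

definition borel_exceptional_function :: "(complex \<Rightarrow> complex) \<Rightarrow> (complex \<Rightarrow> complex) \<Rightarrow> bool" where
  "borel_exceptional_function g \<beta> \<longleftrightarrow>
     g meromorphic_on UNIV \<and> growth_order g < \<infinity> \<and> small_function g \<beta> \<and>
     \<not> (\<forall>\<^sub>\<approx>z\<in>UNIV. g z = \<beta> z) \<and>
     zero_exponent (\<lambda>z. g z - \<beta> z) < growth_order g"

definition borel_exceptional_value :: "(complex \<Rightarrow> complex) \<Rightarrow> complex \<Rightarrow> bool" where
  "borel_exceptional_value g d \<longleftrightarrow> borel_exceptional_function g (\<lambda>_. d)"

definition transcendental_entire :: "(complex \<Rightarrow> complex) \<Rightarrow> bool" where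
  "transcendental_entire f \<longleftrightarrow> f holomorphic_on UNIV \<and> \<not> (\<exists>p. \<forall>z. f z = poly p z)"

end

theory Submission
  imports Defs "HOL-Real_Asymp.Real_Asymp"
begin

text \<open>
  Hadamard's factorization gives \<open>f = d + P w\<close> with \<open>w = exp p\<close>, \<open>p\<close> a polynomial of degree \<open>\<rho>\<close> and \<open>P\<close> of
  order less than \<open>\<rho>\<close>. As \<open>T(r, f)\<close> grows like \<open>r\<^sup>\<rho>\<close>, every \<open>\<lambda>\<close>-small entire coefficient \<open>g\<close> satisfies
  \<open>log |g(z)| \<le> o(|z|\<^sup>\<rho>)\<close> without exceptional sets; entire functions with this property are closed
  under sums, products, shifts and derivatives. Hence \<open>\<Phi>\<^sub>2 - \<beta> = C + D w + E w\<^sup>2\<close> with such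
  coefficients, where \<open>C = (\<Sum>b\<^sub>j) d - \<alpha> d\<^sup>2 - \<beta>\<close> and \<open>E = - \<alpha> P\<^sup>2\<close>. If \<open>C\<close> does not vanish identically, eliminating
  the leading term from \<open>G = \<Phi>\<^sub>2 - \<beta>\<close> and \<open>G'\<close>, and then once more, leaves a function that does not
  involve \<open>w\<close>, so that the lemma on the logarithmic derivative yields \<open>m(r, 1/G) = o(r\<^sup>\<rho>)\<close> and Jensen's formula
  yields \<open>N(r, 1/G) = m(r, G) + o(r\<^sup>\<rho>)\<close>. If \<open>C = 0\<close>, the same applies to \<open>D + E w\<close>, unless \<open>D = 0\<close>,
  when \<open>\<Phi>\<^sub>2 - \<beta> = - \<alpha> (f - d)\<^sup>2\<close>.
\<close>

section \<open>Circle means and Taylor coefficients\<close>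

text \<open>Smallness is given for means over circles and only outside exceptional sets, whereas an
  exponent of convergence is an upper limit over all radii. Two facts about entire functions bridge
  this. The values at |z| = x are controlled by one mean over a circle of radius R in [2x, 4x], and
  R can avoid any set of finite logarithmic measure if x is large. Moreover N(r, 1/G) increases with
  r. Conversely, the estimates proved here fail only on null sets of radii: since log |G| grows at
  most like r^\<rho>, the estimate of G'/G may compare r with a fixed multiple of r. Blaschke
  factorization is the common source of Jensen's formula, of the pointwise bound and of the estimate
  of G'/G. Elimination: if (E w^2)' = K w^2, then X = K G - E G' has no term in w^2. Its w-free part
  X0 = K C - E C' is the Wronskian of C and E w^2 divided by w^2, nonzero because w outgrows every
  quotient of coefficients. From 1/G = (1/X) (K - E G'/G), smallness of m(r, 1/X) passes to m(r,
  1/G).\<close>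

lemma log_plus_nonneg [simp]: "0 \<le> log_plus x"
  by (simp add: log_plus_def)

lemma log_plus_mono: "x \<le> y \<Longrightarrow> log_plus x \<le> log_plus y"
  by (simp add: log_plus_def)

lemma ln_le_log_plus: "0 < x \<Longrightarrow> ln x \<le> log_plus x"
  by (simp add: log_plus_def)

lemma log_plus_exp [simp]: "log_plus (exp x) = max 0 x"
  by (auto simp: log_plus_def max_def)

lemma log_plus_mult:
  assumes "0 \<le> x" "0 \<le> y" shows "log_plus (x * y) \<le> log_plus x + log_plus y"
proof -
  have "max 1 (x * y) \<le> max 1 x * max 1 y"
    using assms mult_mono[of 1 "max 1 x" 1 "max 1 y"] mult_mono[of x "max 1 x" y "max 1 y"] by auto
  then have "log_plus (x * y) \<le> ln (max 1 x * max 1 y)"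
    unfolding log_plus_def by (subst ln_le_cancel_iff) auto
  also have "\<dots> = log_plus x + log_plus y"
    unfolding log_plus_def by (rule ln_mult_pos) auto
  finally show ?thesis .
qed

lemma log_plus_add:
  assumes "0 \<le> x" "0 \<le> y" shows "log_plus (x + y) \<le> log_plus x + log_plus y + ln 2"
proof -
  have "x + y \<le> 2 * max x y" by auto
  then have "log_plus (x + y) \<le> log_plus (2 * max x y)" by (rule log_plus_mono)
  also have "\<dots> \<le> log_plus 2 + log_plus (max x y)" using assms by (intro log_plus_mult) auto
  also have "log_plus (max x y) \<le> log_plus x + log_plus y"
    by (cases "x \<le> y") (auto simp: max_def)
  finally show ?thesis by (simp add: log_plus_def)
qed

lemma ln_eq_log_plus_diff: "0 < x \<Longrightarrow> ln x = log_plus x - log_plus (1 / x)"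
  by (cases "x \<ge> 1") (auto simp: log_plus_def max_def ln_div)

lemma continuous_on_log_plus [continuous_intros]:
  "continuous_on S f \<Longrightarrow> continuous_on S (\<lambda>x. log_plus (f x))"
  unfolding log_plus_def by (intro continuous_intros) auto

section \<open>Means over circles centred at the origin\<close>

text \<open>\<open>integral\<close> has the default value 0 on non-integrable functions, so the mean
  carries information only for integrable integrands; continuity on the circle guarantees this in
  the laws below.\<close>

definition circle_mean :: "(complex \<Rightarrow> real) \<Rightarrow> real \<Rightarrow> real" where
  "circle_mean u r = 1 / (2 * pi) * integral {0..2 * pi} (\<lambda>\<theta>. u (of_real r * cis \<theta>))"

lemma proximity_eq_circle_mean: "proximity f r = circle_mean (\<lambda>z. log_plus (norm (f z))) r"
  by (simp add: proximity_def circle_mean_def)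

lemma continuous_on_circle:
  fixes u :: "complex \<Rightarrow> 'a::topological_space"
  assumes "0 \<le> r" "continuous_on (sphere 0 r) u"
  shows "continuous_on A (\<lambda>\<theta>. u (of_real r * cis \<theta>))"
proof (rule continuous_on_compose2[OF assms(2)])
  show "continuous_on A (\<lambda>\<theta>. of_real r * cis \<theta>)"
    by (intro continuous_intros)
qed (use assms in \<open>auto simp: norm_mult\<close>)

lemma circle_integrable:
  fixes u :: "complex \<Rightarrow> 'a::banach"
  assumes "0 \<le> r" "continuous_on (sphere 0 r) u"
  shows "(\<lambda>\<theta>. u (of_real r * cis \<theta>)) integrable_on {0..2 * pi}"
  by (intro integrable_continuous_real continuous_on_circle assms)

lemma circle_mean_mono:
  assumes "0 \<le> r" "continuous_on (sphere 0 r) u" "continuous_on (sphere 0 r) v"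
    and "\<And>z. norm z = r \<Longrightarrow> u z \<le> v z"
  shows "circle_mean u r \<le> circle_mean v r"
proof -
  have "integral {0..2 * pi} (\<lambda>\<theta>. u (of_real r * cis \<theta>)) \<le> integral {0..2 * pi} (\<lambda>\<theta>. v (of_real r * cis \<theta>))"
    using assms by (intro integral_le circle_integrable) (auto simp: norm_mult)
  then show ?thesis by (simp add: circle_mean_def divide_right_mono)
qed

lemma circle_mean_cong:
  assumes "0 \<le> r" "\<And>z. norm z = r \<Longrightarrow> u z = v z"
  shows "circle_mean u r = circle_mean v r"
proof -
  have "u (of_real r * cis \<theta>) = v (of_real r * cis \<theta>)" for \<theta> using assms by (simp add: norm_mult)
  then show ?thesis by (simp add: circle_mean_def)
qed

lemma circle_mean_const [simp]: "circle_mean (\<lambda>_. c) r = c"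
  by (simp add: circle_mean_def)

lemma circle_mean_add:
  assumes "0 \<le> r" "continuous_on (sphere 0 r) u" "continuous_on (sphere 0 r) v"
  shows "circle_mean (\<lambda>z. u z + v z) r = circle_mean u r + circle_mean v r"
  using circle_integrable[OF assms(1,2)] circle_integrable[OF assms(1,3)]
  by (simp add: circle_mean_def integral_add algebra_simps add_divide_distrib)

lemma circle_mean_cmult: "circle_mean (\<lambda>z. c * u z) r = c * circle_mean u r"
  by (simp add: circle_mean_def)

lemma circle_mean_diff:
  assumes "0 \<le> r" "continuous_on (sphere 0 r) u" "continuous_on (sphere 0 r) v"
  shows "circle_mean (\<lambda>z. u z - v z) r = circle_mean u r - circle_mean v r"
  using circle_integrable[OF assms(1,2)] circle_integrable[OF assms(1,3)]
  by (simp add: circle_mean_def integral_diff algebra_simps diff_divide_distrib)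

lemma circle_mean_sum:
  assumes "finite S" "0 \<le> r" "\<And>i. i \<in> S \<Longrightarrow> continuous_on (sphere 0 r) (u i)"
  shows "circle_mean (\<lambda>z. \<Sum>i\<in>S. u i z) r = (\<Sum>i\<in>S. circle_mean (u i) r)"
  using assms
  by (induction S rule: finite_induct) (simp_all add: circle_mean_add continuous_on_sum)

lemma circle_mean_nonneg:
  assumes "0 \<le> r" "continuous_on (sphere 0 r) u" "\<And>z. norm z = r \<Longrightarrow> 0 \<le> u z"
  shows "0 \<le> circle_mean u r"
  using circle_mean_mono[of r "\<lambda>_. 0" u] assms by simp

section \<open>Fourier coefficients on a circle and Taylor coefficients\<close>

text \<open>Cauchy's formula for the n-th derivative at 0, with the circle parametrised by r
  \<open>cis\<close> \<theta>: there dz / z^(n+1) becomes \<i> r^(-n) \<open>cis\<close> (- n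
  \<theta>) d\<theta>.\<close>

lemma circle_fourier_pos:
  assumes h: "h holomorphic_on ball 0 R" and r: "0 < r" "r < R"
  shows "integral {0..2 * pi} (\<lambda>\<theta>. h (of_real r * cis \<theta>) * cis (- (real n * \<theta>)))
           = of_real (2 * pi) * of_real r ^ n * ((deriv ^^ n) h (0::complex) / fact n)"
proof -
  have "((\<lambda>u. h u / (u - 0) ^ Suc n) has_contour_integral (2 * of_real pi * \<i>) / fact n * (deriv ^^ n) h (0::complex)) (circlepath 0 r)"
  proof -
    have "continuous_on (cball 0 r) h" "h holomorphic_on ball 0 r"
      using r by (auto intro!: holomorphic_on_imp_continuous_on holomorphic_on_subset[OF h])
    from Cauchy_has_contour_integral_higher_derivative_circlepath[OF this, of 0 n] r show ?thesis by simp
  qed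
  then have "((\<lambda>\<theta>. h (of_real r * cis \<theta>) / (of_real r * cis \<theta>) ^ Suc n * (of_real r * \<i> * cis \<theta>))
      has_integral (2 * of_real pi * \<i>) / fact n * (deriv ^^ n) h (0::complex)) {0..2*pi}"
    unfolding circlepath_def
    by (subst (asm) has_contour_integral_part_circlepath_iff) (simp_all del: power_Suc add: mult.assoc)
  moreover have "h (of_real r * cis \<theta>) / (of_real r * cis \<theta>) ^ Suc n * (of_real r * \<i> * cis \<theta>)
      = \<i> / of_real r ^ n * (h (of_real r * cis \<theta>) * cis (- (real n * \<theta>)))" for \<theta>
  proof -
    have "cis \<theta> / cis \<theta> ^ Suc n = inverse (cis \<theta> ^ n)" by (simp add: field_simps)
    also have "\<dots> = cis (- (real n * \<theta>))" by (simp only: Complex.DeMoivre cis_inverse)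
    finally have "cis \<theta> / cis \<theta> ^ Suc n = cis (- (real n * \<theta>))" .
    then show ?thesis using r by (simp add: field_simps power_mult_distrib)
  qed
  ultimately have *: "((\<lambda>\<theta>. \<i> / of_real r ^ n * (h (of_real r * cis \<theta>) * cis (- (real n * \<theta>))))
      has_integral (2 * of_real pi * \<i>) / fact n * (deriv ^^ n) h (0::complex)) {0..2*pi}" by simp
  have "((\<lambda>\<theta>. (of_real r ^ n / \<i>) * (\<i> / of_real r ^ n * (h (of_real r * cis \<theta>) * cis (- (real n * \<theta>)))))
      has_integral (of_real r ^ n / \<i>) * ((2 * of_real pi * \<i>) / fact n * (deriv ^^ n) h (0::complex))) {0..2*pi}"
    by (rule has_integral_mult_right[OF *])
  then have "((\<lambda>\<theta>. h (of_real r * cis \<theta>) * cis (- (real n * \<theta>)))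
      has_integral of_real (2 * pi) * of_real r ^ n * ((deriv ^^ n) h (0::complex) / fact n)) {0..2*pi}"
    using r by (simp add: field_simps)
  then show ?thesis by (rule integral_unique)
qed

text \<open>Cauchy's theorem for h(z) z^n. The factor dz contributes one more \<open>cis\<close>
  \<theta>, hence the index \<open>Suc n\<close>.\<close>

lemma circle_fourier_neg:
  assumes h: "h holomorphic_on ball 0 R" and r: "0 < r" "r < R"
  shows "integral {0..2 * pi} (\<lambda>\<theta>. h (of_real r * cis \<theta>) * cis (real (Suc n) * \<theta>)) = 0"
proof -
  have "((\<lambda>u. h u * u ^ n) has_contour_integral 0) (circlepath 0 r)"
    using r by (intro Cauchy_theorem_convex_simple[of _ "ball 0 R"] holomorphic_intros h) auto
  then have *: "((\<lambda>\<theta>. h (of_real r * cis \<theta>) * (of_real r * cis \<theta>) ^ n * (of_real r * \<i> * cis \<theta>))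
      has_integral 0) {0..2*pi}"
    unfolding circlepath_def
    by (subst (asm) has_contour_integral_part_circlepath_iff) (auto simp: mult_ac)
  have "h (of_real r * cis \<theta>) * (of_real r * cis \<theta>) ^ n * (of_real r * \<i> * cis \<theta>)
      = \<i> * of_real r ^ Suc n * (h (of_real r * cis \<theta>) * cis (real (Suc n) * \<theta>))" for \<theta>
  proof -
    have *: "cis (real (Suc n) * \<theta>) = cis \<theta> ^ n * cis \<theta>"
      by (simp only: Complex.DeMoivre[symmetric] power_Suc2)
    show ?thesis unfolding * by (simp add: power_mult_distrib algebra_simps)
  qed
  with * have *: "((\<lambda>\<theta>. \<i> * of_real r ^ Suc n * (h (of_real r * cis \<theta>) * cis (real (Suc n) * \<theta>)))
      has_integral 0) {0..2*pi}" by simp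
  have "((\<lambda>\<theta>. (1 / (\<i> * of_real r ^ Suc n)) * (\<i> * of_real r ^ Suc n * (h (of_real r * cis \<theta>) * cis (real (Suc n) * \<theta>))))
      has_integral (1 / (\<i> * of_real r ^ Suc n)) * 0) {0..2*pi}"
    by (rule has_integral_mult_right[OF *])
  then have "((\<lambda>\<theta>. h (of_real r * cis \<theta>) * cis (real (Suc n) * \<theta>)) has_integral 0) {0..2*pi}"
    using r by (simp add: field_simps)
  then show ?thesis by (rule integral_unique)
qed

text \<open>The mean value property, read off from the Fourier coefficient of index 0.\<close>

lemma circle_mean_Re:
  assumes h: "h holomorphic_on ball 0 R" and r: "0 < r" "r < R"
  shows "circle_mean (\<lambda>z. Re (h z)) r = Re (h 0)"
proof -
  have cont: "continuous_on (sphere 0 r) h"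
    using r by (intro holomorphic_on_imp_continuous_on holomorphic_on_subset[OF h]) auto
  have "integral {0..2 * pi} (\<lambda>\<theta>. h (of_real r * cis \<theta>)) = of_real (2 * pi) * h 0"
    using circle_fourier_pos[OF assms, of 0] by (simp flip: cis_conv_exp)
  moreover have "integral {0..2 * pi} (\<lambda>\<theta>. Re (h (of_real r * cis \<theta>))) = Re (integral {0..2 * pi} (\<lambda>\<theta>. h (of_real r * cis \<theta>)))"
    using integral_linear[OF circle_integrable[OF _ cont] bounded_linear_Re] r by (simp add: o_def)
  ultimately show ?thesis by (simp add: circle_mean_def)
qed

text \<open>The conjugate of \<open>h\<close> has no Fourier coefficients of positive index, so those of
  \<open>Re h\<close> are half the Taylor coefficients of \<open>h\<close>.\<close>

lemma taylor_coeff_bound: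
  assumes h: "h holomorphic_on ball 0 R" and r: "0 < r" "r < R" and n: "0 < n"
  shows "norm ((deriv ^^ n) h (0::complex) / fact n) * r ^ n \<le> 2 * circle_mean (\<lambda>z. \<bar>Re (h z)\<bar>) r"
proof -
  obtain k where k: "n = Suc k" using n by (cases n) auto
  have cont: "continuous_on (sphere 0 r) h"
    using r by (intro holomorphic_on_imp_continuous_on holomorphic_on_subset[OF h]) auto
  have cont': "continuous_on {0..2*pi} (\<lambda>\<theta>. h (of_real r * cis \<theta>))"
    using continuous_on_circle[OF _ cont] r by auto
  let ?H = "\<lambda>\<theta>. h (of_real r * cis \<theta>)"
  have "integral {0..2 * pi} (\<lambda>\<theta>. cnj (?H \<theta> * cis (real n * \<theta>))) = cnj (integral {0..2 * pi} (\<lambda>\<theta>. ?H \<theta> * cis (real n * \<theta>)))"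
    using integral_linear[OF integrable_continuous_real bounded_linear_cnj, of 0 "2 * pi" "\<lambda>\<theta>. ?H \<theta> * cis (real n * \<theta>)"]
    by (simp add: o_def continuous_intros cont')
  also have "\<dots> = 0" using circle_fourier_neg[OF h r, of k] k by simp
  finally have *: "integral {0..2 * pi} (\<lambda>\<theta>. cnj (?H \<theta>) * cis (- (real n * \<theta>))) = 0"
    by (simp add: cis_cnj)
  have "2 * integral {0..2 * pi} (\<lambda>\<theta>. of_real (Re (?H \<theta>)) * cis (- (real n * \<theta>)))
      = integral {0..2 * pi} (\<lambda>\<theta>. 2 * (of_real (Re (?H \<theta>)) * cis (- (real n * \<theta>))))" by simp
  also have "\<dots> = integral {0..2 * pi} (\<lambda>\<theta>. ?H \<theta> * cis (- (real n * \<theta>)) + cnj (?H \<theta>) * cis (- (real n * \<theta>)))"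
    by (intro integral_cong) (simp add: complex_eq_iff algebra_simps)
  also have "\<dots> = integral {0..2 * pi} (\<lambda>\<theta>. ?H \<theta> * cis (- (real n * \<theta>))) + integral {0..2 * pi} (\<lambda>\<theta>. cnj (?H \<theta>) * cis (- (real n * \<theta>)))"
    by (intro integral_add integrable_continuous_real continuous_intros cont')
  also have "\<dots> = of_real (2 * pi) * of_real r ^ n * ((deriv ^^ n) h (0::complex) / fact n)"
    using circle_fourier_pos[OF h r, of n] * by simp
  finally have eq: "2 * integral {0..2 * pi} (\<lambda>\<theta>. of_real (Re (?H \<theta>)) * cis (- (real n * \<theta>))) = of_real (2 * pi) * of_real r ^ n * ((deriv ^^ n) h (0::complex) / fact n)" .
  have "norm (integral {0..2 * pi} (\<lambda>\<theta>. of_real (Re (?H \<theta>)) * cis (- (real n * \<theta>)))) \<le> integral {0..2*pi} (\<lambda>\<theta>. \<bar>Re (?H \<theta>)\<bar>)"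
    by (intro integral_norm_bound_integral integrable_continuous_real continuous_intros cont')
      (auto simp: norm_mult)
  moreover have "norm (2 * integral {0..2 * pi} (\<lambda>\<theta>. of_real (Re (?H \<theta>)) * cis (- (real n * \<theta>)))) = 2 * pi * r ^ n * norm ((deriv ^^ n) h (0::complex) / fact n)"
    unfolding eq using r by (simp add: norm_mult norm_divide norm_power)
  ultimately have "2 * pi * r ^ n * norm ((deriv ^^ n) h (0::complex) / fact n) \<le> 2 * integral {0..2*pi} (\<lambda>\<theta>. \<bar>Re (?H \<theta>)\<bar>)"
    by (simp add: norm_mult)
  then show ?thesis by (simp add: circle_mean_def field_simps)
qed

text \<open>A Borel-Caratheodory estimate with a mean of |Re h| in place of a maximum, since only
  means will be available. The Taylor coefficients are at most M r^(-n), so for |z| \<le> r/2 the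
  series without its constant term is dominated by M (1/2 + 1/4 + ...).\<close>

lemma holomorphic_diff_bound:
  assumes h: "h holomorphic_on ball 0 R" and r: "0 < r" "r < R" and z: "norm z \<le> r / 2"
  shows "norm (h z - h 0) \<le> 2 * circle_mean (\<lambda>z. \<bar>Re (h z)\<bar>) r"
proof -
  define M where "M = 2 * circle_mean (\<lambda>z. \<bar>Re (h z)\<bar>) r"
  define a where "a n = (deriv ^^ n) h (0::complex) / fact n" for n
  have cf: "norm (a n) * r ^ n \<le> M" if "0 < n" for n
    using taylor_coeff_bound[OF h r that] by (simp add: a_def M_def)
  have "(\<lambda>n. a n * (z - 0) ^ n) sums h z"
    unfolding a_def by (rule holomorphic_power_series[OF h]) (use z r in auto)
  then have "(\<lambda>n. a (Suc n) * z ^ Suc n) sums (h z - h 0)"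
    using sums_split_initial_segment[of "\<lambda>n. a n * z ^ n" "h z" 1] by (simp add: a_def)
  moreover have geo: "(\<lambda>n. M * (1/2) ^ Suc n) sums (M * 1)"
    by (intro sums_mult power_half_series)
  moreover have bd: "norm (a (Suc n) * z ^ Suc n) \<le> M * (1/2) ^ Suc n" for n
  proof -
    have "norm (a (Suc n) * z ^ Suc n) = norm (a (Suc n)) * norm z ^ Suc n" by (simp add: norm_mult norm_power)
    also have "\<dots> \<le> norm (a (Suc n)) * (r / 2) ^ Suc n" using z r by (intro mult_left_mono power_mono) auto
    also have "\<dots> = (norm (a (Suc n)) * r ^ Suc n) * (1/2) ^ Suc n" by (simp add: power_divide)
    also have "\<dots> \<le> M * (1/2) ^ Suc n" using cf[of "Suc n"] by (intro mult_right_mono) auto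
    finally show ?thesis .
  qed
  ultimately have "norm (h z - h 0) \<le> M"
    using norm_suminf_le[OF bd sums_summable[OF geo]] by (simp only: sums_iff mult_1_right)
  then show ?thesis by (simp add: M_def)
qed

text \<open>The disc of radius r/4 around z stays in |y| \<le> r/2, where h - h(0) is already
  bounded by twice the mean; Cauchy's inequality turns 2 into 8 / r.\<close>

lemma holomorphic_deriv_bound:
  assumes h: "h holomorphic_on ball 0 R" and r: "0 < r" "r < R" and z: "norm z \<le> r / 4"
  shows "norm (deriv h z) \<le> 8 * circle_mean (\<lambda>z. \<bar>Re (h z)\<bar>) r / r"
proof -
  define M where "M = 2 * circle_mean (\<lambda>z. \<bar>Re (h z)\<bar>) r"
  have sub: "cball z (r/4) \<subseteq> ball 0 R"
  proof
    fix y assume "y \<in> cball z (r/4)"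
    then have "norm (y - z) \<le> r/4" by (simp add: dist_norm norm_minus_commute)
    then have "norm y \<le> r/2" using z norm_triangle_sub[of y z] by linarith
    then show "y \<in> ball 0 R" using r by simp
  qed
  have h': "(\<lambda>w. h w - h 0) holomorphic_on ball 0 R" by (intro holomorphic_intros h)
  have "norm ((deriv ^^ 1) (\<lambda>w. h w - h 0) z) \<le> fact 1 * M / (r/4) ^ 1"
  proof (rule Cauchy_inequality)
    show "(\<lambda>w. h w - h 0) holomorphic_on ball z (r/4)" using sub ball_subset_cball by (intro holomorphic_on_subset[OF h']) blast
    show "continuous_on (cball z (r/4)) (\<lambda>w. h w - h 0)"
      using sub h' by (auto intro: holomorphic_on_imp_continuous_on holomorphic_on_subset)
    fix x assume "norm (z - x) = r/4"
    then have "norm x \<le> r/2" using z norm_triangle_sub[of x z] by (simp add: norm_minus_commute)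
    then show "norm (h x - h 0) \<le> M" using holomorphic_diff_bound[OF h r] by (simp add: M_def)
  qed (use r in auto)
  moreover have "deriv (\<lambda>w. h w - h 0) z = deriv h z"
  proof -
    have "h field_differentiable at z"
      using h z r by (auto intro!: holomorphic_on_imp_differentiable_at)
    then show ?thesis by (simp add: deriv_diff)
  qed
  ultimately show ?thesis by (simp add: M_def field_simps)
qed

section \<open>Blaschke factorization on a disc\<close>

lemma finite_zeros_cball:
  assumes "G holomorphic_on UNIV" "\<exists>z. G z \<noteq> 0"
  shows "finite {z. norm z \<le> R \<and> G z = 0}"
proof (cases "G constant_on UNIV")
  case True
  then have "{z. norm z \<le> R \<and> G z = 0} = {}" using assms(2) by (auto simp: constant_on_def)
  then show ?thesis by (simp only: finite.emptyI)
next
  case False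
  have "finite {z \<in> cball 0 R. G z = 0}"
    by (rule holomorphic_compact_finite_zeros[of G UNIV]) (use assms False in auto)
  then show ?thesis by (simp add: dist_norm)
qed

lemma countable_zero_radii:
  assumes "G holomorphic_on UNIV" "\<exists>z. G z \<noteq> 0"
  shows "countable {norm z | z. G z = 0}"
proof -
  have "{norm z | z. G z = 0} \<subseteq> (\<Union>n::nat. norm ` {z. norm z \<le> real n \<and> G z = 0})"
  proof
    fix x assume "x \<in> {norm z | z. G z = 0}"
    then obtain z where z: "x = norm z" "G z = 0" by auto
    obtain n :: nat where "norm z \<le> real n" using real_arch_simple by blast
    then show "x \<in> (\<Union>n::nat. norm ` {z. norm z \<le> real n \<and> G z = 0})" using z by auto
  qed
  moreover have "countable (\<Union>n::nat. norm ` {z. norm z \<le> real n \<and> G z = 0})"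
    by (rule countable_UN[OF countableI_type countable_finite[OF finite_imageI[OF finite_zeros_cball[OF assms]]]])
  ultimately show ?thesis by (rule countable_subset)
qed

text \<open>\<open>zor_poly\<close> describes the cofactor only near a, so it is used on a disc and
  the quotient elsewhere; both agree on the overlap. At a point with G(a) \<noteq> 0 the order is 0,
  so no case distinction on a is left to the user.\<close>

lemma entire_factor_zero:
  assumes "G holomorphic_on UNIV" "\<exists>z. G z \<noteq> 0"
  obtains g where "g holomorphic_on UNIV" "\<And>z. G z = (z - a) ^ nat (zorder G a) * g z" "g a \<noteq> 0"
proof -
  define n p where "n = nat (zorder G a)" and "p = zor_poly G a"
  obtain r where r: "r > 0" "p holomorphic_on cball a r"
      "\<And>w. w \<in> cball a r \<Longrightarrow> G w = p w * (w - a) ^ n \<and> p w \<noteq> 0"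
  proof -
    have "\<exists>w\<in>UNIV. G w \<noteq> 0" using assms(2) by simp
    from conjunct2[OF zorder_exist_zero[OF assms(1) open_UNIV connected_UNIV UNIV_I this, of a]] that
    show ?thesis unfolding n_def p_def by metis
  qed
  define g where "g z = (if z \<in> cball a r then p z else G z / (z - a) ^ n)" for z
  have eq: "G z = (z - a) ^ n * g z" for z
    using r by (auto simp: g_def)
  have "g holomorphic_on (ball a r \<union> - {a})"
  proof (rule holomorphic_on_Un)
    have "p holomorphic_on ball a r" using r ball_subset_cball by (blast intro: holomorphic_on_subset)
    then show "g holomorphic_on ball a r"
      by (rule holomorphic_transform) (simp add: g_def)
    have "(\<lambda>z. G z / (z - a) ^ n) holomorphic_on - {a}"
      by (intro holomorphic_intros holomorphic_on_subset[OF assms(1)]) auto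
    then show "g holomorphic_on - {a}"
      by (rule holomorphic_transform) (simp add: eq)
  qed auto
  moreover have "ball a r \<union> - {a} = UNIV" using r by auto
  moreover have "g a \<noteq> 0" using r by (auto simp: g_def)
  ultimately show ?thesis using that eq by (auto simp: n_def)
qed

lemma zorder_factor:
  assumes "\<And>z. G z = (z - a) ^ n * g z" "g holomorphic_on UNIV" "g a \<noteq> 0"
  shows "zorder G a = int n"
  by (rule zorder_eqI[of UNIV a g]) (use assms in auto)

lemma entire_factor_zeros:
  assumes "finite S" "G holomorphic_on UNIV" "\<exists>z. G z \<noteq> 0"
  shows "\<exists>g. g holomorphic_on UNIV \<and> (\<forall>z. G z = (\<Prod>a\<in>S. (z - a) ^ nat (zorder G a)) * g z) \<and> (\<forall>a\<in>S. g a \<noteq> 0)"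
  using assms(1)
proof (induction S)
  case empty
  then show ?case using assms by auto
next
  case (insert a S)
  let ?p = "\<lambda>z. \<Prod>a\<in>S. (z - a) ^ nat (zorder G a)"
  obtain g where g: "g holomorphic_on UNIV" "\<And>z. G z = ?p z * g z" "\<And>a. a \<in> S \<Longrightarrow> g a \<noteq> 0"
    using insert by auto
  have "\<exists>z. g z \<noteq> 0" using g(2) assms(3) by auto
  then obtain g2 where g2: "g2 holomorphic_on UNIV" "\<And>z. g z = (z - a) ^ nat (zorder g a) * g2 z" "g2 a \<noteq> 0"
    using entire_factor_zero[OF g(1)] by metis
  \<comment> \<open>The factors split off earlier do not vanish at the new point, so
    \<open>g\<close> has the same order there as \<open>G\<close>.\<close>
  have "zorder G a = int (nat (zorder g a))"
  proof (rule zorder_factor)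
    show "G z = (z - a) ^ nat (zorder g a) * (?p z * g2 z)" for z
      using g(2)[of z] g2(2)[of z] by simp
    show "(\<lambda>z. ?p z * g2 z) holomorphic_on UNIV" by (intro holomorphic_intros g2)
    show "?p a * g2 a \<noteq> 0" using g2(3) insert.hyps by auto
  qed
  then have eq: "nat (zorder g a) = nat (zorder G a)" by simp
  have "G z = (\<Prod>a\<in>insert a S. (z - a) ^ nat (zorder G a)) * g2 z" for z
    using g(2)[of z] g2(2)[of z] insert.hyps eq by simp
  moreover have "g2 b \<noteq> 0" if "b \<in> insert a S" for b
    using that g2 g(3)[of b] by auto
  ultimately show ?case using g2(1) by blast
qed

lemma zorder_nonneg_entire:
  assumes "G holomorphic_on UNIV" "\<exists>z. G z \<noteq> 0"
  shows "0 \<le> zorder G a" "G a = 0 \<longleftrightarrow> 0 < zorder G a"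
proof -
  have "\<exists>w\<in>UNIV. G w \<noteq> 0" using assms(2) by simp
  from conjunct1[OF zorder_exist_zero[OF assms(1) open_UNIV connected_UNIV UNIV_I this, of a]]
  show "0 \<le> zorder G a" "G a = 0 \<longleftrightarrow> 0 < zorder G a" by (simp_all split: if_splits)
qed

text \<open>Translates the poles of 1/G, in terms of which N is defined, into zeros of G. The value
  1/0 = 0 at a zero is harmless because both notions look at punctured neighbourhoods only.\<close>

lemma
  assumes "G holomorphic_on UNIV" "\<exists>z. G z \<noteq> 0"
  shows is_pole_inverse_entire: "is_pole (\<lambda>z. 1 / G z) a \<longleftrightarrow> G a = 0"
    and zorder_inverse_entire: "zorder (\<lambda>z. 1 / G z) a = - zorder G a"
proof -
  obtain g where g: "g holomorphic_on UNIV" "\<And>z. G z = (z - a) ^ nat (zorder G a) * g z" "g a \<noteq> 0"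
    using entire_factor_zero[OF assms] by metis
  have op: "open {z. F z \<noteq> 0}" if "F holomorphic_on UNIV" for F :: "complex \<Rightarrow> complex"
  proof -
    have "continuous_on UNIV F" using that by (rule holomorphic_on_imp_continuous_on)
    then have "open (F -` (- {0}) \<inter> UNIV)" using continuous_on_open_vimage[of UNIV F] by auto
    then show ?thesis by (simp add: vimage_def)
  qed
  show "zorder (\<lambda>z. 1 / G z) a = - zorder G a"
  proof (rule zorder_eqI)
    show "open {z. g z \<noteq> 0}" by (rule op) fact
    show "(\<lambda>z. 1 / g z) holomorphic_on {z. g z \<noteq> 0}"
      by (intro holomorphic_intros holomorphic_on_subset[OF g(1)]) auto
    fix w assume w: "w \<in> {z. g z \<noteq> 0}" "w \<noteq> a"
    have "(w - a) powi (- zorder G a) = inverse ((w - a) ^ nat (zorder G a))"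
      using zorder_nonneg_entire(1)[OF assms, of a] by (simp add: power_int_def power_inverse)
    then show "1 / G w = 1 / g w * (w - a) powi - zorder G a"
      by (subst g(2)) (simp add: field_simps)
  qed (use g in auto)
  show "is_pole (\<lambda>z. 1 / G z) a \<longleftrightarrow> G a = 0"
  proof
    assume "is_pole (\<lambda>z. 1 / G z) a"
    moreover have "(\<lambda>z. 1 / G z) holomorphic_on {z. G z \<noteq> 0}"
      by (intro holomorphic_intros holomorphic_on_subset[OF assms(1)]) auto
    ultimately show "G a = 0" using not_is_pole_holomorphic[OF op[OF assms(1)], of a] by blast
  next
    assume "G a = 0"
    have "isCont G a"
      using holomorphic_on_imp_continuous_on[OF assms(1)] by (simp add: continuous_on_eq_continuous_at)
    then have "(G \<longlongrightarrow> 0) (at a)" using \<open>G a = 0\<close> by (simp add: isCont_def)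
    moreover have "eventually (\<lambda>z. G z \<noteq> 0) (at a)"
    proof -
      have "eventually (\<lambda>z. z \<in> {z. g z \<noteq> 0} - {a}) (at a)"
        by (rule eventually_at_in_open[OF op[OF g(1)]]) (use g in auto)
      then show ?thesis by (rule eventually_mono) (use g(2) in auto)
    qed
    ultimately have "filterlim G (at 0) (at a)" by (auto simp: filterlim_at)
    then show "is_pole (\<lambda>z. 1 / G z) a" by (intro is_pole_divide) auto
  qed
qed

text \<open>Circle means of logarithms are only considered for these radii, so that the integrands are
  continuous.\<close>

definition zero_free_radius :: "(complex \<Rightarrow> complex) \<Rightarrow> real \<Rightarrow> bool" where
  "zero_free_radius G r \<longleftrightarrow> (\<forall>z. norm z = r \<longrightarrow> G z \<noteq> 0)"

text \<open>The factor of the disc of radius R with a simple zero at a and modulus 1 on the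
  boundary; for a = 0 it is z / R. Its pole is the reflected point R^2 /
  \<open>cnj a\<close>.\<close>

definition blaschke :: "real \<Rightarrow> complex \<Rightarrow> complex \<Rightarrow> complex" where
  "blaschke R a z = of_real R * (z - a) / (of_real (R\<^sup>2) - cnj a * z)"

text \<open>The right-hand side is nonnegative in the disc and zero on its boundary, which gives
  both modulus statements about \<open>blaschke\<close>.\<close>

lemma blaschke_norm_identity:
  "(norm (of_real (R\<^sup>2) - cnj a * z))\<^sup>2 - (norm (of_real R * (z - a)))\<^sup>2 = (R\<^sup>2 - (norm z)\<^sup>2) * (R\<^sup>2 - (norm a)\<^sup>2)"
  unfolding cmod_power2 by (simp add: power2_eq_square algebra_simps)

lemma blaschke_denom_nonzero:
  assumes "norm a < R" "norm z \<le> R" shows "of_real (R\<^sup>2) - cnj a * z \<noteq> 0"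
proof
  assume "of_real (R\<^sup>2) - cnj a * z = 0"
  then have "norm (cnj a * z) = R\<^sup>2"
    by (metis abs_of_nonneg eq_iff_diff_eq_0 norm_of_real zero_le_power2)
  moreover have "norm (cnj a * z) < R\<^sup>2"
  proof -
    have "0 < R" using norm_ge_zero[of a] assms(1) by linarith
    then have "norm a * norm z < R * R"
      using mult_left_mono[OF assms(2) norm_ge_zero[of a]] mult_strict_right_mono[OF assms(1), of R] by linarith
    then show ?thesis by (simp add: norm_mult power2_eq_square)
  qed
  ultimately show False by simp
qed

lemma norm_blaschke_le:
  assumes "norm a < R" "norm z \<le> R" shows "norm (blaschke R a z) \<le> 1"
proof -
  have "(norm a)\<^sup>2 \<le> R\<^sup>2" "(norm z)\<^sup>2 \<le> R\<^sup>2" using assms by (auto intro!: power_mono)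
  then have "0 \<le> (R\<^sup>2 - (norm z)\<^sup>2) * (R\<^sup>2 - (norm a)\<^sup>2)" by (intro mult_nonneg_nonneg) auto
  then have "(norm (of_real R * (z - a)))\<^sup>2 \<le> (norm (of_real (R\<^sup>2) - cnj a * z))\<^sup>2"
    using blaschke_norm_identity[of R a z] by linarith
  then have "norm (of_real R * (z - a)) \<le> norm (of_real (R\<^sup>2) - cnj a * z)"
    by (rule power2_le_imp_le) simp
  then show ?thesis
    using blaschke_denom_nonzero[OF assms] unfolding blaschke_def norm_divide by (simp add: divide_le_eq_1)
qed

lemma norm_blaschke_eq:
  assumes "norm a < R" "norm z = R" shows "norm (blaschke R a z) = 1"
proof -
  have "(norm (of_real R * (z - a)))\<^sup>2 = (norm (of_real (R\<^sup>2) - cnj a * z))\<^sup>2"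
    using blaschke_norm_identity[of R a z] assms by simp
  then have "norm (of_real R * (z - a)) = norm (of_real (R\<^sup>2) - cnj a * z)"
    by simp
  then show ?thesis
    using blaschke_denom_nonzero[of a R z] assms unfolding blaschke_def norm_divide by simp
qed

text \<open>Dividing out the zeros in the disc leaves a zero-free function, which has a logarithm.
  As no zero lies on |z| = R, this works on a slightly larger disc, so that Cauchy's formula may be
  applied on the circle itself.\<close>

lemma blaschke_factorization:
  assumes G: "G holomorphic_on UNIV" "\<exists>z. G z \<noteq> 0" and R: "0 < R" "zero_free_radius G R"
  obtains h R' where "R < R'" "h holomorphic_on ball 0 R'"
    "\<And>z a. norm z < R' \<Longrightarrow> norm a < R \<Longrightarrow> G a = 0 \<Longrightarrow> of_real (R\<^sup>2) - cnj a * z \<noteq> 0"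
    "\<And>z. norm z < R' \<Longrightarrow> G z = (\<Prod>a | norm a < R \<and> G a = 0. blaschke R a z ^ nat (zorder G a)) * exp (h z)"
proof -
  define Z where "Z = {a. norm a < R \<and> G a = 0}"
  have finZ: "finite Z"
    by (rule finite_subset[OF _ finite_zeros_cball[OF G, of R]]) (auto simp: Z_def)
  obtain g where g: "g holomorphic_on UNIV" "\<And>z. G z = (\<Prod>a\<in>Z. (z - a) ^ nat (zorder G a)) * g z" "\<And>a. a \<in> Z \<Longrightarrow> g a \<noteq> 0"
    using entire_factor_zeros[OF finZ G] by auto
  \<comment> \<open>The radii that R' must not exceed: moduli of the next zeros outside the disc,
    moduli of the poles of the Blaschke factors, and R + 1, which also makes the set
    nonempty.\<close>
  define T where "T = norm ` {z. norm z \<le> R + 1 \<and> G z = 0 \<and> R < norm z} \<union> (\<lambda>a. R\<^sup>2 / norm a) ` (Z - {0}) \<union> {R + 1}"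
  have finT: "finite T" unfolding T_def
    by (intro finite_UnI finite_imageI finite_subset[OF _ finite_zeros_cball[OF G, of "R+1"]] finite_Diff finZ) auto
  define R' where "R' = Min T"
  have T: "T \<noteq> {}" by (simp add: T_def)
  have "R < t" if "t \<in> T" for t
  proof -
    have "R < R\<^sup>2 / norm a" if "a \<in> Z" "a \<noteq> 0" for a
      using that R by (simp add: Z_def field_simps power2_eq_square)
    then show ?thesis using that unfolding T_def by auto
  qed
  then have R': "R < R'" using finT T by (simp add: R'_def)
  have le: "R' \<le> t" if "t \<in> T" for t using that finT by (simp add: R'_def)
  have den: "of_real (R\<^sup>2) - cnj a * z \<noteq> 0" if "norm z < R'" "a \<in> Z" for z a
  proof (cases "a = 0")
    case False
    then have "R' \<le> R\<^sup>2 / norm a" using le that by (auto simp: T_def)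
    then have "norm z < R\<^sup>2 / norm a" using that by simp
    then have "norm (cnj a * z) < R\<^sup>2" using False by (simp add: norm_mult field_simps)
    then show ?thesis
      by (metis abs_of_nonneg eq_iff_diff_eq_0 less_irrefl norm_of_real zero_le_power2)
  qed (use R in auto)
  have gnz: "g z \<noteq> 0" if "norm z < R'" for z
  proof (cases "z \<in> Z")
    case False
    have "G z \<noteq> 0"
    proof
      assume z: "G z = 0"
      then have "norm z \<noteq> R" using R by (auto simp: zero_free_radius_def)
      then have "R < norm z" using False z by (auto simp: Z_def)
      moreover have "R' \<le> R + 1" using le by (auto simp: T_def)
      ultimately have "norm z \<in> T" using z that by (auto simp: T_def)
      then show False using le that by force
    qed
    then show ?thesis using g(2)[of z] by auto
  qed (use g in auto)
  \<comment> \<open>G divided by its Blaschke product, with the linear factors already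
    cancelled.\<close>
  define k where "k z = g z * (\<Prod>a\<in>Z. ((of_real (R\<^sup>2) - cnj a * z) / of_real R) ^ nat (zorder G a))" for z
  have kh: "k holomorphic_on ball 0 R'"
    unfolding k_def by (intro holomorphic_intros holomorphic_on_subset[OF g(1)]) (use R in auto)
  have knz: "k z \<noteq> 0" if "z \<in> ball 0 R'" for z
    using that gnz[of z] den[of z] R finZ by (auto simp: k_def)
  have "connected (ball (0::complex) R')" "contractible (ball (0::complex) R')"
    by (auto intro: convex_imp_contractible)
  then obtain h where h: "h holomorphic_on ball 0 R'" "\<And>z. z \<in> ball 0 R' \<Longrightarrow> k z = exp (h z)"
    using contractible_imp_holomorphic_log[OF kh] knz by metis
  have "G z = (\<Prod>a\<in>Z. blaschke R a z ^ nat (zorder G a)) * exp (h z)" if "norm z < R'" for z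
  proof -
    have "(\<Prod>a\<in>Z. blaschke R a z ^ nat (zorder G a)) * exp (h z)
        = (\<Prod>a\<in>Z. blaschke R a z ^ nat (zorder G a)) * k z"
      using h that by simp
    also have "\<dots> = (\<Prod>a\<in>Z. (blaschke R a z * ((of_real (R\<^sup>2) - cnj a * z) / of_real R)) ^ nat (zorder G a)) * g z"
      unfolding k_def power_mult_distrib prod.distrib by (simp only: mult_ac)
    also have "(\<Prod>a\<in>Z. (blaschke R a z * ((of_real (R\<^sup>2) - cnj a * z) / of_real R)) ^ nat (zorder G a))
        = (\<Prod>a\<in>Z. (z - a) ^ nat (zorder G a))"
      using den[OF that] R by (intro prod.cong refl arg_cong[where f = "\<lambda>x. x ^ _"]) (simp add: blaschke_def)
    finally show ?thesis using g(2)[of z] by simp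
  qed
  then show ?thesis using that[OF R' h(1)] den by (auto simp: Z_def)
qed

section \<open>Jensen's formula\<close>

lemma counting_inverse_entire:
  assumes "G holomorphic_on UNIV" "\<exists>z. G z \<noteq> 0"
  shows "counting (\<lambda>z. 1 / G z) t = (\<Sum>a | norm a \<le> t \<and> G a = 0. nat (zorder G a))"
  unfolding counting_def is_pole_inverse_entire[OF assms] zorder_inverse_entire[OF assms] by simp

lemma has_integral_inverse_ln:
  assumes "0 < (a::real)" "a \<le> R" shows "((\<lambda>t. m / t) has_integral m * ln (R / a)) {a..R}"
proof -
  have "((\<lambda>t. 1 / t) has_integral ln R - ln a) {a..R}"
    using assms by (intro fundamental_theorem_of_calculus)
      (auto intro!: derivative_eq_intros simp: has_real_derivative_iff_has_vector_derivative[symmetric])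
  from has_integral_mult_right[OF this, of m] show ?thesis
    using assms by (simp add: ln_div)
qed

text \<open>A zero a \<noteq> 0 is counted from t = |a| on and contributes the integral of 1/t over
  [|a|, R]; a zero at the origin is the value of the counting function at 0 and contributes ln
  R.\<close>

lemma counting_int_inverse_entire:
  assumes G: "G holomorphic_on UNIV" "\<exists>z. G z \<noteq> 0" and R: "0 < R"
  shows "counting_int (\<lambda>z. 1 / G z) R
     = (\<Sum>a | norm a \<le> R \<and> G a = 0 \<and> a \<noteq> 0. real (nat (zorder G a)) * ln (R / norm a))
       + real (nat (zorder G 0)) * ln R"
proof -
  define m where "m a = real (nat (zorder G a))" for a
  define Z where "Z = {a. norm a \<le> R \<and> G a = 0 \<and> a \<noteq> 0}"
  have finZ: "finite Z" unfolding Z_def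
    by (rule finite_subset[OF _ finite_zeros_cball[OF G, of R]]) auto
  have m0: "m a = 0" if "G a \<noteq> 0" for a
    using zorder_nonneg_entire[OF G, of a] that by (simp add: m_def)
  have cnt: "real (counting (\<lambda>z. 1 / G z) t) = (\<Sum>a\<in>Z. if norm a \<le> t then m a else 0) + m 0" if "0 \<le> t" "t \<le> R" for t
  proof -
    have "real (counting (\<lambda>z. 1 / G z) t) = (\<Sum>a | norm a \<le> t \<and> G a = 0. m a)"
      by (simp add: counting_inverse_entire[OF G] m_def)
    also have "\<dots> = (\<Sum>a\<in>{a \<in> insert 0 Z. norm a \<le> t}. m a)"
      by (rule sum.mono_neutral_left) (use that m0 finZ in \<open>auto simp: Z_def\<close>)
    also have "\<dots> = (\<Sum>a\<in>insert 0 Z. if norm a \<le> t then m a else 0)"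
      using finZ by (intro sum.inter_filter) auto
    also have "\<dots> = (\<Sum>a\<in>Z. if norm a \<le> t then m a else 0) + m 0"
      using that finZ by (subst sum.insert) (auto simp: Z_def)
    finally show ?thesis .
  qed
  have cnt0: "real (counting (\<lambda>z. 1 / G z) 0) = m 0"
  proof -
    have "(\<Sum>a\<in>Z. if norm a \<le> 0 then m a else 0) = 0" by (intro sum.neutral) (auto simp: Z_def)
    then show ?thesis using cnt[of 0] R by simp
  qed
  have "((\<lambda>t. \<Sum>a\<in>Z. if t \<in> {norm a..R} then m a / t else 0) has_integral (\<Sum>a\<in>Z. m a * ln (R / norm a))) {0..R}"
  proof (intro has_integral_sum finZ)
    fix a assume a: "a \<in> Z"
    show "((\<lambda>t. if t \<in> {norm a..R} then m a / t else 0) has_integral m a * ln (R / norm a)) {0..R}"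
      using a by (subst has_integral_restrict) (auto simp: Z_def intro!: has_integral_inverse_ln)
  qed
  \<comment> \<open>At t = 0 both sides are 0: the left one because no element of \<open>Z\<close>
    is 0, the right one because x / 0 = 0.\<close>
  moreover have "(\<Sum>a\<in>Z. if t \<in> {norm a..R} then m a / t else 0) = (real (counting (\<lambda>z. 1 / G z) t) - real (counting (\<lambda>z. 1 / G z) 0)) / t"
    if "t \<in> {0..R}" for t
    using that cnt[of t] cnt0 by (auto simp: sum_divide_distrib intro!: sum.cong)
  ultimately have "((\<lambda>t. (real (counting (\<lambda>z. 1 / G z) t) - real (counting (\<lambda>z. 1 / G z) 0)) / t) has_integral (\<Sum>a\<in>Z. m a * ln (R / norm a))) {0..R}"
    by (rule has_integral_eq[rotated])
  then show ?thesis
    unfolding counting_int_def by (simp add: integral_unique cnt0 Z_def m_def)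
qed

lemma counting_int_mono:
  assumes G: "G holomorphic_on UNIV" "\<exists>z. G z \<noteq> 0" and R: "1 \<le> r" "r \<le> R"
  shows "counting_int (\<lambda>z. 1 / G z) r \<le> counting_int (\<lambda>z. 1 / G z) R"
proof -
  have "(\<Sum>a | norm a \<le> r \<and> G a = 0 \<and> a \<noteq> 0. real (nat (zorder G a)) * ln (r / norm a))
     \<le> (\<Sum>a | norm a \<le> r \<and> G a = 0 \<and> a \<noteq> 0. real (nat (zorder G a)) * ln (R / norm a))"
    using R by (intro sum_mono mult_left_mono) (auto simp: ln_div)
  also have "\<dots> \<le> (\<Sum>a | norm a \<le> R \<and> G a = 0 \<and> a \<noteq> 0. real (nat (zorder G a)) * ln (R / norm a))"
    by (intro sum_mono2 finite_subset[OF _ finite_zeros_cball[OF G, of R]]) (use R in auto)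
  finally have "(\<Sum>a | norm a \<le> r \<and> G a = 0 \<and> a \<noteq> 0. real (nat (zorder G a)) * ln (r / norm a)) \<le> \<dots>" .
  moreover have "real (nat (zorder G 0)) * ln r \<le> real (nat (zorder G 0)) * ln R"
    using R by (intro mult_left_mono) auto
  ultimately show ?thesis
    using R by (simp add: counting_int_inverse_entire[OF G])
qed

lemma counting_int_nonneg:
  assumes G: "G holomorphic_on UNIV" "\<exists>z. G z \<noteq> 0" and R: "1 \<le> R"
  shows "0 \<le> counting_int (\<lambda>z. 1 / G z) R"
proof -
  have "0 \<le> (\<Sum>a | norm a \<le> R \<and> G a = 0 \<and> a \<noteq> 0. real (nat (zorder G a)) * ln (R / norm a))"
    using R by (intro sum_nonneg mult_nonneg_nonneg) auto
  then show ?thesis using R by (simp add: counting_int_inverse_entire[OF G])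
qed

text \<open>Every zero of modulus at most r contributes at least ln 2 to the counting integral at
  2r.\<close>

lemma zero_count_le_counting_int:
  assumes G: "G holomorphic_on UNIV" "\<exists>z. G z \<noteq> 0" and R: "1 \<le> r"
  shows "(\<Sum>a | norm a \<le> r \<and> G a = 0 \<and> a \<noteq> 0. real (nat (zorder G a))) * ln 2 \<le> counting_int (\<lambda>z. 1 / G z) (2 * r)"
proof -
  have "(\<Sum>a | norm a \<le> r \<and> G a = 0 \<and> a \<noteq> 0. real (nat (zorder G a))) * ln 2
     \<le> (\<Sum>a | norm a \<le> r \<and> G a = 0 \<and> a \<noteq> 0. real (nat (zorder G a)) * ln ((2 * r) / norm a))"
    unfolding sum_distrib_right using R by (intro sum_mono mult_left_mono) (auto simp: field_simps)
  also have "\<dots> \<le> (\<Sum>a | norm a \<le> 2 * r \<and> G a = 0 \<and> a \<noteq> 0. real (nat (zorder G a)) * ln ((2 * r) / norm a))"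
    by (intro sum_mono2 finite_subset[OF _ finite_zeros_cball[OF G, of "2 * r"]]) (use R in auto)
  finally have "(\<Sum>a | norm a \<le> r \<and> G a = 0 \<and> a \<noteq> 0. real (nat (zorder G a))) * ln 2 \<le> \<dots>" .
  moreover have "0 \<le> real (nat (zorder G 0)) * ln (2 * r)" using R by (intro mult_nonneg_nonneg) auto
  moreover have "0 < 2 * r" using R by simp
  ultimately show ?thesis unfolding counting_int_inverse_entire[OF G \<open>0 < 2 * r\<close>] by linarith
qed

text \<open>On the circle the Blaschke product has modulus 1, so ln |G| is there the real part of a
  function holomorphic in the disc.\<close>

lemma circle_mean_ln_norm_blaschke:
  assumes G: "G holomorphic_on UNIV" "\<exists>z. G z \<noteq> 0" and R: "0 < R" "zero_free_radius G R"
    and h: "R < R'" "h holomorphic_on ball 0 R'"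
      "\<And>z. norm z < R' \<Longrightarrow> G z = (\<Prod>a | norm a < R \<and> G a = 0. blaschke R a z ^ nat (zorder G a)) * exp (h z)"
  shows "\<And>z. norm z = R \<Longrightarrow> ln (norm (G z)) = Re (h z)"
    and "circle_mean (\<lambda>z. ln (norm (G z))) R = Re (h 0)"
proof -
  show *: "ln (norm (G z)) = Re (h z)" if "norm z = R" for z
  proof -
    have "norm (\<Prod>a | norm a < R \<and> G a = 0. blaschke R a z ^ nat (zorder G a)) = 1"
      unfolding prod_norm[symmetric] norm_power using that
      by (intro prod.neutral) (auto simp: norm_blaschke_eq)
    then show ?thesis using h(3)[of z] that h(1) by (simp add: norm_mult)
  qed
  have "circle_mean (\<lambda>z. ln (norm (G z))) R = circle_mean (\<lambda>z. Re (h z)) R"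
    using R by (intro circle_mean_cong *) auto
  also have "\<dots> = Re (h 0)" by (rule circle_mean_Re[OF h(2) R(1) h(1)])
  finally show "circle_mean (\<lambda>z. ln (norm (G z))) R = Re (h 0)" .
qed

text \<open>The mean of ln |G| is Re h(0) for the Blaschke logarithm h, and h(0) is found by
  evaluating the factorization at the origin: each zero a contributes ln (R / |a|). The constant is
  ln |g(0)|, where g is G with its zero at the origin removed, and does not depend on R.\<close>

theorem jensen_formula:
  assumes G: "G holomorphic_on UNIV" "\<exists>z. G z \<noteq> 0"
  obtains c where "\<And>R. 0 < R \<Longrightarrow> zero_free_radius G R \<Longrightarrow>
    counting_int (\<lambda>z. 1 / G z) R = circle_mean (\<lambda>z. ln (norm (G z))) R - c"
proof -
  obtain g where g: "g holomorphic_on UNIV" "\<And>z. G z = (z - 0) ^ nat (zorder G 0) * g z" "g 0 \<noteq> 0"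
    by (rule entire_factor_zero[OF G, of 0]) (rule that)
  have "counting_int (\<lambda>z. 1 / G z) R = circle_mean (\<lambda>z. ln (norm (G z))) R - ln (norm (g 0))"
    if R: "0 < R" "zero_free_radius G R" for R
  proof -
    define Z where "Z = {a. norm a < R \<and> G a = 0}"
    define m where "m a = nat (zorder G a)" for a
    have finZ: "finite Z" unfolding Z_def
      by (rule finite_subset[OF _ finite_zeros_cball[OF G, of R]]) auto
    have Z_alt: "Z - {0} = {a. norm a \<le> R \<and> G a = 0 \<and> a \<noteq> 0}"
      using R(2) by (auto simp: Z_def zero_free_radius_def less_le)
    obtain h R' where h': "R < R'" "h holomorphic_on ball 0 R'"
        "\<And>z a. norm z < R' \<Longrightarrow> norm a < R \<Longrightarrow> G a = 0 \<Longrightarrow> of_real (R\<^sup>2) - cnj a * z \<noteq> 0"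
        "\<And>z. norm z < R' \<Longrightarrow> G z = (\<Prod>a | norm a < R \<and> G a = 0. blaschke R a z ^ nat (zorder G a)) * exp (h z)"
      by (rule blaschke_factorization[OF G R]) (rule that)
    note h = h'(1-3) h'(4)[folded m_def Z_def]
    have mean: "circle_mean (\<lambda>z. ln (norm (G z))) R = Re (h 0)"
      by (rule circle_mean_ln_norm_blaschke(2)[OF G R h(1,2)]) (use h(4) in \<open>simp add: Z_def m_def\<close>)
    \<comment> \<open>The factorization with z^(m 0) removed from the factor (z / R)^(m 0) belonging
      to the origin.\<close>
    define k where "k z = (1 / of_real R) ^ m 0 * (\<Prod>a\<in>Z - {0}. blaschke R a z ^ m a) * exp (h z)" for z
    have m0: "m 0 = 0" if "0 \<notin> Z"
      using that R zorder_nonneg_entire[OF G, of 0] by (auto simp: Z_def m_def)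
    have split: "(\<Prod>a\<in>Z. blaschke R a z ^ m a) = blaschke R 0 z ^ m 0 * (\<Prod>a\<in>Z - {0}. blaschke R a z ^ m a)" for z
      using m0 finZ by (cases "0 \<in> Z") (auto simp: prod.remove)
    have eq: "k z = g z" if "norm z < R'" "z \<noteq> 0" for z
    proof -
      have "z ^ m 0 * g z = z ^ m 0 * k z"
        using h(4)[OF that(1)] g(2)[of z] R unfolding k_def split
        by (simp add: m_def blaschke_def power_mult_distrib power_divide power2_eq_square)
      then show ?thesis using that by simp
    qed
    have kh: "k holomorphic_on ball 0 R'" unfolding k_def blaschke_def
      by (intro holomorphic_intros h(2)) (use h(3) in \<open>auto simp: Z_def\<close>)
    have R'0: "0 < R'" using R h(1) by simp
    have "isCont k 0"
      using holomorphic_on_imp_continuous_on[OF kh] R'0 by (simp add: continuous_on_eq_continuous_at)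
    moreover have "isCont g 0"
      using holomorphic_on_imp_continuous_on[OF g(1)] by (simp add: continuous_on_eq_continuous_at)
    moreover have "eventually (\<lambda>z. k z = g z) (at 0)"
      unfolding eventually_at using R'0 eq by (intro exI[of _ R']) (auto simp: dist_norm)
    \<comment> \<open>Cancelling the power of z is possible only for z \<noteq> 0; continuity
      supplies the origin.\<close>
    ultimately have "k 0 = g 0"
      by (metis LIM_unique isCont_def tendsto_cong)
    moreover have "norm (k 0) = (1 / R) ^ m 0 * (\<Prod>a\<in>Z - {0}. (norm a / R) ^ m a) * exp (Re (h 0))"
      using R unfolding k_def by (simp add: norm_mult norm_power norm_divide blaschke_def power2_eq_square flip: prod_norm)
    ultimately have g0: "norm (g 0) = (1 / R) ^ m 0 * (\<Prod>a\<in>Z - {0}. (norm a / R) ^ m a) * exp (Re (h 0))" by simp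
    have "ln (norm (g 0)) = ln ((1 / R) ^ m 0) + ln (\<Prod>a\<in>Z - {0}. (norm a / R) ^ m a) + Re (h 0)"
    proof -
      have "0 < (\<Prod>a\<in>Z - {0}. (norm a / R) ^ m a)" using R by (intro prod_pos) auto
      then show ?thesis using R g0 by (simp add: ln_mult)
    qed
    also have "ln (\<Prod>a\<in>Z - {0}. (norm a / R) ^ m a) = (\<Sum>a\<in>Z - {0}. ln ((norm a / R) ^ m a))"
      using finZ R by (intro ln_prod) auto
    also have "\<dots> = - (\<Sum>a\<in>Z - {0}. real (m a) * ln (R / norm a))"
      unfolding sum_negf[symmetric] using R
      by (intro sum.cong refl) (auto simp: ln_realpow ln_div algebra_simps)
    also have "ln ((1 / R) ^ m 0) = - real (m 0) * ln R"
      using R by (simp add: ln_realpow ln_div)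
    finally show ?thesis
      unfolding counting_int_inverse_entire[OF G R(1)] mean using Z_alt by (simp add: m_def)
  qed
  then show ?thesis using that by blast
qed

section \<open>Logarithmic means and pointwise bounds from Jensen's formula\<close>

lemma continuous_on_sphere_holomorphic:
  "f holomorphic_on UNIV \<Longrightarrow> continuous_on (sphere 0 r) f"
  by (auto intro!: holomorphic_on_imp_continuous_on intro: holomorphic_on_subset)

lemma continuous_on_ln_norm:
  assumes "G holomorphic_on UNIV" "zero_free_radius G R"
  shows "continuous_on (sphere 0 R) (\<lambda>z. ln (norm (G z)))"
  using assms by (intro continuous_intros continuous_on_sphere_holomorphic) (auto simp: zero_free_radius_def)

lemma continuous_on_log_plus_norm:
  "G holomorphic_on UNIV \<Longrightarrow> continuous_on (sphere 0 R) (\<lambda>z. log_plus (norm (G z)))"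
  by (intro continuous_intros continuous_on_sphere_holomorphic)

lemma continuous_on_sphere_inverse:
  assumes "G holomorphic_on UNIV" "zero_free_radius G R"
  shows "continuous_on (sphere 0 R) (\<lambda>z. 1 / G z)"
  using assms by (intro continuous_intros continuous_on_sphere_holomorphic) (auto simp: zero_free_radius_def)

lemma continuous_on_log_plus_inverse:
  assumes "G holomorphic_on UNIV" "zero_free_radius G R"
  shows "continuous_on (sphere 0 R) (\<lambda>z. log_plus (norm (1 / G z)))"
  by (intro continuous_on_log_plus continuous_on_norm continuous_on_sphere_inverse assms)

text \<open>Integrated forms of ln x = \<open>log_plus\<close> x - \<open>log_plus\<close> (1/x) and
  |ln x| = 2 \<open>log_plus\<close> x - ln x.\<close>

lemma circle_mean_ln_norm:
  assumes G: "G holomorphic_on UNIV" and R: "0 < R" "zero_free_radius G R"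
  shows "circle_mean (\<lambda>z. ln (norm (G z))) R = proximity G R - proximity (\<lambda>z. 1 / G z) R"
    and "circle_mean (\<lambda>z. \<bar>ln (norm (G z))\<bar>) R = 2 * proximity G R - circle_mean (\<lambda>z. ln (norm (G z))) R"
proof -
  have "circle_mean (\<lambda>z. ln (norm (G z))) R = circle_mean (\<lambda>z. log_plus (norm (G z)) - log_plus (norm (1 / G z))) R"
    using R by (intro circle_mean_cong) (auto simp: zero_free_radius_def norm_divide intro!: ln_eq_log_plus_diff)
  also have "\<dots> = proximity G R - proximity (\<lambda>z. 1 / G z) R"
    unfolding proximity_eq_circle_mean using R G
    by (intro circle_mean_diff continuous_on_log_plus_norm continuous_on_log_plus_inverse) auto
  finally show "circle_mean (\<lambda>z. ln (norm (G z))) R = proximity G R - proximity (\<lambda>z. 1 / G z) R" .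
  have "\<bar>ln x\<bar> = 2 * log_plus x - ln x" if "0 < x" for x
    using that by (cases "x \<ge> 1") (auto simp: log_plus_def max_def)
  then have "circle_mean (\<lambda>z. \<bar>ln (norm (G z))\<bar>) R = circle_mean (\<lambda>z. 2 * log_plus (norm (G z)) - ln (norm (G z))) R"
    using R by (intro circle_mean_cong) (auto simp: zero_free_radius_def)
  also have "\<dots> = circle_mean (\<lambda>z. 2 * log_plus (norm (G z))) R - circle_mean (\<lambda>z. ln (norm (G z))) R"
    using R G by (intro circle_mean_diff continuous_on_ln_norm continuous_on_mult continuous_on_const continuous_on_log_plus_norm) auto
  finally show "circle_mean (\<lambda>z. \<bar>ln (norm (G z))\<bar>) R = 2 * proximity G R - circle_mean (\<lambda>z. ln (norm (G z))) R"
    unfolding proximity_eq_circle_mean circle_mean_cmult .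
qed

text \<open>N is nonnegative for R \<ge> 1, so Jensen's formula bounds the mean of ln |G| from below
  by a constant, and |ln x| = 2 \<open>log_plus\<close> x - ln x does the rest.\<close>

lemma circle_mean_abs_ln_le:
  assumes G: "G holomorphic_on UNIV" "\<exists>z. G z \<noteq> 0"
  obtains c where "0 \<le> c" "\<And>R. 1 \<le> R \<Longrightarrow> zero_free_radius G R \<Longrightarrow>
    circle_mean (\<lambda>z. \<bar>ln (norm (G z))\<bar>) R \<le> 2 * proximity G R + c"
proof -
  obtain c where c: "\<And>R. 0 < R \<Longrightarrow> zero_free_radius G R \<Longrightarrow>
    counting_int (\<lambda>z. 1 / G z) R = circle_mean (\<lambda>z. ln (norm (G z))) R - c"
    by (rule jensen_formula[OF G]) (rule that)
  have "circle_mean (\<lambda>z. \<bar>ln (norm (G z))\<bar>) R \<le> 2 * proximity G R + \<bar>c\<bar>" if "1 \<le> R" "zero_free_radius G R" for R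
    using circle_mean_ln_norm(2)[OF G(1) _ that(2)] c[of R] counting_int_nonneg[OF G that(1)] that by simp
  then show ?thesis using that[of "\<bar>c\<bar>"] by auto
qed

text \<open>Inside the disc the Blaschke product is at most 1, so |G| \<le> exp (Re h), and h is
  controlled by the mean of its real part. This is the passage from proximity functions back to
  pointwise bounds.\<close>

lemma norm_le_exp_proximity:
  assumes G: "G holomorphic_on UNIV" "\<exists>z. G z \<noteq> 0"
  obtains c where "0 \<le> c" "\<And>R z. 1 \<le> R \<Longrightarrow> zero_free_radius G R \<Longrightarrow> norm z \<le> R / 2 \<Longrightarrow>
    norm (G z) \<le> exp (6 * proximity G R + c)"
proof -
  obtain c where c: "0 \<le> c" "\<And>R. 1 \<le> R \<Longrightarrow> zero_free_radius G R \<Longrightarrow>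
    circle_mean (\<lambda>z. \<bar>ln (norm (G z))\<bar>) R \<le> 2 * proximity G R + c"
    by (rule circle_mean_abs_ln_le[OF G]) (rule that)
  have "norm (G z) \<le> exp (6 * proximity G R + 3 * c)" if R: "1 \<le> R" "zero_free_radius G R" and z: "norm z \<le> R / 2" for R z
  proof -
    have R0: "0 < R" using R by simp
    obtain h R' where h: "R < R'" "h holomorphic_on ball 0 R'"
        "\<And>z a. norm z < R' \<Longrightarrow> norm a < R \<Longrightarrow> G a = 0 \<Longrightarrow> of_real (R\<^sup>2) - cnj a * z \<noteq> 0"
        "\<And>z. norm z < R' \<Longrightarrow> G z = (\<Prod>a | norm a < R \<and> G a = 0. blaschke R a z ^ nat (zorder G a)) * exp (h z)"
      by (rule blaschke_factorization[OF G R0 R(2)]) (rule that)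
    note lnG = circle_mean_ln_norm_blaschke[OF G R0 R(2) h(1,2,4)]
    define M where "M = circle_mean (\<lambda>z. \<bar>ln (norm (G z))\<bar>) R"
    have M: "circle_mean (\<lambda>z. \<bar>Re (h z)\<bar>) R = M"
      unfolding M_def using R0 lnG(1) by (intro circle_mean_cong) auto
    have "circle_mean (\<lambda>z. ln (norm (G z))) R \<le> M"
      unfolding M_def using R0 R continuous_on_ln_norm[OF G(1) R(2)]
      by (intro circle_mean_mono) (auto intro!: continuous_on_rabs)
    then have "Re (h 0) \<le> M" using lnG(2) by simp
    moreover have "norm (h z - h 0) \<le> 2 * M"
      using holomorphic_diff_bound[OF h(2) R0 h(1) z] M by simp
    then have "Re (h z) - Re (h 0) \<le> 2 * M"
      using complex_Re_le_cmod[of "h z - h 0"] by simp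
    \<comment> \<open>One M comes from Re h(0) and two from the variation of h; with M \<le> 2 m(R,
      G) + c this is the source of the factor 6.\<close>
    ultimately have "Re (h z) \<le> 3 * M" by simp
    also have "\<dots> \<le> 3 * (2 * proximity G R + c)" using c(2)[OF R] by (simp add: M_def)
    finally have hz: "Re (h z) \<le> 6 * proximity G R + 3 * c" by simp
    have "norm (\<Prod>a | norm a < R \<and> G a = 0. blaschke R a z ^ nat (zorder G a)) \<le> 1"
      unfolding prod_norm[symmetric] norm_power using z R0
      by (intro prod_le_1 conjI power_le_one) (auto intro!: norm_blaschke_le)
    then have "norm (G z) \<le> 1 * exp (Re (h z))"
      using h(4)[of z] z R0 h(1) by (simp add: norm_mult)
    also have "\<dots> \<le> exp (6 * proximity G R + 3 * c)" using hz by simp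
    finally show ?thesis .
  qed
  then show ?thesis using that[of "3 * c"] c(1) by auto
qed

section \<open>The lemma on the logarithmic derivative\<close>

lemma ex_zero_free_radius:
  assumes G: "G holomorphic_on UNIV" "\<exists>z. G z \<noteq> 0" and "x < y"
  obtains R where "x < R" "R < y" "zero_free_radius G R"
proof -
  have "\<not> {x<..<y} \<subseteq> {norm z | z. G z = 0}"
    using uncountable_open_interval[of x y] \<open>x < y\<close> countable_zero_radii[OF G] countable_subset by blast
  then obtain R where R: "R \<in> {x<..<y}" "R \<notin> {norm z | z. G z = 0}" by (meson subsetI)
  then have "zero_free_radius G R" by (force simp: zero_free_radius_def)
  then show ?thesis using that[of R] R by simp
qed

section \<open>Means of inverse square roots of distances\<close>

text \<open>sin x \<ge> x - x^3/6, which is at least x/2 as long as x^2 \<le> 3; on the interval in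
  question x \<le> 8/5 and (8/5)^2 < 3.\<close>

lemma half_le_abs_sin:
  fixes x :: real
  assumes "\<bar>x\<bar> \<le> pi / 2" shows "\<bar>x\<bar> / 2 \<le> \<bar>sin x\<bar>"
proof -
  have *: "x / 2 \<le> sin x" if "0 \<le> x" "x \<le> pi / 2" for x :: real
  proof -
    have "\<bar>sin x - (\<Sum>m<3. sin_coeff m * x ^ m)\<bar> \<le> inverse (fact 3) * \<bar>x\<bar> ^ 3"
      by (rule Maclaurin_sin_bound)
    moreover have "(\<Sum>m<3. sin_coeff m * x ^ m) = x"
      by (simp add: eval_nat_numeral sin_coeff_def)
    ultimately have "\<bar>sin x - x\<bar> \<le> x ^ 3 / 6"
      using that by (simp add: fact_numeral)
    then have "x - x ^ 3 / 6 \<le> sin x" by linarith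
    moreover have "x \<le> 8/5" using that pi_less_4 pi_approx by simp
    then have "x * x \<le> (8/5) * (8/5)" using that by (intro mult_mono) auto
    then have "x * (x * x) \<le> x * 3" using that by (intro mult_left_mono) auto
    then have "x ^ 3 \<le> 3 * x" by (simp add: eval_nat_numeral)
    ultimately show ?thesis by linarith
  qed
  show ?thesis using *[of x] *[of "- x"] assms by (cases "0 \<le> x") auto
qed

text \<open>The radius 20 is large enough for [s - 20, s + 20] to contain [0, 2 \<open>pi\<close>]
  for all centres s that occur below; each half contributes 2 sqrt 20.\<close>

lemma integral_inverse_sqrt_le:
  fixes s :: real
  assumes "- 20 + 2 * pi \<le> s" "s \<le> 20"
  shows "(\<lambda>\<theta>. \<bar>\<theta> - s\<bar> powr (-1/2)) integrable_on {0..2 * pi}"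
    and "integral {0..2 * pi} (\<lambda>\<theta>. \<bar>\<theta> - s\<bar> powr (-1/2)) \<le> 4 * sqrt 20"
proof -
  have *: "((\<lambda>x. x powr (-1/2)) has_integral 2 * sqrt 20) {0..20::real}"
    using has_integral_powr_from_0[of "-1/2" 20] by (simp add: powr_half_sqrt mult.commute)
  have pos: "((\<lambda>x. \<bar>x\<bar> powr (-1/2)) has_integral 2 * sqrt 20) {0..20::real}"
    by (rule has_integral_eq[OF _ *]) auto
  have "((\<lambda>x. \<bar>x\<bar> powr (-1/2)) has_integral 2 * sqrt 20) {-20..0::real}"
    using has_integral_reflect_real[of "\<lambda>x. \<bar>x\<bar> powr (-1/2)" "2 * sqrt 20" 20 0] pos by simp
  from has_integral_combine[OF _ _ this pos]
  have full: "((\<lambda>x. \<bar>x\<bar> powr (-1/2)) has_integral 4 * sqrt 20) {-20..20::real}" by simp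
  have "((\<lambda>x. \<bar>x - s\<bar> powr (-1/2)) has_integral 4 * sqrt 20) {s - 20..s + 20}"
    using has_integral_affinity[of "\<lambda>x. \<bar>x\<bar> powr (-1/2)" "4 * sqrt 20" "-20" "20::real" 1 "- s"] full
    by (simp add: add.commute)
  then have int: "(\<lambda>x. \<bar>x - s\<bar> powr (-1/2)) integrable_on {s - 20..s + 20}"
      "integral {s - 20..s + 20} (\<lambda>x. \<bar>x - s\<bar> powr (-1/2)) = 4 * sqrt 20"
    by (auto simp: integrable_on_def integral_unique)
  have sub: "{0..2 * pi} \<subseteq> {s - 20..s + 20}" using assms by auto
  show i: "(\<lambda>\<theta>. \<bar>\<theta> - s\<bar> powr (-1/2)) integrable_on {0..2 * pi}"
    by (rule integrable_on_subinterval[OF int(1) sub])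
  show "integral {0..2 * pi} (\<lambda>\<theta>. \<bar>\<theta> - s\<bar> powr (-1/2)) \<le> 4 * sqrt 20"
    unfolding int(2)[symmetric] by (rule integral_subset_le[OF sub i int(1)]) auto
qed

text \<open>The distance from r \<open>cis\<close> \<theta> to a is at least r |sin (\<theta> - arg
  a)|, whatever |a| is. Hence the integrand is dominated by inverse square roots of distances to the
  zeros of the sine, and the bound is uniform in a and in r \<ge> 1. The constant is 5 * sqrt 2 * 4
  sqrt 20.\<close>

lemma circle_mean_inverse_sqrt_le:
  assumes r: "1 \<le> r" "norm a \<noteq> r"
  shows "circle_mean (\<lambda>z. 1 / sqrt (norm (z - a))) r \<le> 20 * sqrt 40"
proof -
  define \<phi> where "\<phi> = (if a = 0 then 0 else Arg a)"
  have \<phi>: "- pi \<le> \<phi>" "\<phi> \<le> pi" using Arg_bounded[of a] by (auto simp: \<phi>_def)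
  have a: "a = of_real (norm a) * cis \<phi>"
    by (auto simp: \<phi>_def cis_Arg sgn_eq)
  \<comment> \<open>\<theta> - \<phi> ranges over [- \<open>pi\<close>, 3 \<open>pi\<close>], which
    contains exactly these five multiples of \<open>pi\<close>.\<close>
  define J where "J = {-1, 0, 1, 2, 3::int}"
  define v where "v \<theta> = (\<Sum>j\<in>J. sqrt 2 * \<bar>\<theta> - (\<phi> + of_int j * pi)\<bar> powr (-1/2))" for \<theta>
  define u where "u \<theta> = 1 / sqrt (norm (of_real r * cis \<theta> - a))" for \<theta>
  define S where "S = (\<lambda>j. \<phi> + of_int j * pi) ` J"
  have bnd: "u \<theta> \<le> v \<theta>" if \<theta>: "\<theta> \<in> {0..2 * pi}" "\<theta> \<notin> S" for \<theta>
  proof -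
    define x where "x = \<theta> - \<phi>"
    have "- pi \<le> x" "x \<le> 3 * pi" using \<theta> \<phi> by (auto simp: x_def)
    then have "\<exists>j\<in>J. \<bar>x - of_int j * pi\<bar> \<le> pi / 2"
      by (simp add: J_def abs_le_iff) (smt (verit) pi_gt_zero)
    then obtain j where j: "j \<in> J" "\<bar>x - of_int j * pi\<bar> \<le> pi / 2" by auto
    define y where "y = x - of_int j * pi"
    have y0: "y \<noteq> 0"
    proof
      assume "y = 0"
      then have "\<theta> = \<phi> + of_int j * pi" by (simp add: y_def x_def algebra_simps)
      then show False using \<theta>(2) j(1) by (auto simp: S_def)
    qed
    have "\<bar>sin y\<bar> = \<bar>sin x\<bar>"
      using j(1) sin_periodic_pi[of "x - pi"] sin_periodic_pi[of "x"] sin_periodic_pi[of "x - 2 * pi"] sin_periodic_pi[of "x - 3 * pi"]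
      by (auto simp: J_def y_def algebra_simps)
    have ct: "cis \<theta> = cis \<phi> * cis x" by (simp add: cis_mult x_def)
    have "cis \<phi> * of_real (norm a) = a" using a by (simp add: mult.commute)
    then have "of_real r * cis \<theta> - a = cis \<phi> * (of_real r * cis x - of_real (norm a))"
      unfolding right_diff_distrib by (simp add: ct mult_ac)
    then have "norm (of_real r * cis \<theta> - a) = norm (of_real r * cis x - of_real (norm a))"
      by (metis mult_1 norm_cis norm_mult)
    also have "\<dots> \<ge> \<bar>Im (of_real r * cis x - of_real (norm a))\<bar>" by (rule abs_Im_le_cmod)
    also have "\<bar>Im (of_real r * cis x - of_real (norm a))\<bar> = r * \<bar>sin x\<bar>" using r by (simp add: abs_mult)
    finally have "r * \<bar>sin y\<bar> \<le> norm (of_real r * cis \<theta> - a)" using \<open>\<bar>sin y\<bar> = _\<close> by simp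
    moreover have "\<bar>y\<bar> / 2 \<le> \<bar>sin y\<bar>" by (rule half_le_abs_sin) (use j in \<open>simp add: y_def\<close>)
    moreover have "1 * \<bar>sin y\<bar> \<le> r * \<bar>sin y\<bar>" using r by (intro mult_right_mono) auto
    ultimately have "\<bar>y\<bar> / 2 \<le> norm (of_real r * cis \<theta> - a)" by linarith
    then have "sqrt (\<bar>y\<bar> / 2) \<le> sqrt (norm (of_real r * cis \<theta> - a))" by simp
    then have "u \<theta> \<le> 1 / sqrt (\<bar>y\<bar> / 2)"
      unfolding u_def using y0 by (intro divide_left_mono mult_pos_pos) (auto intro: less_le_trans)
    also have "\<dots> = sqrt 2 * \<bar>y\<bar> powr (-1/2)"
      by (simp add: real_sqrt_divide powr_minus_divide powr_half_sqrt)
    also have "\<bar>y\<bar> = \<bar>\<theta> - (\<phi> + of_int j * pi)\<bar>" by (simp add: y_def x_def algebra_simps)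
    also have "sqrt 2 * \<bar>\<theta> - (\<phi> + of_int j * pi)\<bar> powr (-1/2) \<le> v \<theta>"
      unfolding v_def using j(1) by (intro member_le_sum[where f = "\<lambda>j. sqrt 2 * \<bar>\<theta> - (\<phi> + of_int j * pi)\<bar> powr (-1/2)"]) (auto simp: J_def)
    finally show ?thesis .
  qed
  have rng: "- 20 + 2 * pi \<le> \<phi> + of_int j * pi" "\<phi> + of_int j * pi \<le> 20" if "j \<in> J" for j
    using that \<phi> pi_less_4 pi_gt_zero by (auto simp: J_def)
  have cont: "continuous_on {0..2*pi} u" unfolding u_def
    using r by (intro continuous_intros) (auto simp: norm_mult)
  have finJ: "finite J" by (simp add: J_def)
  have intj: "(\<lambda>\<theta>. sqrt 2 * \<bar>\<theta> - (\<phi> + of_int j * pi)\<bar> powr (-1/2)) integrable_on {0..2 * pi}" if "j \<in> J" for j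
    by (intro integrable_on_mult_right integral_inverse_sqrt_le(1) rng that)
  have vint: "v integrable_on {0..2 * pi}" unfolding v_def
    by (intro integrable_sum integrable_on_mult_right integral_inverse_sqrt_le(1) rng finJ)
  have "integral {0..2 * pi} v = (\<Sum>j\<in>J. sqrt 2 * integral {0..2 * pi} (\<lambda>\<theta>. \<bar>\<theta> - (\<phi> + of_int j * pi)\<bar> powr (-1/2)))"
    unfolding v_def
    by (subst integral_sum[OF finJ]) (simp_all only: intj integral_mult_right)
  also have "\<dots> \<le> (\<Sum>j\<in>J. sqrt 2 * (4 * sqrt 20))"
    by (intro sum_mono mult_left_mono integral_inverse_sqrt_le(2) rng) auto
  also have "\<dots> = 20 * sqrt 40" by (simp add: J_def real_sqrt_mult[symmetric])
  finally have v_le: "integral {0..2 * pi} v \<le> 20 * sqrt 40" .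
  \<comment> \<open>At the points of \<open>S\<close> one summand of \<open>v\<close> is 0
    \<open>powr\<close> (-1/2) = 0 instead of infinite, so \<open>v\<close> need not dominate
    \<open>u\<close> there; changing it on a finite set leaves the integral unchanged.\<close>
  define w where "w \<theta> = (if \<theta> \<in> S then u \<theta> else v \<theta>)" for \<theta>
  have "finite S" by (simp add: S_def J_def)
  have w: "(w has_integral integral {0..2 * pi} v) {0..2 * pi}"
    by (rule has_integral_spike_finite[OF \<open>finite S\<close> _ integrable_integral[OF vint]]) (simp add: w_def)
  have "integral {0..2 * pi} u \<le> integral {0..2 * pi} v"
    by (rule has_integral_le[OF integrable_integral[OF integrable_continuous_real[OF cont]] w])
      (use bnd in \<open>auto simp: w_def\<close>)
  then have "integral {0..2 * pi} u \<le> 20 * sqrt 40" using v_le by simp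
  moreover have "20 * sqrt 40 \<le> 2 * pi * (20 * sqrt 40)" using pi_gt3 by simp
  ultimately have "integral {0..2 * pi} u \<le> 2 * pi * (20 * sqrt 40)" by linarith
  then show ?thesis unfolding circle_mean_def u_def by (simp add: field_simps)
qed

text \<open>The logarithm of a sum of poles has to be bounded by something linear whose circle mean
  is known. Square roots make the poles integrable: the sum is at most T^2 with T the sum of the
  terms m / sqrt x. The weight 1 / (1 + n) will cancel the number n of summands after
  integration.\<close>

lemma log_plus_sum_le:
  fixes x :: "'a \<Rightarrow> real" and m :: "'a \<Rightarrow> nat"
  assumes "finite S" "\<And>i. i \<in> S \<Longrightarrow> 0 < x i"
  defines "n \<equiv> (\<Sum>i\<in>S. real (m i))"
  shows "log_plus (\<Sum>i\<in>S. real (m i) / x i) \<le> 2 * ln (1 + n) + 2 / (1 + n) * (\<Sum>i\<in>S. real (m i) * (1 / sqrt (x i)))"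
proof -
  define T where "T = (\<Sum>i\<in>S. real (m i) * (1 / sqrt (x i)))"
  define y where "y = (\<Sum>i\<in>S. real (m i) / x i)"
  have T0: "0 \<le> T" unfolding T_def using assms(2) by (intro sum_nonneg) (auto simp: less_imp_le)
  have n0: "0 \<le> n" unfolding n_def by (intro sum_nonneg) auto
  have y0: "0 \<le> y" unfolding y_def using assms(2) by (intro sum_nonneg) (auto simp: less_imp_le)
  have "(\<Sum>i\<in>S. (real (m i) * (1 / sqrt (x i)))\<^sup>2) \<le> T\<^sup>2"
    unfolding T_def using assms(1,2)
  proof (induction S rule: finite_induct)
    case (insert i S)
    have pos: "0 \<le> (\<Sum>i\<in>S. real (m i) * (1 / sqrt (x i)))" "0 \<le> real (m i) * (1 / sqrt (x i))"
      using insert.prems by (auto intro!: sum_nonneg simp: less_imp_le)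
    have "0 \<le> 2 * (real (m i) * (1 / sqrt (x i))) * (\<Sum>i\<in>S. real (m i) * (1 / sqrt (x i)))"
      by (rule mult_nonneg_nonneg[OF mult_nonneg_nonneg[OF zero_le_numeral pos(2)] pos(1)])
    moreover have "(\<Sum>i\<in>S. (real (m i) * (1 / sqrt (x i)))\<^sup>2) \<le> (\<Sum>i\<in>S. real (m i) * (1 / sqrt (x i)))\<^sup>2"
      using insert by simp
    ultimately show ?case unfolding sum.insert[OF insert.hyps(1,2)] power2_sum by linarith
  qed simp
  moreover have "y \<le> (\<Sum>i\<in>S. (real (m i) * (1 / sqrt (x i)))\<^sup>2)"
    unfolding y_def
  proof (rule sum_mono)
    fix i assume i: "i \<in> S"
    \<comment> \<open>The multiplicities are natural numbers, which makes this true also below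
      1.\<close>
    have "real (m i) \<le> (real (m i))\<^sup>2" by (cases "m i") (auto simp: power2_eq_square)
    then show "real (m i) / x i \<le> (real (m i) * (1 / sqrt (x i)))\<^sup>2"
      using assms(2)[OF i] by (simp add: power_mult_distrib power_divide divide_right_mono)
  qed
  ultimately have "y \<le> T\<^sup>2" by linarith
  then have "max 1 y \<le> (1 + T)\<^sup>2" using T0 by (simp add: power2_sum add_nonneg_nonneg)
  then have "log_plus y \<le> ln ((1 + T)\<^sup>2)" unfolding log_plus_def by (subst ln_le_cancel_iff) (use T0 in auto)
  also have "\<dots> = 2 * ln (1 + T)" using T0 by (simp add: ln_realpow)
  \<comment> \<open>The product on the right is 1 + n + T; splitting off 1 + n leaves an argument
    whose logarithm is bounded linearly.\<close>
  also have "ln (1 + T) \<le> ln ((1 + n) * (1 + T / (1 + n)))"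
    using T0 n0 by (subst ln_le_cancel_iff) (auto simp: field_simps add_pos_nonneg intro: add_pos_nonneg)
  also have "\<dots> = ln (1 + n) + ln (1 + T / (1 + n))"
    using T0 n0 by (intro ln_mult_pos) (auto simp: add_pos_nonneg)
  also have "ln (1 + T / (1 + n)) \<le> T / (1 + n)"
    using T0 n0 by (intro ln_add_one_self_le_self) auto
  finally show ?thesis by (simp add: y_def T_def algebra_simps)
qed

text \<open>Logarithmic differentiation of the factorization: the first summand for a comes from the
  zero of the Blaschke factor, the second from its reflected pole.\<close>

lemma deriv_over_blaschke_product:
  assumes h: "h holomorphic_on ball 0 R'" and z: "norm z < R'" and R: "0 < R" and Z: "finite Z"
    and den: "\<And>a z. a \<in> Z \<Longrightarrow> norm z < R' \<Longrightarrow> of_real (R\<^sup>2) - cnj a * z \<noteq> 0"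
    and zZ: "z \<notin> Z"
    and G: "\<And>z. norm z < R' \<Longrightarrow> G z = (\<Prod>a\<in>Z. blaschke R a z ^ m a) * exp (h z)"
  shows "deriv G z / G z = (\<Sum>a\<in>Z. of_nat (m a) * (1 / (z - a) + cnj a / (of_real (R\<^sup>2) - cnj a * z))) + deriv h z"
proof -
  define q where "q a = of_nat (m a) * (1 / (z - a) + cnj a / (of_real (R\<^sup>2) - cnj a * z))" for a
  have dB: "((\<lambda>z. blaschke R a z ^ m a) has_field_derivative (blaschke R a z ^ m a * q a)) (at z)" if a: "a \<in> Z" for a
  proof -
    have za: "z - a \<noteq> 0" using zZ a by auto
    have d: "of_real (R\<^sup>2) - cnj a * z \<noteq> 0" using den[OF a z] .
    have 1: "(blaschke R a has_field_derivative (blaschke R a z * (1 / (z - a) + cnj a / (of_real (R\<^sup>2) - cnj a * z)))) (at z)"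
    proof -
      have alg: "R0 * e / D * (1 / e + c / D) = (R0 * D - R0 * e * (- c)) / (D * D)"
        if "D \<noteq> 0" "e \<noteq> 0" for R0 e D c :: complex
        using that by (simp add: field_simps)
      have "((\<lambda>z. of_real R * (z - a) / (of_real (R\<^sup>2) - cnj a * z)) has_field_derivative
          (of_real R * (of_real (R\<^sup>2) - cnj a * z) - of_real R * (z - a) * (- cnj a)) / ((of_real (R\<^sup>2) - cnj a * z) * (of_real (R\<^sup>2) - cnj a * z))) (at z)"
        by (rule DERIV_divide) (use d in \<open>auto intro!: derivative_eq_intros\<close>)
      then show ?thesis unfolding blaschke_def alg[OF d za] .
    qed
    have "((\<lambda>z. blaschke R a z ^ m a) has_field_derivative of_nat (m a) * (blaschke R a z * (1 / (z - a) + cnj a / (of_real (R\<^sup>2) - cnj a * z))) * blaschke R a z ^ (m a - 1)) (at z)"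
      using DERIV_power[OF 1, of "m a"] by (simp add: mult_ac)
    also have "of_nat (m a) * (blaschke R a z * (1 / (z - a) + cnj a / (of_real (R\<^sup>2) - cnj a * z))) * blaschke R a z ^ (m a - 1) = blaschke R a z ^ m a * q a"
      by (cases "m a") (simp_all add: q_def mult_ac)
    finally show ?thesis .
  qed
  have "((\<lambda>z. \<Prod>a\<in>Z. blaschke R a z ^ m a) has_field_derivative (\<Sum>a\<in>Z. blaschke R a z ^ m a * q a * (\<Prod>b\<in>Z - {a}. blaschke R b z ^ m b))) (at z)"
    by (rule has_field_derivative_prod) (rule dB)
  also have "(\<Sum>a\<in>Z. blaschke R a z ^ m a * q a * (\<Prod>b\<in>Z - {a}. blaschke R b z ^ m b)) = (\<Sum>a\<in>Z. q a * (\<Prod>b\<in>Z. blaschke R b z ^ m b))"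
    using Z by (intro sum.cong refl) (simp add: prod.remove mult_ac)
  also have "\<dots> = (\<Prod>b\<in>Z. blaschke R b z ^ m b) * (\<Sum>a\<in>Z. q a)" unfolding sum_distrib_left by (simp only: mult.commute)
  finally have dP: "((\<lambda>z. \<Prod>a\<in>Z. blaschke R a z ^ m a) has_field_derivative (\<Prod>b\<in>Z. blaschke R b z ^ m b) * (\<Sum>a\<in>Z. q a)) (at z)" .
  have "(h has_field_derivative deriv h z) (at z)"
    using z by (intro holomorphic_derivI[OF h]) auto
  then have "((\<lambda>z. (\<Prod>a\<in>Z. blaschke R a z ^ m a) * exp (h z)) has_field_derivative
      (\<Prod>b\<in>Z. blaschke R b z ^ m b) * exp (h z) * ((\<Sum>a\<in>Z. q a) + deriv h z)) (at z)"
    by (auto intro!: derivative_eq_intros dP simp: algebra_simps)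
  then have "(G has_field_derivative G z * ((\<Sum>a\<in>Z. q a) + deriv h z)) (at z)"
    unfolding G[OF z]
    by (rule has_field_derivative_transform_within_open[of _ _ _ "ball 0 R'"]) (use z G in auto)
  then have "deriv G z = G z * ((\<Sum>a\<in>Z. q a) + deriv h z)" by (rule DERIV_imp_deriv)
  moreover have "G z \<noteq> 0"
    unfolding G[OF z] using den[OF _ z] Z zZ R by (auto simp: blaschke_def)
  ultimately show ?thesis by (simp add: q_def)
qed

text \<open>In G'/G, written by the Blaschke factorization on a disc of radius R > 4r, only the
  poles 1/(z - a) are singular, and their logarithmic mean is tamed by inverse square roots. As log
  |G| grows at most like a power, passing from r to a fixed multiple of r costs only constants, so
  the bound holds at every zero-free radius.\<close>

theorem log_derivative_bound:
  assumes G: "G holomorphic_on UNIV" "\<exists>z. G z \<noteq> 0"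
    and K: "0 \<le> K" "0 < \<rho>" "\<And>z. R0 \<le> norm z \<Longrightarrow> norm (G z) \<le> exp (K * norm z powr \<rho>)"
  obtains A where "0 < A" "\<And>r. max 1 R0 \<le> r \<Longrightarrow> zero_free_radius G r \<Longrightarrow>
    proximity (\<lambda>z. deriv G z / G z) r \<le> A + 3 * ln (A + A * r powr \<rho>)"
proof -
  obtain c where c: "0 \<le> c" "\<And>R. 1 \<le> R \<Longrightarrow> zero_free_radius G R \<Longrightarrow>
    circle_mean (\<lambda>z. \<bar>ln (norm (G z))\<bar>) R \<le> 2 * proximity G R + c"
    by (rule circle_mean_abs_ln_le[OF G]) (rule that)
  obtain cJ where cJ: "\<And>R. 0 < R \<Longrightarrow> zero_free_radius G R \<Longrightarrow>
    counting_int (\<lambda>z. 1 / G z) R = circle_mean (\<lambda>z. ln (norm (G z))) R - cJ"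
    by (rule jensen_formula[OF G]) (rule that)
  define m where "m a = nat (zorder G a)" for a
  \<comment> \<open>A1 + A2 r^\<rho> bounds 1 + n + 8 M, where n counts the zeros in |a| < R and M
    is the mean of |ln |G|| at R. The bases 5 and 15 come from R < 5r and R2 < 3R < 15r, and ln 2
    from the count of zeros. \<open>A\<close> also absorbs 40 sqrt 40, twice the bound for inverse
    square roots, and ln 2.\<close>
  define A1 where "A1 = 1 + real (m 0) + \<bar>cJ\<bar> / ln 2 + 8 * c"
  define A2 where "A2 = K * 15 powr \<rho> / ln 2 + 16 * K * 5 powr \<rho>"
  define A where "A = max A1 A2 + 40 * sqrt 40 + ln 2"
  have A1: "1 \<le> A1" using c(1) by (simp add: A1_def)
  have A2: "0 \<le> A2" using K(1) by (simp add: A2_def)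
  have prox: "proximity G R \<le> K * R powr \<rho>" if "R0 \<le> R" "0 \<le> R" for R
  proof -
    have "circle_mean (\<lambda>z. log_plus (norm (G z))) R \<le> circle_mean (\<lambda>z. K * R powr \<rho>) R"
    proof (intro circle_mean_mono continuous_on_log_plus_norm G)
      fix z :: complex assume z: "norm z = R"
      have "log_plus (norm (G z)) \<le> log_plus (exp (K * norm z powr \<rho>))"
        using K(3)[of z] z that by (intro log_plus_mono) auto
      also have "\<dots> = K * R powr \<rho>" using K(1) z by simp
      finally show "log_plus (norm (G z)) \<le> K * R powr \<rho>" .
    qed (use that in auto)
    then show ?thesis by (simp add: proximity_eq_circle_mean)
  qed
  have "proximity (\<lambda>z. deriv G z / G z) r \<le> A + 3 * ln (A + A * r powr \<rho>)"
    if r: "max 1 R0 \<le> r" "zero_free_radius G r" for r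
  proof -
    have r1: "1 \<le> r" "R0 \<le> r" using r by auto
    \<comment> \<open>The bound on h' holds for |z| \<le> R/4, hence the factor 4.\<close>
    obtain R where R: "4 * r < R" "R < 5 * r" "zero_free_radius G R"
      by (rule ex_zero_free_radius[OF G, of "4 * r" "5 * r"]) (use r1 in auto)
    \<comment> \<open>The zeros in |a| \<le> R are counted by N at 2R. Jensen's formula needs a
      zero-free radius, so N is increased to the next such one.\<close>
    obtain R2 where R2: "2 * R < R2" "R2 < 3 * R" "zero_free_radius G R2"
      by (rule ex_zero_free_radius[OF G, of "2 * R" "3 * R"]) (use r1 R in auto)
    have R0: "0 < R" "1 \<le> R" using R r1 by auto
    define Z where "Z = {a. norm a < R \<and> G a = 0}"
    have finZ: "finite Z" unfolding Z_def
      by (rule finite_subset[OF _ finite_zeros_cball[OF G, of R]]) auto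
    obtain h R' where h': "R < R'" "h holomorphic_on ball 0 R'"
        "\<And>z a. norm z < R' \<Longrightarrow> norm a < R \<Longrightarrow> G a = 0 \<Longrightarrow> of_real (R\<^sup>2) - cnj a * z \<noteq> 0"
        "\<And>z. norm z < R' \<Longrightarrow> G z = (\<Prod>a | norm a < R \<and> G a = 0. blaschke R a z ^ nat (zorder G a)) * exp (h z)"
      by (rule blaschke_factorization[OF G R0(1) R(3)]) (rule that)
    define n where "n = (\<Sum>a\<in>Z. real (m a))"
    define M where "M = circle_mean (\<lambda>z. \<bar>ln (norm (G z))\<bar>) R"
    have "M = circle_mean (\<lambda>z. \<bar>Re (h z)\<bar>) R"
      unfolding M_def using R0 circle_mean_ln_norm_blaschke(1)[OF G R0(1) R(3) h'(1,2,4)]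
      by (intro circle_mean_cong) auto
    then have dh: "norm (deriv h z) \<le> 8 * M / R" if "norm z = r" for z
      using holomorphic_deriv_bound[OF h'(2) R0(1) h'(1), of z] that R by simp
    have M0: "0 \<le> M" unfolding M_def using R0 R continuous_on_ln_norm[OF G(1) R(3)]
      by (intro circle_mean_nonneg) (auto intro!: continuous_on_rabs)
    have "R powr \<rho> \<le> (5 * r) powr \<rho>" using R R0 K by (intro powr_mono2) auto
    then have "K * R powr \<rho> \<le> K * (5 powr \<rho> * r powr \<rho>)"
      using r1 K(1) by (intro mult_left_mono) (simp_all add: powr_mult)
    moreover have "M \<le> 2 * (K * R powr \<rho>) + c"
      using c(2)[OF R0(2) R(3)] prox[of R] R r1 by (simp add: M_def)
    ultimately have M: "M \<le> 2 * (K * (5 powr \<rho> * r powr \<rho>)) + c" by linarith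
    have "n \<le> real (m 0) + (\<Sum>a | norm a \<le> R \<and> G a = 0 \<and> a \<noteq> 0. real (m a))"
    proof -
      have "n \<le> (\<Sum>a\<in>insert 0 {a. norm a \<le> R \<and> G a = 0 \<and> a \<noteq> 0}. real (m a))"
        unfolding n_def by (intro sum_mono2 finite.insertI finite_subset[OF _ finite_zeros_cball[OF G, of R]]) (auto simp: Z_def)
      then show ?thesis
        by (subst (asm) sum.insert) (auto intro: finite_subset[OF _ finite_zeros_cball[OF G, of R]])
    qed
    moreover have "(\<Sum>a | norm a \<le> R \<and> G a = 0 \<and> a \<noteq> 0. real (m a)) * ln 2 \<le> K * (15 powr \<rho> * r powr \<rho>) + \<bar>cJ\<bar>"
    proof -
      have "R2 powr \<rho> \<le> (15 * r) powr \<rho>" using R R0 R2 K by (intro powr_mono2) auto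
      then have KR2: "K * R2 powr \<rho> \<le> K * (15 powr \<rho> * r powr \<rho>)"
        using r1 K(1) by (intro mult_left_mono) (simp_all add: powr_mult)
      have "(\<Sum>a | norm a \<le> R \<and> G a = 0 \<and> a \<noteq> 0. real (m a)) * ln 2 \<le> counting_int (\<lambda>z. 1 / G z) (2 * R)"
        unfolding m_def by (rule zero_count_le_counting_int[OF G R0(2)])
      also have "\<dots> \<le> counting_int (\<lambda>z. 1 / G z) R2"
        using R0 R2 by (intro counting_int_mono G) auto
      also have "\<dots> = circle_mean (\<lambda>z. ln (norm (G z))) R2 - cJ" using R0 R2 by (intro cJ) auto
      also have "\<dots> \<le> circle_mean (\<lambda>z. log_plus (norm (G z))) R2 - cJ"
        using R2 R0 continuous_on_ln_norm[OF G(1) R2(3)]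
        by (intro diff_mono circle_mean_mono continuous_on_log_plus_norm G) (auto simp: zero_free_radius_def intro!: ln_le_log_plus)
      also have "\<dots> \<le> K * R2 powr \<rho> + \<bar>cJ\<bar>"
        using prox[of R2] R2 R r1 by (simp add: proximity_eq_circle_mean)
      finally show ?thesis using KR2 by linarith
    qed
    then have "(\<Sum>a | norm a \<le> R \<and> G a = 0 \<and> a \<noteq> 0. real (m a)) \<le> (K * (15 powr \<rho> * r powr \<rho>) + \<bar>cJ\<bar>) / ln 2"
      by (simp add: pos_le_divide_eq)
    ultimately have n: "n \<le> real (m 0) + (K * (15 powr \<rho> * r powr \<rho>) + \<bar>cJ\<bar>) / ln 2" by linarith
    have n0: "0 \<le> n" unfolding n_def by (intro sum_nonneg) auto
    have nM: "1 + n + 8 * M \<le> A1 + A2 * r powr \<rho>"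
      using n M unfolding A1_def A2_def by (simp add: algebra_simps add_divide_distrib)
    have Zr: "norm a \<noteq> r" if "a \<in> Z" for a using that r(2) by (auto simp: Z_def zero_free_radius_def)
    have bound: "norm (deriv G z / G z) \<le> (\<Sum>a\<in>Z. real (m a) / norm (z - a)) + (n + 8 * M)" if z: "norm z = r" for z
    proof -
      have zR: "norm z < R'" "z \<notin> Z" using z R R0 h'(1) r1 Zr by auto
      have eq: "deriv G z / G z = (\<Sum>a\<in>Z. of_nat (m a) * (1 / (z - a) + cnj a / (of_real (R\<^sup>2) - cnj a * z))) + deriv h z"
        by (rule deriv_over_blaschke_product[OF h'(2) zR(1) R0(1) finZ _ zR(2)])
          (use h'(3,4) in \<open>auto simp: Z_def m_def\<close>)
      have "norm (deriv G z / G z) \<le> (\<Sum>a\<in>Z. norm (of_nat (m a) * (1 / (z - a) + cnj a / (of_real (R\<^sup>2) - cnj a * z)))) + norm (deriv h z)"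
        unfolding eq by (intro order_trans[OF norm_triangle_ineq] add_mono norm_sum order_refl)
      also have "\<dots> \<le> (\<Sum>a\<in>Z. real (m a) / norm (z - a) + real (m a)) + 8 * M"
      proof (intro add_mono sum_mono)
        fix a assume a: "a \<in> Z"
        have "norm (cnj a * z) \<le> R * r" using a z R0 by (auto simp: norm_mult Z_def intro!: mult_mono)
        moreover have "norm (of_real (R\<^sup>2)::complex) = R\<^sup>2" by (simp only: norm_of_real) simp
        ultimately have "R\<^sup>2 - R * r \<le> norm (of_real (R\<^sup>2)::complex) - norm (cnj a * z)" by linarith
        also have "\<dots> \<le> norm (of_real (R\<^sup>2) - cnj a * z)" by (rule norm_triangle_ineq2)
        finally have 1: "R * (R - r) \<le> norm (of_real (R\<^sup>2) - cnj a * z)" by (simp add: power2_eq_square algebra_simps)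
        \<comment> \<open>R - r \<ge> 1, so the denominator has modulus at least R > |a| and the
          reflected poles contribute a bounded amount each.\<close>
        have "R * 1 \<le> R * (R - r)" using R r1 R0 by (intro mult_left_mono) auto
        then have 2: "R \<le> norm (of_real (R\<^sup>2) - cnj a * z)" using 1 by simp
        have "norm (cnj a / (of_real (R\<^sup>2) - cnj a * z)) \<le> 1"
          unfolding norm_divide using 2 R0 a by (subst divide_le_eq_1_pos) (auto simp: Z_def)
        then have "norm (1 / (z - a) + cnj a / (of_real (R\<^sup>2) - cnj a * z)) \<le> 1 / norm (z - a) + 1"
          by (intro order_trans[OF norm_triangle_ineq] add_mono) (auto simp: norm_divide)
        then have "real (m a) * norm (1 / (z - a) + cnj a / (of_real (R\<^sup>2) - cnj a * z)) \<le> real (m a) * (1 / norm (z - a) + 1)"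
          by (intro mult_left_mono) auto
        then show "norm (of_nat (m a) * (1 / (z - a) + cnj a / (of_real (R\<^sup>2) - cnj a * z))) \<le> real (m a) / norm (z - a) + real (m a)"
          unfolding norm_mult norm_of_nat by (simp add: distrib_left)
      next
        have "8 * M * 1 \<le> 8 * M * R" using M0 R0 by (intro mult_left_mono) auto
        then have "8 * M / R \<le> 8 * M" using R0 by (simp add: divide_le_eq)
        then show "norm (deriv h z) \<le> 8 * M" using dh[OF z] by linarith
      qed
      also have "\<dots> = (\<Sum>a\<in>Z. real (m a) / norm (z - a)) + (n + 8 * M)"
        by (simp add: sum.distrib n_def)
      finally show ?thesis .
    qed
    define B where "B = 2 * ln (1 + n) + log_plus (n + 8 * M) + ln 2"
    have ptw: "log_plus (norm (deriv G z / G z)) \<le> B + 2 / (1 + n) * (\<Sum>a\<in>Z. real (m a) * (1 / sqrt (norm (z - a))))"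
      if z: "norm z = r" for z
    proof -
      have pos: "0 < norm (z - a)" if "a \<in> Z" for a using Zr[OF that] z by auto
      have "log_plus (norm (deriv G z / G z)) \<le> log_plus ((\<Sum>a\<in>Z. real (m a) / norm (z - a)) + (n + 8 * M))"
        by (rule log_plus_mono[OF bound[OF z]])
      moreover have "\<dots> \<le> log_plus (\<Sum>a\<in>Z. real (m a) / norm (z - a)) + log_plus (n + 8 * M) + ln 2"
        using n0 M0 by (intro log_plus_add sum_nonneg) auto
      moreover have "log_plus (\<Sum>a\<in>Z. real (m a) / norm (z - a)) \<le> 2 * ln (1 + n) + 2 / (1 + n) * (\<Sum>a\<in>Z. real (m a) * (1 / sqrt (norm (z - a))))"
        unfolding n_def by (rule log_plus_sum_le[OF finZ pos])
      ultimately show ?thesis unfolding B_def by linarith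
    qed
    have contG: "continuous_on (sphere 0 r) G" "continuous_on (sphere 0 r) (deriv G)"
      using G(1) holomorphic_deriv[OF G(1)]
      by (auto intro!: holomorphic_on_imp_continuous_on intro: holomorphic_on_subset)
    have cont1: "continuous_on (sphere 0 r) (\<lambda>z. log_plus (norm (deriv G z / G z)))"
      using r(2) by (intro continuous_intros contG) (auto simp: zero_free_radius_def)
    have cont2: "continuous_on (sphere 0 r) (\<lambda>z. real (m a) * (1 / sqrt (norm (z - a))))" if "a \<in> Z" for a
      using Zr[OF that] by (intro continuous_intros) auto
    have "proximity (\<lambda>z. deriv G z / G z) r \<le> circle_mean (\<lambda>z. B + 2 / (1 + n) * (\<Sum>a\<in>Z. real (m a) * (1 / sqrt (norm (z - a))))) r"
      unfolding proximity_eq_circle_mean using r1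
      by (intro circle_mean_mono cont1 ptw continuous_on_add continuous_on_mult continuous_on_const continuous_on_sum cont2) auto
    also have "\<dots> = B + 2 / (1 + n) * (\<Sum>a\<in>Z. real (m a) * circle_mean (\<lambda>z. 1 / sqrt (norm (z - a))) r)"
    proof -
      have r0: "0 \<le> r" using r1 by simp
      have "continuous_on (sphere 0 r) (\<lambda>z. \<Sum>a\<in>Z. real (m a) * (1 / sqrt (norm (z - a))))"
        by (intro continuous_on_sum cont2)
      then show ?thesis
        by (simp only: circle_mean_add[OF r0 continuous_on_const continuous_on_mult[OF continuous_on_const]]
            circle_mean_const circle_mean_cmult circle_mean_sum[OF finZ r0 cont2])
    qed
    also have "\<dots> \<le> B + 2 / (1 + n) * (\<Sum>a\<in>Z. real (m a) * (20 * sqrt 40))"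
      using r1 n0 by (intro add_left_mono mult_left_mono sum_mono circle_mean_inverse_sqrt_le Zr) auto
    \<comment> \<open>The uniform bound makes the sum of means proportional to n, and n / (1 + n)
      \<le> 1 removes the dependence on the number of zeros.\<close>
    also have "\<dots> = B + 40 * sqrt 40 * (n / (1 + n))"
      by (simp add: n_def sum_distrib_right[symmetric])
    also have "\<dots> \<le> B + 40 * sqrt 40 * 1"
      using n0 by (intro add_left_mono mult_left_mono) auto
    finally have 1: "proximity (\<lambda>z. deriv G z / G z) r \<le> B + 40 * sqrt 40" by simp
    define Y where "Y = A + A * r powr \<rho>"
    have YA: "A1 + A2 * r powr \<rho> \<le> Y"
    proof -
      have "A1 \<le> A" "A2 \<le> A" by (auto simp: A_def max_def intro!: add_increasing2)
      then show ?thesis unfolding Y_def by (intro add_mono mult_right_mono) auto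
    qed
    have "ln (1 + n) \<le> ln Y" using n0 nM YA M0 by (subst ln_le_cancel_iff) auto
    moreover have "log_plus (n + 8 * M) \<le> ln Y" unfolding log_plus_def
      using n0 nM YA M0 by (subst ln_le_cancel_iff) auto
    ultimately have "B + 40 * sqrt 40 \<le> 3 * ln Y + (ln 2 + 40 * sqrt 40)" by (simp add: B_def)
    also have "\<dots> \<le> A + 3 * ln Y" using A1 by (simp add: A_def)
    finally show ?thesis using 1 by (simp add: Y_def)
  qed
  moreover have "0 < A" using A1 by (auto simp: A_def intro!: add_pos_nonneg)
  ultimately show ?thesis using that by blast
qed

section \<open>Factoring out the zeros of an entire function of finite order\<close>

text \<open>For small u the factor is 1 + O(|u|^(p+1)), and |u|^(p+1) \<le> |u|^s because s \<le> p
  + 1. Otherwise 2 |u| > 1, so every power |u|^k with k \<le> p \<le> s is dominated by (2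
  |u|)^s.\<close>

lemma norm_weierstrass_factor_le:
  assumes s: "0 < s" "real p \<le> s" "s \<le> real p + 1"
  obtains C where "0 \<le> C" "\<And>u. norm (weierstrass_factor p u) \<le> exp (C * norm u powr s)"
proof -
  define C where "C = 3 + real p * 2 powr s + 3 powr s / s"
  have C: "3 \<le> C" "real p * 2 powr s + 3 powr s / s \<le> C" using s by (auto simp: C_def)
  have "norm (weierstrass_factor p u) \<le> exp (C * norm u powr s)" for u
  proof (cases "norm u \<le> 1 / 2")
    case True
    have "norm (weierstrass_factor p u) \<le> 1 + norm (weierstrass_factor p u - 1)"
      using norm_triangle_ineq[of 1 "weierstrass_factor p u - 1"] by simp
    also have "\<dots> \<le> 1 + 3 * norm u ^ Suc p"
      using weierstrass_factor_bound[OF True, of p] by simp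
    also have "\<dots> \<le> exp (3 * norm u ^ Suc p)" by (rule exp_ge_add_one_self)
    also have "3 * norm u ^ Suc p \<le> C * norm u powr s"
    proof (intro mult_mono C(1))
      show "norm u ^ Suc p \<le> norm u powr s"
      proof (cases "u = 0")
        case False
        then have "norm u ^ Suc p = norm u powr (real p + 1)" by (simp add: powr_realpow[symmetric] powr_add)
        also have "\<dots> \<le> norm u powr s" using False True s by (intro powr_mono') auto
        finally show ?thesis .
      qed auto
    qed (use C in auto)
    finally show ?thesis by simp
  next
    case False
    define t where "t = norm u"
    have t: "1 / 2 \<le> t" using False by (simp add: t_def)
    have pw: "t ^ k \<le> 2 powr s * t powr s" if "k \<le> p" for k
    proof -
      have "t ^ k \<le> (2 * t) ^ k" using t by (intro power_mono) auto
      also have "\<dots> = (2 * t) powr real k" using t by (simp add: powr_realpow)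
      also have "\<dots> \<le> (2 * t) powr s" using t that s by (intro powr_mono) auto
      finally show ?thesis using t by (simp add: powr_mult)
    qed
    have "norm (\<Sum>k = 1..p. u ^ k / of_nat k) \<le> (\<Sum>k = 1..p. 2 powr s * t powr s)"
    proof (rule sum_norm_le)
      fix k assume k: "k \<in> {1..p}"
      have "norm (u ^ k / of_nat k) = t ^ k / real k" by (simp add: norm_divide norm_power t_def)
      also have "\<dots> \<le> t ^ k / 1" using k t by (intro divide_left_mono) auto
      also have "\<dots> \<le> 2 powr s * t powr s" using pw[of k] k by simp
      finally show "norm (u ^ k / of_nat k) \<le> 2 powr s * t powr s" .
    qed
    then have 1: "Re (\<Sum>k = 1..p. u ^ k / of_nat k) \<le> real p * (2 powr s * t powr s)"
      using complex_Re_le_cmod[of "\<Sum>k = 1..p. u ^ k / of_nat k"] by simp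
    \<comment> \<open>The inequality ln x \<le> x - 1 is applied to x = (1 + t)^s; then 1 + t \<le>
      3t because t \<ge> 1/2.\<close>
    have "s * ln (1 + t) = ln ((1 + t) powr s)" using t by (simp add: ln_powr)
    also have "\<dots> \<le> (1 + t) powr s - 1" using t by (intro ln_le_minus_one) auto
    also have "\<dots> \<le> (3 * t) powr s" using t s powr_mono2[of s "1 + t" "3 * t"] by simp
    also have "\<dots> = 3 powr s * t powr s" using t by (simp add: powr_mult)
    finally have "ln (1 + t) \<le> 3 powr s / s * t powr s" using s by (simp add: field_simps)
    then have "exp (ln (1 + t)) \<le> exp (3 powr s / s * t powr s)" by simp
    then have 2: "1 + t \<le> exp (3 powr s / s * t powr s)" using t by simp
    have "norm (weierstrass_factor p u) = norm (1 - u) * exp (Re (\<Sum>k = 1..p. u ^ k / of_nat k))"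
      by (simp add: weierstrass_factor_def norm_mult)
    also have "\<dots> \<le> exp (3 powr s / s * t powr s) * exp (real p * (2 powr s * t powr s))"
      using 1 2 norm_triangle_ineq4[of 1 u] by (intro mult_mono) (auto simp: t_def)
    also have "\<dots> = exp ((real p * 2 powr s + 3 powr s / s) * t powr s)"
      by (simp add: exp_add[symmetric] algebra_simps)
    also have "\<dots> \<le> exp (C * t powr s)" using C by (simp add: mult_right_mono)
    finally show ?thesis by (simp add: t_def)
  qed
  then show ?thesis using that[of C] C by auto
qed

text \<open>The number of zeros up to r is O(r^\<sigma>). A shell between consecutive powers of 2
  then contributes at most a constant times (2^(\<sigma> - s))^k, so the shells form a convergent
  geometric series.\<close>

lemma zeros_convergence_exponent:
  assumes G: "G holomorphic_on UNIV" "\<exists>z. G z \<noteq> 0"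
    and N: "\<And>r. r0 \<le> r \<Longrightarrow> counting_int (\<lambda>z. 1 / G z) r \<le> r powr \<sigma>" and s: "\<sigma> < s" "0 < s"
  obtains C where "0 \<le> C" "\<And>R. (\<Sum>a | norm a \<le> R \<and> G a = 0 \<and> a \<noteq> 0. real (nat (zorder G a)) * norm a powr (-s)) \<le> C"
proof -
  define m where "m a = real (nat (zorder G a))" for a
  define Z where "Z R = {a. norm a \<le> R \<and> G a = 0 \<and> a \<noteq> 0}" for R
  have finZ: "finite (Z R)" for R
    unfolding Z_def by (rule finite_subset[OF _ finite_zeros_cball[OF G, of R]]) auto
  define S where "S R = (\<Sum>a\<in>Z R. m a * norm a powr (-s))" for R
  have mono: "S r \<le> S R" if "r \<le> R" for r R
    unfolding S_def by (intro sum_mono2 finZ) (use that in \<open>auto simp: Z_def m_def\<close>)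
  have S0: "0 \<le> S r" for r unfolding S_def m_def by (intro sum_nonneg) auto
  \<comment> \<open>The dyadic decomposition starts beyond r0 and 1, where the bound on N is
    available; the zeros before that give the constant \<open>S (2 ^ N0)\<close>.\<close>
  obtain N0 :: nat where N0: "max 1 r0 < 2 ^ N0" using real_arch_pow[of 2 "max 1 r0"] by (auto simp del: max_less_iff_conj)
  define D where "D = 2 powr \<sigma> / ln 2"
  have D0: "0 \<le> D" by (simp add: D_def)
  have cnt: "(\<Sum>a\<in>Z r. m a) \<le> D * r powr \<sigma>" if r: "max 1 r0 \<le> r" for r
  proof -
    have "(\<Sum>a\<in>Z r. m a) * ln 2 \<le> counting_int (\<lambda>z. 1 / G z) (2 * r)"
      unfolding Z_def m_def using r by (intro zero_count_le_counting_int G) auto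
    also have "\<dots> \<le> (2 * r) powr \<sigma>" using r by (intro N) auto
    also have "\<dots> = 2 powr \<sigma> * r powr \<sigma>" using r by (simp add: powr_mult)
    finally show ?thesis by (simp add: D_def field_simps)
  qed
  define q where "q = 2 powr (\<sigma> - s)"
  have q: "0 < q" "q < 1" using s by (auto simp: q_def powr_less_one)
  define E where "E = D * 2 powr \<sigma> * (2 ^ N0) powr (\<sigma> - s)"
  have E0: "0 \<le> E" using D0 by (simp add: E_def)
  have step: "S (2 ^ (N0 + k)) \<le> S (2 ^ N0) + (\<Sum>i<k. E * q ^ i)" for k
  proof (induction k)
    case (Suc k)
    define r where "r = (2::real) ^ (N0 + k)"
    have "max 1 r0 \<le> 2 ^ N0" using N0 by (rule less_imp_le)
    also have "(2::real) ^ N0 \<le> r" unfolding r_def by (intro power_increasing) auto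
    finally have r: "max 1 r0 \<le> r" .
    then have r1: "1 \<le> r" by simp
    have "S (2 * r) = S r + (\<Sum>a\<in>Z (2 * r) - Z r. m a * norm a powr (-s))"
      unfolding S_def by (rule sum.subset_diff[THEN trans]) (use r1 finZ in \<open>auto simp: Z_def add.commute\<close>)
    also have "(\<Sum>a\<in>Z (2 * r) - Z r. m a * norm a powr (-s)) \<le> (\<Sum>a\<in>Z (2 * r) - Z r. m a * r powr (-s))"
      using r1 s by (intro sum_mono mult_left_mono powr_mono2') (auto simp: Z_def m_def)
    also have "\<dots> \<le> (\<Sum>a\<in>Z (2 * r). m a * r powr (-s))"
      by (intro sum_mono2 finZ) (auto simp: m_def)
    also have "\<dots> = (\<Sum>a\<in>Z (2 * r). m a) * r powr (-s)" by (simp add: sum_distrib_right)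
    also have "\<dots> \<le> D * (2 * r) powr \<sigma> * r powr (-s)"
      using r1 r by (intro mult_right_mono cnt) auto
    also have "\<dots> = D * 2 powr \<sigma> * r powr (\<sigma> - s)"
      using r1 by (simp add: powr_mult powr_diff powr_minus divide_inverse)
    also have "r powr (\<sigma> - s) = (2 ^ N0) powr (\<sigma> - s) * q ^ k"
    proof -
      have "(2 ^ k) powr (\<sigma> - s) = q ^ k"
        by (simp add: q_def powr_powr powr_realpow[symmetric] mult.commute)
      then show ?thesis by (simp add: r_def power_add powr_mult)
    qed
    finally have "S (2 * r) \<le> S r + E * q ^ k" by (simp add: E_def mult_ac)
    then show ?case using Suc.IH by (simp add: r_def)
  qed simp
  have "S R \<le> S (2 ^ N0) + E / (1 - q)" for R
  proof -
    obtain k :: nat where k: "R < 2 ^ k" using real_arch_pow[of 2 R] by auto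
    have "S R \<le> S (2 ^ (N0 + k))"
    proof (rule mono)
      have "(2::real) ^ k \<le> 2 ^ (N0 + k)" by (intro power_increasing) auto
      then show "R \<le> 2 ^ (N0 + k)" using k by linarith
    qed
    also have "\<dots> \<le> S (2 ^ N0) + E * (\<Sum>i<k. q ^ i)" using step[of k] by (simp add: sum_distrib_left)
    also have "(\<Sum>i<k. q ^ i) \<le> 1 / (1 - q)"
      using q by (simp add: geometric_sum sum_gp_strict divide_right_mono)
    finally show ?thesis using E0 by (simp add: mult_left_mono)
  qed
  then show ?thesis using that[of "S (2 ^ N0) + E / (1 - q)"] S0 E0 q unfolding S_def Z_def m_def by simp
qed

text \<open>Only the bound on \<open>P\<close> matters, so instead of proving convergence of the canonical product
  we take a locally uniform limit of its partial products by Montel's theorem; Hurwitz's theorem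
  keeps the zeros under control.\<close>

lemma canonical_product:
  fixes m :: "complex \<Rightarrow> nat"
  assumes fin: "\<And>k::nat. finite (Z k)" and Zm: "\<And>k l. k \<le> l \<Longrightarrow> Z k \<subseteq> Z l"
    and Zc: "\<And>k l a. a \<in> Z l - Z k \<Longrightarrow> real k \<le> norm a" and Z0: "\<And>k. 0 \<notin> Z k"
    and bnd: "\<And>k. (\<Sum>a\<in>Z k. real (m a) * norm a powr (-s)) \<le> C" and C: "0 \<le> C"
    and E: "0 \<le> C1" "\<And>u. norm (weierstrass_factor p u) \<le> exp (C1 * norm u powr s)" and s: "0 < s"
  obtains P where "P holomorphic_on UNIV" "P 0 = 1" "\<And>z. norm (P z) \<le> exp (C1 * C * norm z powr s)"
    "\<And>k. \<exists>Q. Q holomorphic_on UNIV \<and> (\<forall>z. P z = (\<Prod>a\<in>Z k. weierstrass_factor p (z / a) ^ m a) * Q z) \<and> (\<forall>z\<in>ball 0 (real k). Q z \<noteq> 0)"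
proof -
  define F where "F S z = (\<Prod>a\<in>S. weierstrass_factor p (z / a) ^ m a)" for S z
  \<comment> \<open>One locally uniform bound serves all finite partial products and all their
    tails, so both are normal families.\<close>
  define H where "H = {h. h holomorphic_on UNIV \<and> (\<forall>z. norm (h z) \<le> exp (C1 * C * norm z powr s))}"
  have FH: "F S \<in> H" if S: "S \<subseteq> Z k" for S k
  proof -
    have S0: "a \<noteq> 0" if "a \<in> S" for a using S Z0[of k] that by auto
    have "F S holomorphic_on UNIV"
      unfolding F_def using S0 by (intro holomorphic_intros) auto
    moreover have "norm (F S z) \<le> exp (C1 * C * norm z powr s)" for z
    proof -
      have "norm (F S z) \<le> (\<Prod>a\<in>S. exp (C1 * norm z powr s * (real (m a) * norm a powr (-s))))"
        unfolding F_def prod_norm[symmetric]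
      proof (intro prod_mono conjI norm_ge_zero)
        fix a assume a: "a \<in> S"
        have "norm (weierstrass_factor p (z / a) ^ m a) \<le> exp (C1 * norm (z / a) powr s) ^ m a"
          unfolding norm_power by (intro power_mono E) auto
        also have "\<dots> = exp (real (m a) * (C1 * norm (z / a) powr s))" by (simp add: exp_of_nat_mult)
        also have "norm (z / a) powr s = norm z powr s * norm a powr (-s)"
          by (simp add: norm_divide powr_divide powr_minus_divide)
        finally show "norm (weierstrass_factor p (z / a) ^ m a) \<le> exp (C1 * norm z powr s * (real (m a) * norm a powr (-s)))"
          by (simp add: mult_ac)
      qed
      also have "\<dots> = exp (C1 * norm z powr s * (\<Sum>a\<in>S. real (m a) * norm a powr (-s)))"
        using finite_subset[OF S fin] by (simp add: exp_sum sum_distrib_left)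
      also have "\<dots> \<le> exp (C1 * norm z powr s * C)"
      proof -
        have "(\<Sum>a\<in>S. real (m a) * norm a powr (-s)) \<le> (\<Sum>a\<in>Z k. real (m a) * norm a powr (-s))"
          by (intro sum_mono2 fin S) auto
        then have "(\<Sum>a\<in>S. real (m a) * norm a powr (-s)) \<le> C" using bnd[of k] by linarith
        then show ?thesis using E(1) by (simp add: mult_left_mono)
      qed
      finally show ?thesis by (simp add: mult_ac)
    qed
    ultimately show ?thesis by (simp add: H_def)
  qed
  have F0: "F S 0 = 1" for S by (simp add: F_def)
  have Hbd: "\<exists>B. \<forall>h\<in>H. \<forall>z\<in>K. norm (h z) \<le> B" if K: "compact K" for K
  proof -
    obtain b where b: "\<And>z. z \<in> K \<Longrightarrow> norm z \<le> b" using compact_imp_bounded[OF K] by (auto simp: bounded_iff)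
    have "norm (h z) \<le> exp (C1 * C * \<bar>b\<bar> powr s)" if "h \<in> H" "z \<in> K" for h z
    proof -
      have "norm (h z) \<le> exp (C1 * C * norm z powr s)" using that by (simp add: H_def)
      also have "norm z powr s \<le> \<bar>b\<bar> powr s" using b[OF that(2)] s by (intro powr_mono2) auto
      then have "exp (C1 * C * norm z powr s) \<le> exp (C1 * C * \<bar>b\<bar> powr s)" using C E(1) by (simp add: mult_left_mono)
      finally show ?thesis .
    qed
    then show ?thesis by blast
  qed
  have Hh: "h holomorphic_on UNIV" if "h \<in> H" for h using that by (simp add: H_def)
  obtain P r where P: "P holomorphic_on UNIV" "strict_mono (r :: nat \<Rightarrow> nat)"
      "\<And>x. x \<in> UNIV \<Longrightarrow> ((\<lambda>n. F (Z (r n)) x) \<longlongrightarrow> P x) sequentially"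
      "\<And>K. compact K \<Longrightarrow> K \<subseteq> UNIV \<Longrightarrow> uniform_limit K ((\<lambda>n. F (Z n)) \<circ> r) P sequentially"
    by (rule Montel[OF open_UNIV Hh Hbd, of "\<lambda>n. F (Z n)"]) (use FH in auto)
  have "P 0 = 1"
    using P(3)[of 0] by (simp add: F0 LIMSEQ_const_iff)
  moreover have "norm (P z) \<le> exp (C1 * C * norm z powr s)" for z
  proof (rule LIMSEQ_le_const2)
    show "(\<lambda>n. norm (F (Z (r n)) z)) \<longlonglongrightarrow> norm (P z)" using P(3)[of z] by (intro tendsto_norm) auto
    show "\<exists>N. \<forall>n\<ge>N. norm (F (Z (r n)) z) \<le> exp (C1 * C * norm z powr s)"
      using FH[of "Z (r _)"] by (auto simp: H_def)
  qed
  moreover have "\<exists>Q. Q holomorphic_on UNIV \<and> (\<forall>z. P z = F (Z k) z * Q z) \<and> (\<forall>z\<in>ball 0 (real k). Q z \<noteq> 0)" for k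
  proof -
    have rk: "k \<le> r (j + k)" for j using seq_suble[OF P(2), of "j + k"] by linarith
    \<comment> \<open>The tail beyond \<open>Z k\<close> is extracted along a further subsequence,
      so that \<open>P\<close> remains the same for every k.\<close>
    obtain Q t where Q: "Q holomorphic_on UNIV" "strict_mono (t :: nat \<Rightarrow> nat)"
      "\<And>x. x \<in> UNIV \<Longrightarrow> ((\<lambda>n. F (Z (r (t n + k)) - Z k) x) \<longlongrightarrow> Q x) sequentially"
      "\<And>K. compact K \<Longrightarrow> K \<subseteq> UNIV \<Longrightarrow> uniform_limit K ((\<lambda>n. F (Z (r (n + k)) - Z k)) \<circ> t) Q sequentially"
      by (rule Montel[OF open_UNIV Hh Hbd, of "\<lambda>n. F (Z (r (n + k)) - Z k)"]) (use FH[OF Diff_subset] in auto)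
    have split: "F (Z (r (n + k))) z = F (Z k) z * F (Z (r (n + k)) - Z k) z" for n z
      unfolding F_def using prod.subset_diff[OF Zm[OF rk] fin] by (simp add: mult.commute)
    have PQ: "P z = F (Z k) z * Q z" for z
    proof (rule LIMSEQ_unique)
      have "strict_mono (\<lambda>n. t n + k)" using Q(2) by (simp add: strict_mono_def)
      from LIMSEQ_subseq_LIMSEQ[OF P(3)[OF UNIV_I] this]
      show "(\<lambda>n. F (Z (r (t n + k))) z) \<longlonglongrightarrow> P z" by (simp add: o_def)
      show "(\<lambda>n. F (Z (r (t n + k))) z) \<longlonglongrightarrow> F (Z k) z * Q z"
        unfolding split by (intro tendsto_mult tendsto_const Q(3)) auto
    qed
    \<comment> \<open>The normalisation at the origin settles the case of a constant limit, to which
      Hurwitz's theorem does not apply.\<close>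
    have Q0: "Q 0 = 1" using Q(3)[of 0] by (simp add: F0 LIMSEQ_const_iff)
    have "Q z \<noteq> 0" if z: "z \<in> ball 0 (real k)" for z
    proof (cases "Q constant_on ball 0 (real k)")
      case True
      moreover have "0 < real k" using z norm_ge_zero[of z] unfolding mem_ball_0 by linarith
      then have "(0::complex) \<in> ball 0 (real k)" by simp
      ultimately have "Q z = Q 0" using z unfolding constant_on_def by metis
      then show ?thesis using Q0 by simp
    next
      case False
      show ?thesis
      proof (rule Hurwitz_no_zeros[of "ball 0 (real k)" "(\<lambda>n. F (Z (r (n + k)) - Z k)) \<circ> t" Q])
        show "((\<lambda>n. F (Z (r (n + k)) - Z k)) \<circ> t) n holomorphic_on ball 0 (real k)" for n
          using Hh[OF FH[of "Z (r (t n + k)) - Z k" "r (t n + k)"]] by (auto intro: holomorphic_on_subset)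
        show "Q holomorphic_on ball 0 (real k)" using Q(1) by (rule holomorphic_on_subset) auto
        show "((\<lambda>n. F (Z (r (n + k)) - Z k)) \<circ> t) n x \<noteq> 0" if x: "x \<in> ball 0 (real k)" for n x
        proof -
          have "weierstrass_factor p (x / a) \<noteq> 0" if a: "a \<in> Z (r (t n + k)) - Z k" for a
            using Zc[OF a] x a Z0 by auto
          then show ?thesis using fin by (auto simp: F_def)
        qed
      qed (use False z Q(4) in auto)
    qed
    then show ?thesis using Q(1) PQ by blast
  qed
  ultimately show ?thesis using that[of P] P(1) unfolding F_def by blast
qed

text \<open>With the zeros put into a canonical product P of controlled growth, G/P extends to a
  zero-free entire function and therefore has an entire logarithm.\<close>

theorem canonical_factorization:
  assumes G: "G holomorphic_on UNIV" "\<exists>z. G z \<noteq> 0"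
    and N: "\<And>r. r0 \<le> r \<Longrightarrow> counting_int (\<lambda>z. 1 / G z) r \<le> r powr \<sigma>" and s: "\<sigma> < s" "0 < s"
  obtains P q C n where "P holomorphic_on UNIV" "\<exists>z. P z \<noteq> 0" "q holomorphic_on UNIV"
    "\<And>z. G z = P z * exp (q z)" "0 \<le> C" "\<And>z. norm (P z) \<le> norm z ^ n * exp (C * norm z powr s)"
proof -
  \<comment> \<open>With this genus p \<le> s \<le> p + 1, as the bound on the Weierstrass factor
    demands.\<close>
  define p where "p = nat \<lfloor>s\<rfloor>"
  have p: "real p \<le> s" "s \<le> real p + 1" using s by (auto simp: p_def)
  obtain C1 where C1: "0 \<le> C1" "\<And>u. norm (weierstrass_factor p u) \<le> exp (C1 * norm u powr s)"
    by (rule norm_weierstrass_factor_le[OF s(2) p]) (rule that)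
  obtain C where C: "0 \<le> C" "\<And>R. (\<Sum>a | norm a \<le> R \<and> G a = 0 \<and> a \<noteq> 0. real (nat (zorder G a)) * norm a powr (-s)) \<le> C"
    using zeros_convergence_exponent[OF G N s] that by blast
  define m where "m a = nat (zorder G a)" for a
  define Z where "Z k = {a. norm a \<le> real k \<and> G a = 0 \<and> a \<noteq> 0}" for k :: nat
  have finZ: "finite (Z k)" for k
    unfolding Z_def by (rule finite_subset[OF _ finite_zeros_cball[OF G, of "real k"]]) auto
  have bnd: "(\<Sum>a\<in>Z k. real (m a) * norm a powr (-s)) \<le> C" for k
    using C(2)[of "real k"] by (simp add: Z_def m_def)
  have Z1: "Z k \<subseteq> Z l" if "k \<le> l" for k l using that by (auto simp: Z_def)
  have Z2: "real k \<le> norm a" if "a \<in> Z l - Z k" for a k l using that by (auto simp: Z_def)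
  have Z3: "0 \<notin> Z k" for k by (simp add: Z_def)
  obtain P0 where P0: "P0 holomorphic_on UNIV" "P0 0 = 1" "\<And>z. norm (P0 z) \<le> exp (C1 * C * norm z powr s)"
    "\<And>k. \<exists>Q. Q holomorphic_on UNIV \<and> (\<forall>z. P0 z = (\<Prod>a\<in>Z k. weierstrass_factor p (z / a) ^ m a) * Q z) \<and> (\<forall>z\<in>ball 0 (real k). Q z \<noteq> 0)"
    by (rule canonical_product[where Z = Z and m = m, OF finZ Z1 Z2 Z3 bnd C(1) C1 s(2)]) (assumption | rule that)+
  define P where "P z = z ^ m 0 * P0 z" for z
  have Ph: "P holomorphic_on UNIV" unfolding P_def by (intro holomorphic_intros P0)
  \<comment> \<open>P0(0) = 1 does not suffice because of the factor z^(m 0); a nearby point z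
    \<noteq> 0 is used.\<close>
  have P_nz: "\<exists>z. P z \<noteq> 0"
  proof -
    have "eventually (\<lambda>z. P0 z \<noteq> 0 \<and> z \<in> UNIV) (at 0)"
      by (rule non_zero_neighbour_alt[OF P0(1), where \<beta> = 0]) (use P0(2) in auto)
    then have "eventually (\<lambda>z. P0 z \<noteq> 0 \<and> z \<noteq> 0) (at 0)"
      using eventually_neq_at_within[of 0 0 UNIV] by eventually_elim auto
    then obtain z where "P0 z \<noteq> 0" "z \<noteq> 0" using eventually_happens[of _ "at (0::complex)"] by auto
    then show ?thesis by (auto simp: P_def)
  qed
  have local: "\<exists>w. w holomorphic_on ball 0 (real k) \<and> (\<forall>z\<in>ball 0 (real k). G z = P z * w z \<and> w z \<noteq> 0)" for k
  proof -
    obtain Q where Q: "Q holomorphic_on UNIV" "\<And>z. P0 z = (\<Prod>a\<in>Z k. weierstrass_factor p (z / a) ^ m a) * Q z"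
        "\<And>z. z \<in> ball 0 (real k) \<Longrightarrow> Q z \<noteq> 0"
      using P0(4)[of k] by auto
    have "finite (insert 0 (Z k))" using finZ by simp
    from entire_factor_zeros[OF this G] obtain g where g: "g holomorphic_on UNIV"
        "\<And>z. G z = (\<Prod>a\<in>insert 0 (Z k). (z - a) ^ m a) * g z" "\<And>a. a \<in> insert 0 (Z k) \<Longrightarrow> g a \<noteq> 0"
      unfolding m_def by auto
    \<comment> \<open>The zero-free cofactor that turns a Weierstrass factor back into z -
      a.\<close>
    define e where "e a z = - a * exp (- (\<Sum>j = 1..p. (z / a) ^ j / of_nat j))" for a z :: complex
    define w where "w z = (\<Prod>a\<in>Z k. e a z ^ m a) * g z / Q z" for z
    have Za: "a \<noteq> 0" if "a \<in> Z k" for a using that by (simp add: Z_def)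
    have lin: "z - a = weierstrass_factor p (z / a) * e a z" if "a \<in> Z k" for a z
    proof -
      have "weierstrass_factor p (z / a) * e a z = (1 - z / a) * (- a) * (exp (\<Sum>j = 1..p. (z / a) ^ j / of_nat j) * exp (- (\<Sum>j = 1..p. (z / a) ^ j / of_nat j)))"
        unfolding weierstrass_factor_def e_def by (simp only: mult_ac)
      also have "\<dots> = (1 - z / a) * (- a)" by (simp add: exp_minus)
      also have "\<dots> = z - a" using Za[OF that] by (simp add: field_simps)
      finally show ?thesis by simp
    qed
    have "w holomorphic_on ball 0 (real k)" unfolding w_def e_def
      by (intro holomorphic_intros holomorphic_on_subset[OF g(1)] holomorphic_on_subset[OF Q(1)]) (use Q(3) Za in auto)
    moreover have "G z = P z * w z" if z: "z \<in> ball 0 (real k)" for z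
    proof -
      have "(\<Prod>a\<in>insert 0 (Z k). (z - a) ^ m a) = z ^ m 0 * (\<Prod>a\<in>Z k. (z - a) ^ m a)"
        using finZ by (simp add: Z_def)
      also have "(\<Prod>a\<in>Z k. (z - a) ^ m a) = (\<Prod>a\<in>Z k. (weierstrass_factor p (z / a) * e a z) ^ m a)"
        by (intro prod.cong refl) (simp only: lin[symmetric])
      also have "\<dots> = (\<Prod>a\<in>Z k. weierstrass_factor p (z / a) ^ m a) * (\<Prod>a\<in>Z k. e a z ^ m a)"
        by (simp only: power_mult_distrib prod.distrib)
      finally have "G z = z ^ m 0 * ((\<Prod>a\<in>Z k. weierstrass_factor p (z / a) ^ m a) * (\<Prod>a\<in>Z k. e a z ^ m a)) * g z"
        using g(2)[of z] by simp
      then show ?thesis using Q(3)[OF z] by (simp add: P_def Q(2) w_def)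
    qed
    moreover have "w z \<noteq> 0" if z: "z \<in> ball 0 (real k)" for z
    proof -
      have "g z \<noteq> 0"
      proof
        assume g0: "g z = 0"
        then have "G z = 0" using g(2)[of z] by simp
        then have "z \<in> insert 0 (Z k)" using z by (auto simp: Z_def)
        then show False using g(3) g0 by blast
      qed
      moreover have "(\<Prod>a\<in>Z k. e a z ^ m a) \<noteq> 0" using finZ Za by (auto simp: e_def)
      ultimately show ?thesis using Q(3)[OF z] by (simp add: w_def)
    qed
    ultimately show ?thesis by blast
  qed
  \<comment> \<open>The local quotients fit together because each of them is, at every point, the
    limit of G/P: the zeros of P are isolated.\<close>
  define w where "w = remove_sings (\<lambda>z. G z / P z)"
  have w_eq: "w z = v z" if v: "v holomorphic_on ball 0 (real k)" "\<And>z. z \<in> ball 0 (real k) \<Longrightarrow> G z = P z * v z"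
    and z: "z \<in> ball 0 (real k)" for z v k
  proof -
    obtain b where "P b \<noteq> 0" using P_nz by auto
    then have "eventually (\<lambda>x. P x \<noteq> 0 \<and> x \<in> UNIV) (at z)"
      by (intro non_zero_neighbour_alt[OF Ph, where \<beta> = b]) auto
    moreover have "eventually (\<lambda>x. x \<in> ball 0 (real k)) (at z)"
      using z by (intro eventually_at_in_open') auto
    ultimately have ev: "eventually (\<lambda>x. v x = G x / P x) (at z)"
      by eventually_elim (use v(2) in auto)
    have "isCont v z" using holomorphic_on_imp_continuous_on[OF v(1)] z by (simp add: continuous_on_eq_continuous_at)
    then have "((\<lambda>x. G x / P x) \<longlongrightarrow> v z) (at z)"
      using tendsto_cong[OF ev] by (simp add: isCont_def)
    then show ?thesis unfolding w_def by (rule remove_sings_eqI)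
  qed
  have w: "G z = P z * w z" "w z \<noteq> 0" "w field_differentiable at z" for z
  proof -
    obtain k :: nat where k: "norm z < real k" using reals_Archimedean2 by blast
    obtain v where v: "v holomorphic_on ball 0 (real k)" "\<And>z. z \<in> ball 0 (real k) \<Longrightarrow> G z = P z * v z"
        "\<And>z. z \<in> ball 0 (real k) \<Longrightarrow> v z \<noteq> 0" using local[of k] by blast
    have zk: "z \<in> ball 0 (real k)" using k by simp
    show "G z = P z * w z" "w z \<noteq> 0" using w_eq[OF v(1,2) zk] v(2,3)[OF zk] by auto
    have "w holomorphic_on ball 0 (real k)"
      using v(1) by (rule holomorphic_transform) (use w_eq[OF v(1,2)] in auto)
    then show "w field_differentiable at z" using zk by (auto intro: holomorphic_on_imp_differentiable_at)
  qed
  have wh: "w holomorphic_on UNIV" using w(3) by (auto simp: holomorphic_on_def intro: field_differentiable_at_within)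
  obtain q where q: "q holomorphic_on UNIV" "\<And>z. z \<in> UNIV \<Longrightarrow> w z = exp (q z)"
    using contractible_imp_holomorphic_log[OF wh] w(2) convex_imp_contractible[OF convex_UNIV] by metis
  show ?thesis
  proof (rule that[OF Ph P_nz q(1)])
    show "G z = P z * exp (q z)" for z using w(1)[of z] q(2)[of z] by simp
    show "0 \<le> C1 * C" using C1 C by simp
    show "norm (P z) \<le> norm z ^ m 0 * exp (C1 * C * norm z powr s)" for z
      using P0(3)[of z] by (simp add: P_def norm_mult norm_power mult_left_mono)
  qed
qed

section \<open>Generic radii\<close>

text \<open>Eventually along this filter means for all large r off a Lebesgue null set, which may
  depend on the property. Null sets contain the moduli of zeros, are closed under countable unions
  and have finite logarithmic measure.\<close>

definition generic_radii :: "real filter" where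
  "generic_radii = inf at_top (ae_filter lborel)"

lemma eventually_generic_radii:
  "eventually P generic_radii \<longleftrightarrow> (\<exists>x N. N \<in> null_sets lborel \<and> (\<forall>r\<ge>x. r \<notin> N \<longrightarrow> P r))"
proof
  assume "eventually P generic_radii"
  then obtain Q R where QR: "eventually Q at_top" "AE r in lborel. R r" "\<And>r. Q r \<Longrightarrow> R r \<Longrightarrow> P r"
    unfolding generic_radii_def eventually_inf by auto
  obtain x where x: "\<And>r. x \<le> r \<Longrightarrow> Q r" using QR(1) by (auto simp: eventually_at_top_linorder)
  obtain N where N: "N \<in> null_sets lborel" "{r \<in> space lborel. \<not> R r} \<subseteq> N"
    using QR(2) by (auto simp: eventually_ae_filter)
  then show "\<exists>x N. N \<in> null_sets lborel \<and> (\<forall>r\<ge>x. r \<notin> N \<longrightarrow> P r)"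
    using x QR(3) by (intro exI[of _ x] exI[of _ N]) auto
next
  assume "\<exists>x N. N \<in> null_sets lborel \<and> (\<forall>r\<ge>x. r \<notin> N \<longrightarrow> P r)"
  then obtain x N where xN: "N \<in> null_sets lborel" "\<And>r. x \<le> r \<Longrightarrow> r \<notin> N \<Longrightarrow> P r" by auto
  have "AE r in lborel. r \<notin> N" using xN(1) by (rule AE_not_in)
  then show "eventually P generic_radii"
    unfolding generic_radii_def eventually_inf
    using xN(2) eventually_ge_at_top[of x] by (intro exI[of _ "\<lambda>r. x \<le> r"] exI[of _ "\<lambda>r. r \<notin> N"]) auto
qed

lemma eventually_generic_radii_at_top: "eventually P at_top \<Longrightarrow> eventually P generic_radii"
  unfolding generic_radii_def by (rule filter_leD[OF inf_le1])

lemma eventually_generic_zero_free: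
  assumes "G holomorphic_on UNIV" "\<exists>z. G z \<noteq> 0"
  shows "eventually (zero_free_radius G) generic_radii"
  unfolding eventually_generic_radii
  by (intro exI[of _ 0] exI[of _ "{norm z | z. G z = 0}"] conjI
      countable_imp_null_set_lborel countable_zero_radii assms) (auto simp: zero_free_radius_def)

text \<open>An interval of length 1 is not a null set. Combined with monotonicity of N, this extends
  estimates from generic radii to all large radii.\<close>

lemma generic_radii_interval:
  assumes "eventually P generic_radii"
  shows "\<exists>x0. \<forall>x\<ge>x0. \<exists>r. x \<le> r \<and> r \<le> x + 1 \<and> P r"
proof -
  obtain x0 N where N: "N \<in> null_sets lborel" "\<And>r. x0 \<le> r \<Longrightarrow> r \<notin> N \<Longrightarrow> P r"
    using assms unfolding eventually_generic_radii by auto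
  have "\<exists>r. x \<le> r \<and> r \<le> x + 1 \<and> P r" if "x0 \<le> x" for x
  proof (rule ccontr)
    assume "\<not> ?thesis"
    then have "{x..x + 1} \<subseteq> N" using N(2) that by (meson atLeastAtMost_iff order_trans subsetI)
    then have "emeasure lborel {x..x + 1} \<le> emeasure lborel N" using N(1) by (intro emeasure_mono) auto
    then show False using N(1) by (auto simp: null_sets_def)
  qed
  then show ?thesis by blast
qed

lemma generic_radii_neq_bot: "generic_radii \<noteq> bot"
proof
  assume "generic_radii = bot"
  then have "eventually (\<lambda>_. False) generic_radii" by simp
  then show False using generic_radii_interval by blast
qed

section \<open>One-sided smallness relative to r^\<rho>\<close>

text \<open>The bound is one-sided, without absolute values, so that it expresses comparisons such
  as m(r, f) \<le> m(r, g) + o(r^\<rho>) as smallness of a difference. The null set may depend on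
  \<epsilon>.\<close>

definition upper_small :: "real \<Rightarrow> (real \<Rightarrow> real) \<Rightarrow> bool" where
  "upper_small \<rho> u \<longleftrightarrow> (\<forall>\<epsilon>>0. \<forall>\<^sub>F r in generic_radii. u r \<le> \<epsilon> * r powr \<rho>)"

lemma upper_small_mono:
  assumes "upper_small \<rho> v" "\<forall>\<^sub>F r in generic_radii. u r \<le> v r"
  shows "upper_small \<rho> u"
  unfolding upper_small_def
proof (intro allI impI)
  fix \<epsilon> :: real assume "0 < \<epsilon>"
  then have "\<forall>\<^sub>F r in generic_radii. v r \<le> \<epsilon> * r powr \<rho>" using assms(1) by (simp add: upper_small_def)
  with assms(2) show "\<forall>\<^sub>F r in generic_radii. u r \<le> \<epsilon> * r powr \<rho>" by eventually_elim auto
qed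

lemma upper_small_at_top:
  assumes "\<And>\<epsilon>. 0 < \<epsilon> \<Longrightarrow> \<forall>\<^sub>F r in at_top. u r \<le> \<epsilon> * r powr \<rho>"
  shows "upper_small \<rho> u"
  using assms eventually_generic_radii_at_top by (auto simp: upper_small_def)

lemma upper_small_add:
  assumes "upper_small \<rho> u" "upper_small \<rho> v"
  shows "upper_small \<rho> (\<lambda>r. u r + v r)"
  unfolding upper_small_def
proof (intro allI impI)
  fix \<epsilon> :: real assume "0 < \<epsilon>"
  then have "\<forall>\<^sub>F r in generic_radii. u r \<le> \<epsilon> / 2 * r powr \<rho>" "\<forall>\<^sub>F r in generic_radii. v r \<le> \<epsilon> / 2 * r powr \<rho>"
    using assms by (simp_all only: upper_small_def half_gt_zero)
  then show "\<forall>\<^sub>F r in generic_radii. u r + v r \<le> \<epsilon> * r powr \<rho>" by eventually_elim (simp add: field_simps)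
qed

lemma upper_small_const: "0 < \<rho> \<Longrightarrow> upper_small \<rho> (\<lambda>_. c)"
proof (rule upper_small_at_top)
  fix \<epsilon> :: real assume "0 < \<epsilon>" "0 < \<rho>"
  then show "\<forall>\<^sub>F r in at_top. c \<le> \<epsilon> * r powr \<rho>" by real_asymp
qed

text \<open>All product and sum estimates for m(r, .) are obtained by integrating a pointwise
  inequality for \<open>log_plus\<close> through this lemma; a list lets the same function occur
  more than once.\<close>

lemma proximity_le_sum_list:
  assumes "0 \<le> r" "continuous_on (sphere 0 r) F" "\<And>f. f \<in> set fs \<Longrightarrow> continuous_on (sphere 0 r) f"
    and "\<And>z. norm z = r \<Longrightarrow> log_plus (norm (F z)) \<le> (\<Sum>f\<leftarrow>fs. log_plus (norm (f z))) + c"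
  shows "proximity F r \<le> (\<Sum>f\<leftarrow>fs. proximity f r) + c"
proof -
  have cont: "continuous_on (sphere 0 r) (\<lambda>z. (\<Sum>f\<leftarrow>fs. log_plus (norm (f z))) + c)"
      if "\<And>f. f \<in> set fs \<Longrightarrow> continuous_on (sphere 0 r) f" for fs :: "(complex \<Rightarrow> complex) list" and c
    using that by (induction fs) (auto intro!: continuous_intros simp: add.assoc)
  have mean: "circle_mean (\<lambda>z. (\<Sum>f\<leftarrow>fs. log_plus (norm (f z))) + c) r = (\<Sum>f\<leftarrow>fs. proximity f r) + c"
    if "\<And>f. f \<in> set fs \<Longrightarrow> continuous_on (sphere 0 r) f" for fs :: "(complex \<Rightarrow> complex) list" and c
    using that
  proof (induction fs)
    case (Cons f fs)
    have "circle_mean (\<lambda>z. log_plus (norm (f z)) + ((\<Sum>f\<leftarrow>fs. log_plus (norm (f z))) + c)) r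
        = circle_mean (\<lambda>z. log_plus (norm (f z))) r + circle_mean (\<lambda>z. (\<Sum>f\<leftarrow>fs. log_plus (norm (f z))) + c) r"
      by (intro circle_mean_add assms cont continuous_intros Cons.prems) auto
    then show ?case using Cons by (simp add: proximity_eq_circle_mean add.assoc)
  qed simp
  have "proximity F r \<le> circle_mean (\<lambda>z. (\<Sum>f\<leftarrow>fs. log_plus (norm (f z))) + c) r"
    unfolding proximity_eq_circle_mean by (intro circle_mean_mono cont assms continuous_intros) auto
  then show ?thesis using mean[of fs c] assms(3) by simp
qed

lemma proximity_le_bound:
  assumes "0 \<le> r" "continuous_on (sphere 0 r) F" "\<And>z. norm z = r \<Longrightarrow> norm (F z) \<le> exp M" "0 \<le> M"
  shows "proximity F r \<le> M"
proof -
  have "log_plus (norm (F z)) \<le> M" if "norm z = r" for z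
    using log_plus_mono[OF assms(3)[OF that]] assms(4) by simp
  then show ?thesis using proximity_le_sum_list[of r F "[]" M] assms by simp
qed

section \<open>Entire functions of small growth\<close>

definition slow :: "real \<Rightarrow> (complex \<Rightarrow> complex) \<Rightarrow> bool" where
  "slow \<rho> g \<longleftrightarrow> g holomorphic_on UNIV \<and> (\<forall>\<epsilon>>0. \<forall>\<^sub>F z in at_infinity. norm (g z) \<le> exp (\<epsilon> * norm z powr \<rho>))"

text \<open>The class to which functions involving w belong: large compared with the coefficients,
  but still within reach of the logarithmic derivative estimate.\<close>

definition finite_type :: "real \<Rightarrow> (complex \<Rightarrow> complex) \<Rightarrow> bool" where
  "finite_type \<rho> g \<longleftrightarrow> g holomorphic_on UNIV \<and> (\<exists>K\<ge>0. \<forall>\<^sub>F z in at_infinity. norm (g z) \<le> exp (K * norm z powr \<rho>))"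

lemma eventually_at_infinity_norm:
  "eventually P at_top \<Longrightarrow> eventually (\<lambda>z::complex. P (norm z)) at_infinity"
  by (rule eventually_compose_filterlim[OF _ filterlim_norm_at_top])

lemma slow_holomorphic: "slow \<rho> g \<Longrightarrow> g holomorphic_on UNIV"
  by (simp add: slow_def)

lemma finite_type_holomorphic: "finite_type \<rho> g \<Longrightarrow> g holomorphic_on UNIV"
  by (simp add: finite_type_def)

lemma slowD: "slow \<rho> g \<Longrightarrow> 0 < \<epsilon> \<Longrightarrow> \<forall>\<^sub>F z in at_infinity. norm (g z) \<le> exp (\<epsilon> * norm z powr \<rho>)"
  by (simp add: slow_def)

lemma slow_imp_finite_type: "slow \<rho> g \<Longrightarrow> finite_type \<rho> g"
  using slowD[of \<rho> g 1] slow_holomorphic[of \<rho> g] unfolding finite_type_def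
  by (intro conjI exI[of _ 1]) simp_all

lemma slow_const:
  assumes "0 < \<rho>" shows "slow \<rho> (\<lambda>_. c)"
  unfolding slow_def
proof (intro conjI allI impI)
  fix \<epsilon> :: real assume "0 < \<epsilon>"
  then have "\<forall>\<^sub>F r in at_top. norm c \<le> exp (\<epsilon> * r powr \<rho>)" using assms by real_asymp
  then show "\<forall>\<^sub>F z in at_infinity. norm c \<le> exp (\<epsilon> * norm (z::complex) powr \<rho>)" by (rule eventually_at_infinity_norm)
qed auto

lemma slow_ident:
  assumes "0 < \<rho>" shows "slow \<rho> (\<lambda>z. z)"
  unfolding slow_def
proof (intro conjI allI impI)
  fix \<epsilon> :: real assume "0 < \<epsilon>"
  then have "\<forall>\<^sub>F r in at_top. r \<le> exp (\<epsilon> * r powr \<rho>)" using assms by real_asymp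
  then show "\<forall>\<^sub>F z in at_infinity. norm z \<le> exp (\<epsilon> * norm (z::complex) powr \<rho>)" by (rule eventually_at_infinity_norm)
qed auto

lemma slow_mult:
  assumes "slow \<rho> f" "slow \<rho> g" shows "slow \<rho> (\<lambda>z. f z * g z)"
  unfolding slow_def
proof (intro conjI allI impI)
  fix \<epsilon> :: real assume e: "0 < \<epsilon>"
  have "\<forall>\<^sub>F z in at_infinity. norm (f z) \<le> exp (\<epsilon> / 2 * norm z powr \<rho>)" "\<forall>\<^sub>F z in at_infinity. norm (g z) \<le> exp (\<epsilon> / 2 * norm z powr \<rho>)"
    by (rule slowD[OF assms(1) half_gt_zero[OF e]], rule slowD[OF assms(2) half_gt_zero[OF e]])
  then show "\<forall>\<^sub>F z in at_infinity. norm (f z * g z) \<le> exp (\<epsilon> * norm z powr \<rho>)"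
  proof eventually_elim
    case (elim z)
    have "norm (f z * g z) \<le> exp (\<epsilon> / 2 * norm z powr \<rho>) * exp (\<epsilon> / 2 * norm z powr \<rho>)"
      unfolding norm_mult using elim by (intro mult_mono) auto
    also have "\<dots> = exp (\<epsilon> * norm z powr \<rho>)" by (simp add: exp_add[symmetric] field_simps)
    finally show ?case .
  qed
qed (use assms in \<open>auto simp: slow_def intro!: holomorphic_intros\<close>)

lemma slow_add:
  assumes "slow \<rho> f" "slow \<rho> g" "0 < \<rho>" shows "slow \<rho> (\<lambda>z. f z + g z)"
  unfolding slow_def
proof (intro conjI allI impI)
  fix \<epsilon> :: real assume e: "0 < \<epsilon>"
  have "\<forall>\<^sub>F z in at_infinity. norm (f z) \<le> exp (\<epsilon> / 2 * norm z powr \<rho>)" "\<forall>\<^sub>F z in at_infinity. norm (g z) \<le> exp (\<epsilon> / 2 * norm z powr \<rho>)"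
    "\<forall>\<^sub>F z in at_infinity. norm (2::complex) \<le> exp (\<epsilon> / 2 * norm (z::complex) powr \<rho>)"
    by (rule slowD[OF assms(1) half_gt_zero[OF e]], rule slowD[OF assms(2) half_gt_zero[OF e]],
        rule slowD[OF slow_const[OF assms(3)] half_gt_zero[OF e]])
  then show "\<forall>\<^sub>F z in at_infinity. norm (f z + g z) \<le> exp (\<epsilon> * norm z powr \<rho>)"
  proof eventually_elim
    case (elim z)
    have "norm (f z + g z) \<le> 2 * exp (\<epsilon> / 2 * norm z powr \<rho>)"
      using elim norm_triangle_ineq[of "f z" "g z"] by linarith
    also have "\<dots> \<le> exp (\<epsilon> / 2 * norm z powr \<rho>) * exp (\<epsilon> / 2 * norm z powr \<rho>)"
      using elim by (intro mult_right_mono) auto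
    also have "\<dots> = exp (\<epsilon> * norm z powr \<rho>)" by (simp add: exp_add[symmetric] field_simps)
    finally show ?case .
  qed
qed (use assms in \<open>auto simp: slow_def intro!: holomorphic_intros\<close>)

lemma slow_cmult: "slow \<rho> f \<Longrightarrow> 0 < \<rho> \<Longrightarrow> slow \<rho> (\<lambda>z. c * f z)"
  by (intro slow_mult slow_const)

lemma slow_diff: "slow \<rho> f \<Longrightarrow> slow \<rho> g \<Longrightarrow> 0 < \<rho> \<Longrightarrow> slow \<rho> (\<lambda>z. f z - g z)"
  using slow_add[of \<rho> f "\<lambda>z. -1 * g z"] slow_cmult[of \<rho> g "-1"] by simp

lemma slow_power: "slow \<rho> f \<Longrightarrow> 0 < \<rho> \<Longrightarrow> slow \<rho> (\<lambda>z. f z ^ n)"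
  by (induction n) (auto intro: slow_const slow_mult)

lemma slow_sum: "(\<And>i. i \<in> I \<Longrightarrow> slow \<rho> (f i)) \<Longrightarrow> 0 < \<rho> \<Longrightarrow> slow \<rho> (\<lambda>z. \<Sum>i\<in>I. f i z)"
  by (induction I rule: infinite_finite_induct) (auto intro: slow_const slow_add)

lemma slow_poly: "0 < \<rho> \<Longrightarrow> slow \<rho> (poly p)"
proof (induction p)
  case (pCons a p)
  have "poly (pCons a p) = (\<lambda>z. a + z * poly p z)" by (simp add: fun_eq_iff)
  then show ?case by (simp only:) (intro slow_add slow_mult slow_const slow_ident pCons)
next
  case 0
  have "poly 0 = (\<lambda>_. 0::complex)" by (simp add: fun_eq_iff)
  then show ?case using slow_const[OF 0] by simp
qed

text \<open>The common basis for shifts and, through Cauchy's inequality on a unit disc, for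
  derivatives.\<close>

lemma norm_le_exp_neighbour:
  assumes "slow \<rho> f" "0 < \<rho>" "0 < \<epsilon>"
  shows "\<forall>\<^sub>F z in at_infinity. \<forall>w. norm (w - z) \<le> c \<longrightarrow> norm (f w) \<le> exp (\<epsilon> * norm z powr \<rho>)"
proof -
  \<comment> \<open>Points within distance c of a large z have modulus at most 2 |z|; dividing by
    2^\<rho> compensates for this.\<close>
  define \<delta> where "\<delta> = \<epsilon> / 2 powr \<rho>"
  have "0 < \<delta>" using assms by (simp add: \<delta>_def)
  then obtain R where R: "\<And>w. R \<le> norm w \<Longrightarrow> norm (f w) \<le> exp (\<delta> * norm w powr \<rho>)"
    using slowD[OF assms(1)] unfolding eventually_at_infinity by blast
  show ?thesis unfolding eventually_at_infinity
  proof (intro exI[of _ "\<bar>R\<bar> + \<bar>c\<bar>"] allI impI)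
    fix z w :: complex assume z: "\<bar>R\<bar> + \<bar>c\<bar> \<le> norm z" and w: "norm (w - z) \<le> c"
    have "norm z \<le> norm w + c" using norm_triangle_sub[of z w] w by (simp add: norm_minus_commute)
    then have "R \<le> norm w" using z by linarith
    then have "norm (f w) \<le> exp (\<delta> * norm w powr \<rho>)" by (rule R)
    also have "norm w \<le> 2 * norm z" using norm_triangle_sub[of w z] w z by linarith
    then have "norm w powr \<rho> \<le> (2 * norm z) powr \<rho>" using assms by (intro powr_mono2) auto
    then have "\<delta> * norm w powr \<rho> \<le> \<delta> * (2 powr \<rho> * norm z powr \<rho>)"
      using \<open>0 < \<delta>\<close> by (intro mult_left_mono) (auto simp: powr_mult)
    also have "\<dots> = \<epsilon> * norm z powr \<rho>" by (simp add: \<delta>_def)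
    finally show "norm (f w) \<le> exp (\<epsilon> * norm z powr \<rho>)" by simp
  qed
qed

lemma slow_shift:
  assumes "slow \<rho> f" "0 < \<rho>" shows "slow \<rho> (\<lambda>z. f (z + c))"
  unfolding slow_def
proof (intro conjI allI impI)
  have "(f \<circ> (\<lambda>z. z + c)) holomorphic_on UNIV"
    using slow_holomorphic[OF assms(1)]
    by (intro holomorphic_on_compose holomorphic_intros) (auto intro: holomorphic_on_subset)
  then show "(\<lambda>z. f (z + c)) holomorphic_on UNIV" by (simp add: o_def)
  fix \<epsilon> :: real assume "0 < \<epsilon>"
  from norm_le_exp_neighbour[OF assms this, of "norm c"]
  show "\<forall>\<^sub>F z in at_infinity. norm (f (z + c)) \<le> exp (\<epsilon> * norm z powr \<rho>)"
    by eventually_elim (simp add: algebra_simps)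
qed

lemma slow_deriv:
  assumes "slow \<rho> f" "0 < \<rho>" shows "slow \<rho> (deriv f)"
  unfolding slow_def
proof (intro conjI allI impI)
  show "deriv f holomorphic_on UNIV" using slow_holomorphic[OF assms(1)] by (intro holomorphic_deriv) auto
  fix \<epsilon> :: real assume "0 < \<epsilon>"
  from norm_le_exp_neighbour[OF assms this, of 1]
  show "\<forall>\<^sub>F z in at_infinity. norm (deriv f z) \<le> exp (\<epsilon> * norm z powr \<rho>)"
  proof eventually_elim
    case (elim z)
    have "norm ((deriv ^^ 1) f z) \<le> fact 1 * exp (\<epsilon> * norm z powr \<rho>) / 1 ^ 1"
    proof (rule Cauchy_inequality)
      show "f holomorphic_on ball z 1" using slow_holomorphic[OF assms(1)] by (rule holomorphic_on_subset) auto
      then show "continuous_on (cball z 1) f" using slow_holomorphic[OF assms(1)]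
        by (auto intro!: holomorphic_on_imp_continuous_on intro: holomorphic_on_subset)
      fix x assume "norm (z - x) = 1"
      then show "norm (f x) \<le> exp (\<epsilon> * norm z powr \<rho>)" using elim by (simp add: norm_minus_commute)
    qed auto
    then show ?case by simp
  qed
qed

lemma finite_type_mult:
  assumes "finite_type \<rho> f" "finite_type \<rho> g" shows "finite_type \<rho> (\<lambda>z. f z * g z)"
proof -
  obtain K L where K: "0 \<le> K" "\<forall>\<^sub>F z in at_infinity. norm (f z) \<le> exp (K * norm z powr \<rho>)"
      and L: "0 \<le> L" "\<forall>\<^sub>F z in at_infinity. norm (g z) \<le> exp (L * norm z powr \<rho>)"
    using assms unfolding finite_type_def by blast
  have "\<forall>\<^sub>F z in at_infinity. norm (f z * g z) \<le> exp ((K + L) * norm z powr \<rho>)"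
    using K(2) L(2)
  proof eventually_elim
    case (elim z)
    have "norm (f z * g z) \<le> exp (K * norm z powr \<rho>) * exp (L * norm z powr \<rho>)"
      unfolding norm_mult using elim by (intro mult_mono) auto
    then show ?case by (simp add: exp_add[symmetric] algebra_simps)
  qed
  then show ?thesis using K(1) L(1) assms unfolding finite_type_def
    by (auto intro!: holomorphic_intros exI[of _ "K + L"])
qed

lemma finite_type_add:
  assumes "finite_type \<rho> f" "finite_type \<rho> g" "0 < \<rho>" shows "finite_type \<rho> (\<lambda>z. f z + g z)"
proof -
  obtain K L where K: "0 \<le> K" "\<forall>\<^sub>F z in at_infinity. norm (f z) \<le> exp (K * norm z powr \<rho>)"
      and L: "0 \<le> L" "\<forall>\<^sub>F z in at_infinity. norm (g z) \<le> exp (L * norm z powr \<rho>)"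
    using assms unfolding finite_type_def by blast
  have "\<forall>\<^sub>F z in at_infinity. norm (2::complex) \<le> exp (1 * norm (z::complex) powr \<rho>)"
    by (intro slowD slow_const assms) auto
  with K(2) L(2) have "\<forall>\<^sub>F z in at_infinity. norm (f z + g z) \<le> exp ((K + L + 1) * norm z powr \<rho>)"
  proof eventually_elim
    case (elim z)
    have "exp (K * norm z powr \<rho>) \<le> exp ((K + L) * norm z powr \<rho>)" "exp (L * norm z powr \<rho>) \<le> exp ((K + L) * norm z powr \<rho>)"
      using K(1) L(1) by (auto intro!: mult_right_mono)
    then have "norm (f z + g z) \<le> 2 * exp ((K + L) * norm z powr \<rho>)"
      using elim norm_triangle_ineq[of "f z" "g z"] by linarith
    also have "\<dots> \<le> exp (1 * norm z powr \<rho>) * exp ((K + L) * norm z powr \<rho>)"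
      using elim by (intro mult_right_mono) auto
    also have "\<dots> = exp ((K + L + 1) * norm z powr \<rho>)" by (simp add: exp_add[symmetric] algebra_simps)
    finally show ?case .
  qed
  then show ?thesis using K(1) L(1) assms unfolding finite_type_def
    by (auto intro!: holomorphic_intros exI[of _ "K + L + 1"])
qed

lemma proximity_slow:
  assumes "slow \<rho> g" "0 < \<epsilon>"
  shows "\<forall>\<^sub>F r in at_top. proximity g r \<le> \<epsilon> * r powr \<rho>"
proof -
  obtain R where R: "\<And>z. R \<le> norm z \<Longrightarrow> norm (g z) \<le> exp (\<epsilon> * norm z powr \<rho>)"
    using slowD[OF assms] unfolding eventually_at_infinity by blast
  have "proximity g r \<le> \<epsilon> * r powr \<rho>" if "max 0 R \<le> r" for r
    by (rule proximity_le_bound) (use that R assms in \<open>auto intro!: continuous_on_sphere_holomorphic slow_holomorphic\<close>)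
  then show ?thesis unfolding eventually_at_top_linorder by blast
qed

lemma proximity_finite_type:
  assumes "finite_type \<rho> g"
  obtains K where "0 \<le> K" "\<forall>\<^sub>F r in at_top. proximity g r \<le> K * r powr \<rho>"
proof -
  obtain K R where K: "0 \<le> K" and R: "\<And>z. R \<le> norm z \<Longrightarrow> norm (g z) \<le> exp (K * norm z powr \<rho>)"
    using assms unfolding finite_type_def eventually_at_infinity by blast
  have "proximity g r \<le> K * r powr \<rho>" if "max 0 R \<le> r" for r
    by (rule proximity_le_bound) (use that R K in \<open>auto intro!: continuous_on_sphere_holomorphic finite_type_holomorphic[OF assms]\<close>)
  then have "\<forall>\<^sub>F r in at_top. proximity g r \<le> K * r powr \<rho>" unfolding eventually_at_top_linorder by blast
  then show ?thesis using K that by blast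
qed

lemma upper_small_proximity: "slow \<rho> g \<Longrightarrow> upper_small \<rho> (proximity g)"
  by (rule upper_small_at_top) (rule proximity_slow)

text \<open>Jensen's formula together with N \<ge> 0 gives m(r, 1/g) \<le> m(r, g) + O(1).\<close>

lemma upper_small_proximity_inverse:
  assumes "slow \<rho> g" "\<exists>z. g z \<noteq> 0" "0 < \<rho>"
  shows "upper_small \<rho> (proximity (\<lambda>z. 1 / g z))"
proof -
  have g: "g holomorphic_on UNIV" using assms(1) by (rule slow_holomorphic)
  obtain c where c: "\<And>R. 0 < R \<Longrightarrow> zero_free_radius g R \<Longrightarrow>
    counting_int (\<lambda>z. 1 / g z) R = circle_mean (\<lambda>z. ln (norm (g z))) R - c"
    by (rule jensen_formula[OF g assms(2)]) (rule that)
  show ?thesis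
  proof (rule upper_small_mono[OF upper_small_add[OF upper_small_proximity[OF assms(1)] upper_small_const[OF assms(3), of "-c"]]])
    show "\<forall>\<^sub>F r in generic_radii. proximity (\<lambda>z. 1 / g z) r \<le> proximity g r + - c"
      using eventually_generic_zero_free[OF g assms(2)] eventually_generic_radii_at_top[OF eventually_ge_at_top[of 1]]
    proof eventually_elim
      case (elim r)
      then show ?case
        using c[of r] counting_int_nonneg[OF g assms(2), of r] circle_mean_ln_norm(1)[OF g, of r] by simp
    qed
  qed
qed

lemma upper_small_log_derivative:
  assumes "finite_type \<rho> g" "\<exists>z. g z \<noteq> 0" "0 < \<rho>"
  shows "upper_small \<rho> (proximity (\<lambda>z. deriv g z / g z))"
proof -
  have g: "g holomorphic_on UNIV" using assms(1) by (rule finite_type_holomorphic)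
  obtain K R where K: "0 \<le> K" and R: "\<And>z. R \<le> norm z \<Longrightarrow> norm (g z) \<le> exp (K * norm z powr \<rho>)"
    using assms(1) unfolding finite_type_def eventually_at_infinity by blast
  obtain A where A: "0 < A" "\<And>r. max 1 R \<le> r \<Longrightarrow> zero_free_radius g r \<Longrightarrow>
    proximity (\<lambda>z. deriv g z / g z) r \<le> A + 3 * ln (A + A * r powr \<rho>)"
    by (rule log_derivative_bound[OF g assms(2) K assms(3) R]) (assumption | rule that)+
  show ?thesis
  proof (rule upper_small_mono[OF upper_small_at_top])
    fix \<epsilon> :: real assume "0 < \<epsilon>"
    then show "\<forall>\<^sub>F r in at_top. A + 3 * ln (A + A * r powr \<rho>) \<le> \<epsilon> * r powr \<rho>"
      using A(1) assms(3) by real_asymp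
  next
    show "\<forall>\<^sub>F r in generic_radii. proximity (\<lambda>z. deriv g z / g z) r \<le> A + 3 * ln (A + A * r powr \<rho>)"
      using eventually_generic_zero_free[OF g assms(2)] eventually_generic_radii_at_top[OF eventually_ge_at_top[of "max 1 R"]]
      by eventually_elim (rule A(2))
  qed
qed

section \<open>Functions with a Borel exceptional value\<close>

lemma characteristic_entire:
  assumes "f holomorphic_on UNIV" shows "characteristic f r = proximity f r"
proof -
  have "\<not> is_pole f z" for z by (rule not_is_pole_holomorphic[OF open_UNIV UNIV_I assms])
  then have "counting f = (\<lambda>_. 0)" by (auto simp: counting_def)
  then show ?thesis by (simp add: characteristic_def counting_int_def)
qed

lemma le_exp_log_plus: "x \<le> exp (log_plus x)"
  by (simp add: log_plus_def)

lemma Limsup_log_plus_le: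
  assumes "\<forall>\<^sub>F r in at_top. u r \<le> r powr t" "0 \<le> t"
  shows "Limsup at_top (\<lambda>r. ereal (log_plus (u r) / ln r)) \<le> ereal t"
proof (rule Limsup_bounded)
  show "\<forall>\<^sub>F r in at_top. ereal (log_plus (u r) / ln r) \<le> ereal t"
    using assms(1) eventually_gt_at_top[of 1]
  proof eventually_elim
    case (elim r)
    have "log_plus (u r) \<le> log_plus (exp (t * ln r))"
      using elim by (intro log_plus_mono) (simp add: powr_def)
    also have "\<dots> = t * ln r" using elim assms(2) by simp
    finally show ?case using elim by (simp add: divide_le_eq)
  qed
qed

lemma Limsup_log_plus_lessD:
  assumes "Limsup at_top (\<lambda>r. ereal (log_plus (u r) / ln r)) < ereal t"
  shows "\<forall>\<^sub>F r in at_top. u r \<le> r powr t"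
  using Limsup_lessD[OF assms] eventually_gt_at_top[of 1]
proof eventually_elim
  case (elim r)
  then have "log_plus (u r) \<le> t * ln r" by (simp add: divide_less_eq)
  then have "exp (log_plus (u r)) \<le> exp (t * ln r)" by simp
  from order_trans[OF le_exp_log_plus this] show ?case using elim by (simp add: powr_def)
qed

lemma Limsup_log_plus_nonneg: "0 \<le> Limsup at_top (\<lambda>r. ereal (log_plus (u r) / ln r))"
proof (rule le_Limsup)
  show "\<forall>\<^sub>F r in at_top. 0 \<le> ereal (log_plus (u r) / ln r)"
    using eventually_gt_at_top[of "1::real"] by eventually_elim simp
qed simp

lemma powr_dominated:
  assumes "s < (\<rho>::real)" "0 < \<epsilon>"
  shows "\<forall>\<^sub>F r in at_top. C * r powr s \<le> \<epsilon> * r powr \<rho>"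
proof -
  define \<delta> where "\<delta> = \<rho> - s"
  have "0 < \<delta>" using assms by (simp add: \<delta>_def)
  then have "\<forall>\<^sub>F r in at_top. C \<le> \<epsilon> * r powr \<delta>" using assms(2) by real_asymp
  then show ?thesis using eventually_gt_at_top[of 0]
  proof eventually_elim
    case (elim r)
    have "C * r powr s \<le> \<epsilon> * r powr \<delta> * r powr s" using elim by (intro mult_right_mono) auto
    also have "\<dots> = \<epsilon> * r powr \<rho>" by (simp add: \<delta>_def powr_add[symmetric])
    finally show ?case .
  qed
qed

text \<open>An upper limit only has to be approached along some radii, and generic radii are
  unbounded.\<close>

lemma Limsup_log_plus_ge:
  assumes "\<forall>\<^sub>F r in generic_radii. c * r powr \<rho> \<le> u r" "0 < c"
  shows "ereal \<rho> \<le> Limsup at_top (\<lambda>r. ereal (log_plus (u r) / ln r))"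
proof (rule ccontr)
  assume "\<not> ?thesis"
  then have "Limsup at_top (\<lambda>r. ereal (log_plus (u r) / ln r)) < ereal \<rho>" by (simp only: not_le)
  from ereal_dense2[OF this] obtain t where t: "Limsup at_top (\<lambda>r. ereal (log_plus (u r) / ln r)) < ereal t" "ereal t < ereal \<rho>"
    by blast
  have "0 < c / 2" using assms by simp
  have "\<forall>\<^sub>F r in at_top. 1 * r powr t \<le> c / 2 * r powr \<rho>"
    by (rule powr_dominated) (use t assms in auto)
  with Limsup_log_plus_lessD[OF t(1)] eventually_gt_at_top[of "0::real"]
  have "\<forall>\<^sub>F r in at_top. u r \<le> c / 2 * r powr \<rho> \<and> 0 < r"
    by eventually_elim auto
  from eventually_generic_radii_at_top[OF this] assms(1)
  have "\<forall>\<^sub>F r in generic_radii. False"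
  proof eventually_elim
    case (elim r)
    then have "c * r powr \<rho> \<le> c / 2 * r powr \<rho>" by linarith
    then show ?case using elim assms(2) by simp
  qed
  then show False using generic_radii_neq_bot by simp
qed

lemma slow_of_bound:
  assumes "P holomorphic_on UNIV" "\<forall>\<^sub>F z in at_infinity. norm (P z) \<le> norm z ^ n * exp (C * norm z powr s)" "s < \<rho>" "0 < \<rho>"
  shows "slow \<rho> P"
  unfolding slow_def
proof (intro conjI allI impI assms(1))
  fix \<epsilon> :: real assume e: "0 < \<epsilon>"
  have "\<forall>\<^sub>F z in at_infinity. norm (z ^ n :: complex) \<le> exp (\<epsilon> / 2 * norm z powr \<rho>)"
    by (rule slowD[OF slow_power[OF slow_ident[OF assms(4)] assms(4)]]) (use e in simp)
  moreover have "\<forall>\<^sub>F z in at_infinity. C * norm (z::complex) powr s \<le> \<epsilon> / 2 * norm z powr \<rho>"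
    by (rule eventually_at_infinity_norm, rule powr_dominated) (use e assms in auto)
  ultimately show "\<forall>\<^sub>F z in at_infinity. norm (P z) \<le> exp (\<epsilon> * norm z powr \<rho>)"
    using assms(2)
  proof eventually_elim
    case (elim z)
    have "norm (P z) \<le> norm z ^ n * exp (C * norm z powr s)" by (rule elim(3))
    also have "\<dots> \<le> exp (\<epsilon> / 2 * norm z powr \<rho>) * exp (\<epsilon> / 2 * norm z powr \<rho>)"
      using elim by (intro mult_mono) (auto simp: norm_power)
    also have "\<dots> = exp (\<epsilon> * norm z powr \<rho>)" by (simp add: exp_add[symmetric] field_simps)
    finally show ?case .
  qed
qed

text \<open>|Re q| = 2 max(0, Re q) - Re q, where max(0, Re q) is \<open>log_plus\<close> of |exp q|
  and the mean of Re q is Re q(0). So growth of exp q controls the Taylor coefficients of q.\<close>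

lemma entire_coeff_bound:
  assumes q: "q holomorphic_on UNIV" and r: "0 < r" "0 < n"
  shows "norm ((deriv ^^ n) q 0 / fact n) * r ^ n \<le> 4 * proximity (\<lambda>z. exp (q z)) r + 2 * \<bar>Re (q 0)\<bar>"
proof -
  have h: "q holomorphic_on ball 0 (r + 1)" using q by (rule holomorphic_on_subset) auto
  note cont = continuous_on_sphere_holomorphic[OF q]
  have "circle_mean (\<lambda>z. \<bar>Re (q z)\<bar>) r = circle_mean (\<lambda>z. 2 * log_plus (norm (exp (q z))) - Re (q z)) r"
    using r by (intro circle_mean_cong) (auto simp: max_def)
  also have "\<dots> = 2 * proximity (\<lambda>z. exp (q z)) r - Re (q 0)"
    unfolding proximity_eq_circle_mean using r circle_mean_Re[OF h, of r]
    by (subst circle_mean_diff) (auto simp: circle_mean_cmult intro!: continuous_intros cont)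
  finally show ?thesis using taylor_coeff_bound[OF h r(1) _ r(2)] by simp
qed

lemma entire_eq_poly:
  assumes q: "q holomorphic_on UNIV" and N: "\<And>n. N < n \<Longrightarrow> (deriv ^^ n) q 0 = 0"
  obtains p where "degree p \<le> N" "q = poly p"
proof -
  define a where "a n = (deriv ^^ n) q 0 / fact n" for n
  define p where "p = (\<Sum>n\<le>N. monom (a n) n)"
  have a0: "a n = 0" if "N < n" for n using N[OF that] by (simp add: a_def)
  have cf: "coeff p n = a n" for n
    using a0 by (auto simp: p_def coeff_sum coeff_monom if_distrib cong: if_cong)
  have "q z = poly p z" for z
  proof -
    have "(\<lambda>n. a n * (z - 0) ^ n) sums q z"
      unfolding a_def by (rule holomorphic_power_series[of q 0 "norm z + 1"]) (use q in \<open>auto intro: holomorphic_on_subset\<close>)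
    moreover have "(\<lambda>n. a n * (z - 0) ^ n) sums (\<Sum>n\<le>N. a n * (z - 0) ^ n)"
      by (rule sums_finite) (use a0 in auto)
    ultimately show ?thesis by (simp add: sums_unique2 p_def poly_sum poly_monom)
  qed
  moreover have "degree p \<le> N" by (rule degree_le) (use cf a0 in auto)
  ultimately show ?thesis using that by (auto simp: fun_eq_iff)
qed

section \<open>Exponentials of polynomials and their shifts and derivatives\<close>

lemma norm_poly_le:
  fixes p :: "complex poly"
  obtains K where "0 \<le> K" "\<And>z. 1 \<le> norm z \<Longrightarrow> norm (poly p z) \<le> K * norm z powr real (degree p)"
proof -
  define K where "K = (\<Sum>i\<le>degree p. norm (coeff p i))"
  have "norm (poly p z) \<le> K * norm z powr real (degree p)" if z: "1 \<le> norm z" for z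
  proof -
    have "norm (poly p z) \<le> (\<Sum>i\<le>degree p. norm (coeff p i) * norm z ^ degree p)"
      unfolding poly_altdef using z
      by (intro sum_norm_le) (auto simp: norm_mult norm_power intro!: mult_left_mono power_increasing)
    also have "\<dots> = K * norm z ^ degree p" by (simp add: K_def sum_distrib_right)
    also have "norm z ^ degree p = norm z powr real (degree p)" using z by (subst powr_realpow) auto
    finally show ?thesis .
  qed
  then show ?thesis using that[of K] by (auto simp: K_def sum_nonneg)
qed

lemma norm_exp_poly_le:
  fixes p :: "complex poly"
  obtains K where "0 \<le> K" "\<forall>\<^sub>F z in at_infinity. norm (exp (poly p z)) \<le> exp (K * norm z powr real (degree p))"
proof -
  obtain K where K: "0 \<le> K" "\<And>z. 1 \<le> norm z \<Longrightarrow> norm (poly p z) \<le> K * norm z powr real (degree p)"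
    by (rule norm_poly_le[of p]) (rule that)
  have "norm (exp (poly p z)) \<le> exp (K * norm z powr real (degree p))" if "1 \<le> norm z" for z
    using K(2)[OF that] complex_Re_le_cmod[of "poly p z"] by simp
  then have "\<forall>\<^sub>F z in at_infinity. norm (exp (poly p z)) \<le> exp (K * norm z powr real (degree p))"
    unfolding eventually_at_infinity by blast
  then show ?thesis using K(1) that by blast
qed

lemma holomorphic_exp_poly: "(\<lambda>z. exp (poly p z)) holomorphic_on A" for p :: "complex poly"
  by (intro holomorphic_intros)

lemma finite_type_exp_poly: "finite_type (real (degree p)) (\<lambda>z. exp (poly p z))"
  unfolding finite_type_def using norm_exp_poly_le[of p] holomorphic_exp_poly[of p UNIV] by metis

lemma slow_exp_poly:
  fixes p :: "complex poly"
  assumes "real (degree p) < \<rho>" shows "slow \<rho> (\<lambda>z. exp (poly p z))"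
proof -
  obtain K where K: "0 \<le> K" "\<forall>\<^sub>F z in at_infinity. norm (exp (poly p z)) \<le> exp (K * norm z powr real (degree p))"
    by (rule norm_exp_poly_le[of p]) (rule that)
  show ?thesis
    by (rule slow_of_bound[OF holomorphic_exp_poly, where n = 0 and C = K and s = "real (degree p)"]) (use K assms in auto)
qed

text \<open>p(z + c) and p(z) have the same leading term, so their difference has smaller
  degree.\<close>

lemma slow_exp_poly_shift:
  fixes p :: "complex poly"
  assumes "0 < degree p" shows "slow (real (degree p)) (\<lambda>z. exp (poly p (z + c) - poly p z))"
proof -
  define D where "D = pcompose p [:c, 1:] - p"
  have deg: "degree (pcompose p [:c, 1:]) = degree p" by (simp add: degree_pcompose)
  have "lead_coeff (pcompose p [:c, 1:]) = lead_coeff p" by (subst lead_coeff_comp) auto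
  then have c0: "coeff D (degree p) = 0" using deg by (simp add: D_def)
  have "degree D \<le> degree p" unfolding D_def by (rule degree_diff_le) (use deg in auto)
  \<comment> \<open>Equal degrees would make the leading coefficient of \<open>D\<close> zero, hence
    \<open>D\<close> = 0 and its degree 0, against \<open>0 < degree p\<close>.\<close>
  moreover have "degree D \<noteq> degree p"
    using c0 assms by (metis degree_0 leading_coeff_0_iff less_irrefl)
  ultimately have "slow (real (degree p)) (\<lambda>z. exp (poly D z))" by (intro slow_exp_poly) simp
  then show ?thesis by (simp add: D_def poly_pcompose add.commute)
qed

text \<open>One derivative replaces Q by Q' + p' Q, which stays slow, and removes the
  constant.\<close>

lemma higher_deriv_poly_exp:
  assumes P: "slow \<rho> P" "0 < \<rho>"
  shows "\<exists>Q. slow \<rho> Q \<and> (\<forall>z. (deriv ^^ k) (\<lambda>z. d + P z * exp (poly p z)) z = (if k = 0 then d else 0) + Q z * exp (poly p z))"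
proof (induction k)
  case 0
  then show ?case using P by auto
next
  case (Suc k)
  define e where "e = (if k = 0 then d else 0)"
  obtain Q where Q: "slow \<rho> Q" "\<And>z. (deriv ^^ k) (\<lambda>z. d + P z * exp (poly p z)) z = e + Q z * exp (poly p z)"
    using Suc by (auto simp: e_def)
  have eq: "(deriv ^^ k) (\<lambda>z. d + P z * exp (poly p z)) = (\<lambda>z. e + Q z * exp (poly p z))" using Q(2) by auto
  have "((\<lambda>z. e + Q z * exp (poly p z)) has_field_derivative (deriv Q z + poly (pderiv p) z * Q z) * exp (poly p z)) (at z)" for z
  proof -
    have "(Q has_field_derivative deriv Q z) (at z)"
      by (rule holomorphic_derivI[OF slow_holomorphic[OF Q(1)]]) auto
    then show ?thesis
      by (auto intro!: derivative_eq_intros poly_DERIV simp: algebra_simps)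
  qed
  then have "(deriv ^^ Suc k) (\<lambda>z. d + P z * exp (poly p z)) z = (deriv Q z + poly (pderiv p) z * Q z) * exp (poly p z)" for z
    by (simp add: eq DERIV_imp_deriv)
  moreover have "slow \<rho> (\<lambda>z. deriv Q z + poly (pderiv p) z * Q z)"
    by (intro slow_add slow_mult slow_deriv slow_poly Q P)
  ultimately show ?case by auto
qed

text \<open>Derivatives of positive order kill the constant d, so only the indices with
  \<open>k j = 0\<close> enter the part free of exp p; this is where I1 comes from. A shift costs
  the factor exp (p(z + c) - p(z)), which is slow.\<close>

lemma linear_difference_form:
  fixes p :: "complex poly"
  assumes P: "slow \<rho> P" "\<rho> = real (degree p)" "0 < degree p"
    and b: "\<And>j. j \<in> J \<Longrightarrow> slow \<rho> (b j)" and J: "finite J"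
    and f: "f = (\<lambda>z. d + P z * exp (poly p z))"
  obtains A where "slow \<rho> A"
    "\<And>z. (\<Sum>j\<in>J. b j z * (deriv ^^ k j) f (z + c j)) = (\<Sum>j\<in>{j\<in>J. k j = 0}. b j z) * d + A z * exp (poly p z)"
proof -
  have \<rho>: "0 < \<rho>" using P by simp
  have "\<forall>n. \<exists>Q. slow \<rho> Q \<and> (\<forall>z. (deriv ^^ n) f z = (if n = 0 then d else 0) + Q z * exp (poly p z))"
    unfolding f using higher_deriv_poly_exp[OF P(1) \<rho>] by blast
  then obtain Q where Q: "\<And>n. slow \<rho> (Q n)"
      "\<And>n z. (deriv ^^ n) f z = (if n = 0 then d else 0) + Q n z * exp (poly p z)" by metis
  define A where "A z = (\<Sum>j\<in>J. b j z * (Q (k j) (z + c j) * exp (poly p (z + c j) - poly p z)))" for z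
  have "slow \<rho> A" unfolding A_def
    using slow_exp_poly_shift[OF P(3)] P(2) by (intro slow_sum slow_mult slow_shift b Q \<rho>) auto
  moreover have "(\<Sum>j\<in>J. b j z * (deriv ^^ k j) f (z + c j)) = (\<Sum>j\<in>{j\<in>J. k j = 0}. b j z) * d + A z * exp (poly p z)" for z
  proof -
    have "(\<Sum>j\<in>J. b j z * (deriv ^^ k j) f (z + c j)) = (\<Sum>j\<in>J. (if k j = 0 then b j z else 0) * d
        + b j z * (Q (k j) (z + c j) * exp (poly p (z + c j) - poly p z)) * exp (poly p z))"
      by (intro sum.cong refl) (simp add: Q(2) algebra_simps exp_diff)
    also have "\<dots> = (\<Sum>j\<in>J. (if k j = 0 then b j z else 0)) * d + A z * exp (poly p z)"
      by (simp add: sum.distrib sum_distrib_right A_def)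
    also have "(\<Sum>j\<in>J. (if k j = 0 then b j z else 0)) = (\<Sum>j\<in>{j\<in>J. k j = 0}. b j z)"
      by (rule sum.inter_filter[OF J, symmetric])
    finally show ?thesis .
  qed
  ultimately show ?thesis using that by blast
qed

lemma higher_deriv_poly_0:
  fixes p :: "complex poly"
  shows "(deriv ^^ n) (poly p) 0 = fact n * coeff p n"
proof (induction n arbitrary: p)
  case 0
  then show ?case by (simp add: poly_0_coeff_0)
next
  case (Suc n)
  have "deriv (poly p) = poly (pderiv p)" by (rule ext, rule DERIV_imp_deriv, rule poly_DERIV)
  then have "(deriv ^^ Suc n) (poly p) 0 = fact n * coeff (pderiv p) n"
    by (simp add: funpow_Suc_right Suc del: funpow.simps)
  then show ?case by (simp add: coeff_pderiv)
qed

lemma holomorphic_poly_UNIV: "poly p holomorphic_on UNIV" for p :: "complex poly"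
  by (rule slow_holomorphic[OF slow_poly[of 1]]) simp

text \<open>The leading coefficient is a Taylor coefficient and hence bounded by the proximity
  function of exp p. Half of it absorbs the constant term and the factor 4 remains, which gives a /
  8.\<close>

lemma proximity_exp_poly_ge:
  fixes p :: "complex poly"
  assumes "0 < degree p"
  obtains c where "0 < c" "\<forall>\<^sub>F r in at_top. c * r powr real (degree p) \<le> proximity (\<lambda>z. exp (poly p z)) r"
proof -
  define a where "a = norm (lead_coeff p)"
  have a: "0 < a" using assms by (auto simp: a_def)
  have "\<forall>\<^sub>F r in at_top. 2 * \<bar>Re (poly p 0)\<bar> * r powr 0 \<le> a / 2 * r powr real (degree p)"
    by (rule powr_dominated) (use assms a in auto)
  then have "\<forall>\<^sub>F r in at_top. a / 8 * r powr real (degree p) \<le> proximity (\<lambda>z. exp (poly p z)) r"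
    using eventually_gt_at_top[of 0]
  proof eventually_elim
    case (elim r)
    have "a * r ^ degree p \<le> 4 * proximity (\<lambda>z. exp (poly p z)) r + 2 * \<bar>Re (poly p 0)\<bar>"
      using entire_coeff_bound[OF holomorphic_poly_UNIV elim(2) assms] by (simp add: higher_deriv_poly_0 a_def)
    then show ?case using elim by (simp add: powr_realpow)
  qed
  then show ?thesis using that[of "a / 8"] a by simp
qed

lemma proximity_exp_poly_le:
  fixes p :: "complex poly"
  obtains K where "0 \<le> K" "\<forall>\<^sub>F r in at_top. proximity (\<lambda>z. exp (poly p z)) r \<le> K * r powr real (degree p)"
  by (rule proximity_finite_type[OF finite_type_exp_poly]) (rule that)

lemma proximity_add_mult_le:
  assumes "0 \<le> r" "continuous_on (sphere 0 r) P" "continuous_on (sphere 0 r) w"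
  shows "proximity (\<lambda>z. d + P z * w z) r \<le> proximity P r + proximity w r + (log_plus (norm d) + ln 2)"
proof -
  have "log_plus (norm (d + P z * w z)) \<le> log_plus (norm (P z)) + log_plus (norm (w z)) + (log_plus (norm d) + ln 2)" for z
  proof -
    have "log_plus (norm (d + P z * w z)) \<le> log_plus (norm d + norm (P z) * norm (w z))"
      by (intro log_plus_mono order_trans[OF norm_triangle_ineq]) (simp add: norm_mult)
    also have "\<dots> \<le> log_plus (norm d) + log_plus (norm (P z) * norm (w z)) + ln 2"
      by (intro log_plus_add) auto
    also have "\<dots> \<le> log_plus (norm d) + (log_plus (norm (P z)) + log_plus (norm (w z))) + ln 2"
      by (intro add_mono log_plus_mult order_refl) auto
    finally show ?thesis by simp
  qed
  then have "proximity (\<lambda>z. d + P z * w z) r \<le> (\<Sum>f\<leftarrow>[P, w]. proximity f r) + (log_plus (norm d) + ln 2)"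
    by (intro proximity_le_sum_list) (use assms in \<open>auto intro!: continuous_intros\<close>)
  then show ?thesis by simp
qed

lemma counting_int_le_powr:
  assumes "zero_exponent g < ereal \<rho>"
  obtains \<sigma> where "0 < \<sigma>" "\<sigma> < \<rho>" "\<forall>\<^sub>F r in at_top. counting_int (\<lambda>z. 1 / g z) r \<le> r powr \<sigma>"
proof -
  obtain \<sigma>' where \<sigma>': "zero_exponent g < \<sigma>'" "\<sigma>' < ereal \<rho>"
    using dense[OF assms] by blast
  have "0 \<le> zero_exponent g" unfolding zero_exponent_def by (rule Limsup_log_plus_nonneg)
  then have "0 < \<sigma>'" using \<sigma>' by (simp add: le_less_trans)
  then obtain \<sigma> where \<sigma>: "\<sigma>' = ereal \<sigma>" "0 < \<sigma>" "\<sigma> < \<rho>" using \<sigma>'(2) by (cases \<sigma>') auto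
  have "\<forall>\<^sub>F r in at_top. counting_int (\<lambda>z. 1 / g z) r \<le> r powr \<sigma>"
    using \<sigma>'(1) unfolding zero_exponent_def \<sigma>(1) by (rule Limsup_log_plus_lessD)
  then show ?thesis using that \<sigma> by blast
qed

text \<open>The exponent \<open>q\<close> is a polynomial because its Taylor coefficients are controlled by the
  proximity function of \<open>exp q = (f - d) / P\<close>.\<close>

theorem borel_exceptional_value_factorization:
  assumes f: "f holomorphic_on UNIV" "\<exists>z. f z \<noteq> d"
    and order: "growth_order f = ereal \<rho>" and zeros: "zero_exponent (\<lambda>z. f z - d) < ereal \<rho>"
  obtains P p where "slow \<rho> P" "\<exists>z. P z \<noteq> 0" "\<rho> = real (degree p)" "0 < degree p" "f = (\<lambda>z. d + P z * exp (poly p z))"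
proof -
  obtain \<sigma> where \<sigma>: "0 < \<sigma>" "\<sigma> < \<rho>" and NN: "\<forall>\<^sub>F r in at_top. counting_int (\<lambda>z. 1 / (f z - d)) r \<le> r powr \<sigma>"
    by (rule counting_int_le_powr[OF zeros]) (rule that)
  \<comment> \<open>\<sigma> < s < t < \<rho>: the canonical product is bounded with exponent s, and
    \<open>P\<close> is slow already with respect to t, which is needed to exclude that the degree
    of p is below \<rho>.\<close>
  define s where "s = (\<sigma> + \<rho>) / 2"
  define t where "t = (s + \<rho>) / 2"
  have \<rho>: "0 < \<rho>" using \<sigma> by linarith
  have s: "\<sigma> < s" "0 < s" "s < t" "0 < t" "t < \<rho>" "s < \<rho>" using \<sigma> \<rho> by (auto simp: s_def t_def intro!: add_pos_pos)
  have G: "(\<lambda>z. f z - d) holomorphic_on UNIV" "\<exists>z. f z - d \<noteq> 0" using f by (auto intro!: holomorphic_intros)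
  obtain r0 where N: "\<And>r. r0 \<le> r \<Longrightarrow> counting_int (\<lambda>z. 1 / (f z - d)) r \<le> r powr \<sigma>"
    using NN unfolding eventually_at_top_linorder by blast
  obtain P q C n where P: "P holomorphic_on UNIV" "\<exists>z. P z \<noteq> 0" "q holomorphic_on UNIV"
      "\<And>z. f z - d = P z * exp (q z)" "0 \<le> C" "\<And>z. norm (P z) \<le> norm z ^ n * exp (C * norm z powr s)"
    using canonical_factorization[OF G N s(1,2)] by blast
  have Pt: "slow t P"
    by (rule slow_of_bound[OF P(1), where n = n and C = C and s = s]) (use P(6) s in auto)
  have P\<rho>: "slow \<rho> P"
    by (rule slow_of_bound[OF P(1), where n = n and C = C and s = s]) (use P(6) s \<rho> in auto)
  have Tf: "\<forall>\<^sub>F r in at_top. proximity f r \<le> r powr (\<rho> + e)" if "0 < e" for e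
  proof -
    have "growth_order f < ereal (\<rho> + e)" using order that by simp
    then show ?thesis using Limsup_log_plus_lessD[of "characteristic f" "\<rho> + e"]
      by (simp add: growth_order_def characteristic_entire[OF f(1)])
  qed
  define c where "c = log_plus (norm d) + ln 2"
  have mw: "proximity (\<lambda>z. exp (q z)) r \<le> proximity f r + proximity (\<lambda>z. 1 / P z) r + c"
    if r: "0 < r" "zero_free_radius P r" for r
  proof -
    note ci = continuous_on_sphere_inverse[OF P(1) r(2)]
    note cf = continuous_on_sphere_holomorphic[OF f(1), of r]
    have "proximity (\<lambda>z. exp (q z)) r = proximity (\<lambda>z. 0 + (1 / P z) * (f z - d)) r"
      unfolding proximity_eq_circle_mean using r P(4)
      by (intro circle_mean_cong) (auto simp: zero_free_radius_def)
    also have "\<dots> \<le> proximity f r + proximity (\<lambda>z. 1 / P z) r + c"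
    proof -
      have "log_plus (norm (0 + (1 / P z) * (f z - d))) \<le> log_plus (norm (f z)) + log_plus (norm (1 / P z)) + c" for z
      proof -
        have "log_plus (norm (0 + (1 / P z) * (f z - d))) \<le> log_plus (norm (1 / P z)) + log_plus (norm (f z - d))"
          unfolding add_0 norm_mult by (intro log_plus_mult) auto
        also have "log_plus (norm (f z - d)) \<le> log_plus (norm (f z) + norm d)"
          by (intro log_plus_mono norm_triangle_ineq4)
        also have "\<dots> \<le> log_plus (norm (f z)) + log_plus (norm d) + ln 2" by (intro log_plus_add) auto
        finally show ?thesis by (simp add: c_def)
      qed
      moreover have "continuous_on (sphere 0 r) (\<lambda>z. 0 + (1 / P z) * (f z - d))"
        by (rule continuous_on_add[OF continuous_on_const continuous_on_mult[OF ci continuous_on_diff[OF cf continuous_on_const]]])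
      ultimately have "proximity (\<lambda>z. 0 + (1 / P z) * (f z - d)) r \<le> (\<Sum>g\<leftarrow>[f, \<lambda>z. 1 / P z]. proximity g r) + c"
        by (intro proximity_le_sum_list) (use r ci cf in auto)
      then show ?thesis by simp
    qed
    finally show ?thesis .
  qed
  have small: "(deriv ^^ n) q 0 = 0" if n: "\<rho> < real n" for n
  proof (rule ccontr)
    assume nz: "(deriv ^^ n) q 0 \<noteq> 0"
    define a where "a = norm ((deriv ^^ n) q 0 / fact n)"
    have a: "0 < a" using nz by (simp add: a_def)
    \<comment> \<open>Finite order only gives T(r, f) \<le> r^(\<rho> + e), so e is half of the gap
      between \<rho> and n.\<close>
    define e where "e = (real n - \<rho>) / 2"
    have e: "0 < e" "\<rho> + e < real n" using n by (auto simp: e_def field_simps)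
    define c' where "c' = 4 * c + 2 * \<bar>Re (q 0)\<bar>"
    have "\<forall>\<^sub>F r in generic_radii. proximity (\<lambda>z. 1 / P z) r \<le> 1 * r powr \<rho>"
      using upper_small_proximity_inverse[OF P\<rho> P(2) \<rho>] unfolding upper_small_def by (rule allE[of _ 1]) simp
    \<comment> \<open>In the coefficient, 4 stands for f, 4 for 1/P and |c'| for the constants;
      being left with a/2 against a gives the contradiction.\<close>
    moreover have "\<forall>\<^sub>F r in generic_radii. proximity f r \<le> r powr (\<rho> + e) \<and> 1 \<le> r \<and>
        (4 + 4 + \<bar>c'\<bar>) * r powr (\<rho> + e) \<le> a / 2 * r powr real n"
      by (intro eventually_generic_radii_at_top eventually_conj Tf e eventually_ge_at_top powr_dominated) (use a in auto)
    ultimately have "\<forall>\<^sub>F r in generic_radii. False"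
      using eventually_generic_zero_free[OF P(1,2)]
    proof eventually_elim
      case (elim r)
      have r: "0 < r" "1 \<le> r" using elim by auto
      have n0: "0 < n" using n \<rho> by (cases n) auto
      have "a * r ^ n \<le> 4 * proximity (\<lambda>z. exp (q z)) r + 2 * \<bar>Re (q 0)\<bar>"
        unfolding a_def by (rule entire_coeff_bound[OF P(3) r(1) n0])
      also have "\<dots> \<le> 4 * (proximity f r + proximity (\<lambda>z. 1 / P z) r) + c'"
        using mw[OF r(1) elim(3)] by (simp add: c'_def)
      also have "\<dots> \<le> 4 * (r powr (\<rho> + e) + r powr \<rho>) + c'" using elim by simp
      also have "r powr \<rho> \<le> r powr (\<rho> + e)" using r e by (intro powr_mono) auto
      finally have 1: "a * r ^ n \<le> 8 * r powr (\<rho> + e) + c'" by simp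
      have "1 \<le> r powr (\<rho> + e)" using r e \<rho> by (intro ge_one_powr_ge_zero) auto
      then have "c' \<le> \<bar>c'\<bar> * r powr (\<rho> + e)" using mult_left_mono[of 1 "r powr (\<rho> + e)" "\<bar>c'\<bar>"] by simp
      then have "a * r ^ n \<le> (4 + 4 + \<bar>c'\<bar>) * r powr (\<rho> + e)" using 1 by (simp add: algebra_simps)
      also have "\<dots> \<le> a / 2 * r ^ n" using elim r by (simp add: powr_realpow)
      finally show ?case using a r by simp
    qed
    then show False using generic_radii_neq_bot by simp
  qed
  obtain p where p: "degree p \<le> nat \<lfloor>\<rho>\<rfloor>" "q = poly p"
  proof (rule entire_eq_poly[OF P(3)])
    show "(deriv ^^ n) q 0 = 0" if "nat \<lfloor>\<rho>\<rfloor> < n" for n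
      using that \<rho> by (intro small) linarith
  qed (rule that)
  have deg: "real (degree p) \<le> \<rho>" using p(1) \<rho> by linarith
  have feq: "f = (\<lambda>z. d + P z * exp (poly p z))" using P(4) p(2) by (auto simp: fun_eq_iff algebra_simps)
  \<comment> \<open>If the degree were smaller, both \<open>P\<close> and exp p, hence f, would grow
    with an exponent below \<rho>.\<close>
  have "\<rho> \<le> real (degree p)"
  proof (rule ccontr)
    assume "\<not> ?thesis"
    define t1 where "t1 = max t (real (degree p))"
    have t1: "t1 < \<rho>" "0 < t1" "t \<le> t1" "real (degree p) \<le> t1" using s \<open>\<not> _\<close> by (auto simp: t1_def)
    define t2 where "t2 = (t1 + \<rho>) / 2"
    have t2: "t1 < t2" "t2 < \<rho>" "0 < t2" using t1 by (auto simp: t2_def)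
    obtain K where K: "0 \<le> K" "\<forall>\<^sub>F r in at_top. proximity (\<lambda>z. exp (poly p z)) r \<le> K * r powr real (degree p)"
      by (rule proximity_exp_poly_le[of p]) (rule that)
    have "\<forall>\<^sub>F r in at_top. proximity P r \<le> 1 * r powr t" by (rule proximity_slow[OF Pt]) simp
    moreover have "\<forall>\<^sub>F r in at_top. (1 + K + c) * r powr t1 \<le> 1 * r powr t2" by (rule powr_dominated) (use t2 in auto)
    ultimately have "\<forall>\<^sub>F r in at_top. characteristic f r \<le> r powr t2"
      using K(2) eventually_ge_at_top[of 1]
    proof eventually_elim
      case (elim r)
      have "proximity f r \<le> proximity P r + proximity (\<lambda>z. exp (poly p z)) r + c"
        unfolding feq c_def using elim
        by (intro proximity_add_mult_le continuous_on_sphere_holomorphic P(1) holomorphic_exp_poly) auto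
      also have "\<dots> \<le> 1 * r powr t + K * r powr real (degree p) + c" using elim by simp
      also have "\<dots> \<le> 1 * r powr t1 + K * r powr t1 + c * r powr t1"
      proof (intro add_mono mult_left_mono powr_mono)
        have "1 \<le> r powr t1" using elim t1 by (intro ge_one_powr_ge_zero) auto
        then show "c \<le> c * r powr t1" using mult_left_mono[of 1 "r powr t1" c] by (simp add: c_def)
      qed (use t1 K elim in auto)
      also have "\<dots> = (1 + K + c) * r powr t1" by (simp add: algebra_simps)
      also have "\<dots> \<le> r powr t2" using elim by simp
      finally show ?case by (simp add: characteristic_entire[OF f(1)])
    qed
    then have "growth_order f \<le> ereal t2" unfolding growth_order_def by (rule Limsup_log_plus_le) (use t2 in simp)
    then show False using order t2 by simp
  qed
  then show ?thesis using that[OF P\<rho> P(2), of p] deg \<rho> feq by auto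
qed

section \<open>Exceptional sets\<close>

lemma finite_log_measure_null:
  assumes "N \<in> null_sets lborel" shows "finite_log_measure N"
proof -
  have N: "N \<in> null_sets lebesgue" using assms by (rule null_sets_completionI)
  have ae: "AE t in lebesgue. t \<notin> N" using N by (rule AE_not_in)
  have "set_nn_integral lebesgue (N \<inter> {1..}) (\<lambda>t. ennreal (1 / t)) = (\<integral>\<^sup>+(t::real). 0 \<partial>lebesgue)"
    by (rule nn_integral_cong_AE) (use ae in \<open>auto elim!: eventually_mono\<close>)
  then show ?thesis using N by (auto simp: finite_log_measure_def)
qed

lemma finite_log_measure_Un:
  assumes "finite_log_measure E" "finite_log_measure F" shows "finite_log_measure (E \<union> F)"
proof -
  have EF: "E \<in> sets lebesgue" "F \<in> sets lebesgue" using assms by (auto simp: finite_log_measure_def)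
  have m: "(\<lambda>t. ennreal (1 / t) * indicator (A \<inter> {1..}) t) \<in> borel_measurable lebesgue" if "A \<in> sets lebesgue" for A
  proof -
    have "(\<lambda>t::real. ennreal (1 / t)) \<in> borel_measurable lebesgue" by (intro measurable_completion) measurable
    moreover have "indicator (A \<inter> {1..}) \<in> borel_measurable lebesgue" using that by (intro borel_measurable_indicator sets.Int) auto
    ultimately show ?thesis by (rule borel_measurable_times_ennreal)
  qed
  have "set_nn_integral lebesgue ((E \<union> F) \<inter> {1..}) (\<lambda>t. ennreal (1 / t))
     \<le> (\<integral>\<^sup>+t. ennreal (1 / t) * indicator (E \<inter> {1..}) t + ennreal (1 / t) * indicator (F \<inter> {1..}) t \<partial>lebesgue)"
    by (intro nn_integral_mono) (auto split: split_indicator)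
  also have "\<dots> = set_nn_integral lebesgue (E \<inter> {1..}) (\<lambda>t. ennreal (1 / t)) + set_nn_integral lebesgue (F \<inter> {1..}) (\<lambda>t. ennreal (1 / t))"
    by (rule nn_integral_add[OF m[OF EF(1)] m[OF EF(2)]])
  also have "\<dots> < \<infinity>" using assms by (simp add: finite_log_measure_def)
  finally show ?thesis using EF by (auto simp: finite_log_measure_def)
qed

lemma at_top_outside_mono: "E \<subseteq> F \<Longrightarrow> at_top_outside F \<le> at_top_outside E"
  unfolding at_top_outside_def by (intro inf_mono) auto

lemma eventually_at_top_outside:
  "eventually P (at_top_outside F) \<longleftrightarrow> (\<exists>x. \<forall>r\<ge>x. r \<notin> F \<longrightarrow> P r)"
  unfolding at_top_outside_def eventually_inf_principal eventually_at_top_linorder by auto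

lemma eventually_at_top_outside_at_top: "eventually P at_top \<Longrightarrow> eventually P (at_top_outside F)"
  unfolding at_top_outside_def by (rule filter_leD[OF inf_le1])

text \<open>The tails of F have logarithmic measure tending to 0, whereas [2x, 4x] always has
  measure at least 2x / (4x) = 1/2. Removing a countable set does not change this.\<close>

lemma finite_log_measure_avoid:
  assumes F: "finite_log_measure F" and N: "countable N"
  obtains x0 where "1 \<le> x0" "\<And>x. x0 \<le> x \<Longrightarrow> \<exists>R. 2 * x \<le> R \<and> R \<le> 4 * x \<and> R \<notin> F \<and> R \<notin> N"
proof -
  define g where "g t = ennreal (1 / t) * indicator (F \<inter> {1..}) t" for t :: real
  have FL: "F \<in> sets lebesgue" using F by (simp add: finite_log_measure_def)
  have gm: "g \<in> borel_measurable lebesgue" unfolding g_def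
  proof (rule borel_measurable_times_ennreal)
    show "(\<lambda>t::real. ennreal (1 / t)) \<in> borel_measurable lebesgue" by (intro measurable_completion) measurable
    show "indicator (F \<inter> {1..}) \<in> borel_measurable lebesgue" using FL by (intro borel_measurable_indicator sets.Int) auto
  qed
  define M where "M = density lebesgue g"
  have fin: "emeasure M A \<noteq> \<infinity>" if "A \<in> sets lebesgue" for A
  proof -
    have "emeasure M A \<le> integral\<^sup>N lebesgue g"
      unfolding M_def emeasure_density[OF gm that] by (intro nn_integral_mono) (auto split: split_indicator)
    also have "\<dots> < \<infinity>" using F by (simp add: finite_log_measure_def g_def[abs_def])
    finally show ?thesis by simp
  qed
  have finn: "emeasure M {real n..} \<noteq> \<infinity>" for n by (rule fin) simp
  have "(\<lambda>n. emeasure M {real n..}) \<longlonglongrightarrow> emeasure M (\<Inter>n. {real n..})"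
    by (rule Lim_emeasure_decseq) (use finn in \<open>auto simp: M_def decseq_def\<close>)
  moreover have "(\<Inter>n. {real n..}) = {}"
  proof (rule equals0I)
    fix x assume x: "x \<in> (\<Inter>n. {real n..})"
    obtain n :: nat where "x < real n" using reals_Archimedean2 by blast
    moreover have "real n \<le> x" using INT_D[OF x UNIV_I, of n] by simp
    ultimately show False by simp
  qed
  ultimately have "(\<lambda>n. emeasure M {real n..}) \<longlonglongrightarrow> 0" by simp
  then have "\<forall>\<^sub>F n in sequentially. emeasure M {real n..} < ennreal (1 / 2)"
  proof (rule order_tendstoD)
    show "0 < ennreal (1 / 2)" by (subst ennreal_0[symmetric], rule ennreal_lessI) simp_all
  qed
  then obtain n where n: "emeasure M {real n..} < ennreal (1 / 2)" by (auto simp: eventually_sequentially)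
  have "\<exists>R. 2 * x \<le> R \<and> R \<le> 4 * x \<and> R \<notin> F \<and> R \<notin> N" if x: "max 1 (real n) \<le> x" for x
  proof (rule ccontr)
    assume "\<not> ?thesis"
    then have sub: "{2 * x..4 * x} - N \<subseteq> {2 * x..4 * x} \<inter> F" by auto
    have x1: "1 \<le> x" "real n \<le> x" using x by auto
    have Nn: "N \<in> null_sets lebesgue" using countable_imp_null_set_lborel[OF N] by (rule null_sets_completionI)
    have "ennreal (2 * x) = emeasure lebesgue {2 * x..4 * x}" using x1 by simp
    also have "\<dots> = emeasure lebesgue ({2 * x..4 * x} - N)" by (rule emeasure_Diff_null_set[symmetric, OF Nn]) simp
    also have "\<dots> \<le> emeasure lebesgue ({2 * x..4 * x} \<inter> F)" using FL by (intro emeasure_mono sub sets.Int) auto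
    finally have 1: "ennreal (2 * x) \<le> emeasure lebesgue ({2 * x..4 * x} \<inter> F)" .
    have "ennreal (1 / 2) = ennreal (1 / (4 * x)) * ennreal (2 * x)" using x1 by (simp add: ennreal_mult[symmetric])
    also have "\<dots> \<le> ennreal (1 / (4 * x)) * emeasure lebesgue ({2 * x..4 * x} \<inter> F)" by (intro mult_left_mono 1) simp
    also have "\<dots> = (\<integral>\<^sup>+t. ennreal (1 / (4 * x)) * indicator ({2 * x..4 * x} \<inter> F) t \<partial>lebesgue)"
      using FL by (intro nn_integral_cmult_indicator[symmetric] sets.Int) auto
    also have "\<dots> \<le> (\<integral>\<^sup>+t. g t * indicator {real n..} t \<partial>lebesgue)"
      using x1 by (intro nn_integral_mono) (auto simp: g_def divide_simps split: split_indicator intro!: ennreal_leI)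
    also have "\<dots> = emeasure M {real n..}" unfolding M_def by (rule emeasure_density[OF gm, symmetric]) simp
    finally show False using n by simp
  qed
  then show ?thesis using that[of "max 1 (real n)"] by auto
qed

text \<open>Here the exceptional set disappears: the mean at one good radius R in [2x, 4x] bounds
  the function on all of |z| = x. R also avoids the moduli of zeros, as the pointwise bound
  requires.\<close>

lemma slow_of_proximity:
  assumes g: "g holomorphic_on UNIV" and F: "finite_log_measure F" and \<rho>: "0 < \<rho>"
    and small: "\<And>\<epsilon>. 0 < \<epsilon> \<Longrightarrow> \<forall>\<^sub>F r in at_top_outside F. proximity g r \<le> \<epsilon> * r powr \<rho>"
  shows "slow \<rho> g"
proof (cases "\<exists>z. g z \<noteq> 0")
  case False
  then have "g = (\<lambda>_. 0)" by auto
  then show ?thesis using slow_const[OF \<rho>] by simp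
next
  case True
  obtain c where c: "0 \<le> c" "\<And>R z. 1 \<le> R \<Longrightarrow> zero_free_radius g R \<Longrightarrow> norm z \<le> R / 2 \<Longrightarrow>
    norm (g z) \<le> exp (6 * proximity g R + c)"
    by (rule norm_le_exp_proximity[OF g True]) (rule that)
  obtain x0 where x0: "1 \<le> x0" "\<And>x. x0 \<le> x \<Longrightarrow> \<exists>R. 2 * x \<le> R \<and> R \<le> 4 * x \<and> R \<notin> F \<and> R \<notin> {norm z | z. g z = 0}"
    by (rule finite_log_measure_avoid[OF F countable_zero_radii[OF g True]]) (rule that)
  show ?thesis unfolding slow_def
  proof (intro conjI allI impI g)
    fix \<epsilon> :: real assume e: "0 < \<epsilon>"
    \<comment> \<open>R \<le> 4x costs 4^\<rho> and the exponent carries 6 m(R, g), so this part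
      amounts to \<epsilon>/2; the other half is for the constant c.\<close>
    define \<delta> where "\<delta> = \<epsilon> / (12 * 4 powr \<rho>)"
    have \<delta>: "0 < \<delta>" using e by (simp add: \<delta>_def)
    obtain x1 where x1: "\<And>r. x1 \<le> r \<Longrightarrow> r \<notin> F \<Longrightarrow> proximity g r \<le> \<delta> * r powr \<rho>"
      using small[OF \<delta>] unfolding eventually_at_top_outside by blast
    have "\<forall>\<^sub>F x in at_top. c \<le> \<epsilon> / 2 * x powr \<rho>" using e \<rho> by real_asymp
    then obtain x2 where x2: "\<And>x. x2 \<le> x \<Longrightarrow> c \<le> \<epsilon> / 2 * x powr \<rho>" unfolding eventually_at_top_linorder by blast
    have "norm (g z) \<le> exp (\<epsilon> * norm z powr \<rho>)" if z: "max x0 (max \<bar>x1\<bar> x2) \<le> norm z" for z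
    proof -
      define x where "x = norm z"
      have x: "x0 \<le> x" "x1 \<le> x" "x2 \<le> x" "1 \<le> x" using z x0(1) by (auto simp: x_def)
      obtain R where R: "2 * x \<le> R" "R \<le> 4 * x" "R \<notin> F" "R \<notin> {norm z | z. g z = 0}" using x0(2)[OF x(1)] by blast
      have zf: "zero_free_radius g R" using R(4) by (auto simp: zero_free_radius_def)
      have "norm (g z) \<le> exp (6 * proximity g R + c)"
        using R x by (intro c(2) zf) (auto simp: x_def)
      also have "proximity g R \<le> \<delta> * R powr \<rho>" using R x by (intro x1) auto
      then have "6 * proximity g R + c \<le> 6 * (\<delta> * R powr \<rho>) + \<epsilon> / 2 * x powr \<rho>" using x2[OF x(3)] by simp
      also have "R powr \<rho> \<le> (4 * x) powr \<rho>" using R x \<rho> by (intro powr_mono2) auto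
      then have "6 * (\<delta> * R powr \<rho>) \<le> 6 * (\<delta> * (4 powr \<rho> * x powr \<rho>))" using \<delta> x by (simp add: powr_mult)
      also have "\<dots> = \<epsilon> / 2 * x powr \<rho>" by (simp add: \<delta>_def)
      finally show ?thesis by (simp add: x_def field_simps)
    qed
    then show "\<forall>\<^sub>F z in at_infinity. norm (g z) \<le> exp (\<epsilon> * norm z powr \<rho>)"
      unfolding eventually_at_infinity by blast
  qed
qed

text \<open>The choice e = (\<rho> - \<open>lam\<close>) / 2 makes the O part o(r^\<rho>), and T(r,
  f) = O(r^\<rho>) does the same for the S part.\<close>

lemma lam_small_imp_slow:
  assumes a: "a holomorphic_on UNIV" "lam_small_function lam f a"
    and f: "growth_order f = ereal \<rho>" "lam < \<rho>" "0 < \<rho>"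
    and Tf: "\<forall>\<^sub>F r in at_top. \<bar>characteristic f r\<bar> \<le> K * r powr \<rho>" "0 < K"
  shows "slow \<rho> a"
proof -
  define e where "e = (\<rho> - lam) / 2"
  have e: "0 < e" "lam + e < \<rho>" using f by (auto simp: e_def field_simps)
  obtain F v w F' where F: "finite_log_measure F" "v \<in> O[at_top_outside F](\<lambda>r. r powr (lam + e))"
      "\<forall>\<^sub>F r in at_top_outside F. characteristic a r = v r + w r"
      and F': "finite_log_measure F'" "w \<in> o[at_top_outside F'](characteristic f)"
    using a(2) e f(1) unfolding lam_small_function_def S_lam_quantity_def S_quantity_def by (metis ereal_less(2) less_ereal.simps(1))
  define E where "E = F \<union> F'"
  have le: "at_top_outside E \<le> at_top_outside F" "at_top_outside E \<le> at_top_outside F'"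
    by (auto simp: E_def intro!: at_top_outside_mono)
  obtain C where C: "\<forall>\<^sub>F r in at_top_outside F. norm (v r) \<le> C * norm (r powr (lam + e))"
    using landau_o.bigE[OF F(2)] by blast
  show ?thesis
  proof (rule slow_of_proximity[OF a(1) _ f(3)])
    show "finite_log_measure E" unfolding E_def by (rule finite_log_measure_Un[OF F(1) F'(1)])
    fix \<epsilon> :: real assume eps: "0 < \<epsilon>"
    have "0 < \<epsilon> / (2 * K)" using eps Tf by simp
    from landau_o.smallD[OF F'(2) this]
    have w: "\<forall>\<^sub>F r in at_top_outside F'. norm (w r) \<le> \<epsilon> / (2 * K) * norm (characteristic f r)" .
    have pw: "\<forall>\<^sub>F r in at_top. C * r powr (lam + e) \<le> \<epsilon> / 2 * r powr \<rho>"
      by (rule powr_dominated) (use e eps in auto)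
    show "\<forall>\<^sub>F r in at_top_outside E. proximity a r \<le> \<epsilon> * r powr \<rho>"
      using filter_leD[OF le(1) F(3)] filter_leD[OF le(1) C] filter_leD[OF le(2) w]
        eventually_at_top_outside_at_top[OF pw] eventually_at_top_outside_at_top[OF Tf(1)]
    proof eventually_elim
      case (elim r)
      have "\<epsilon> / (2 * K) * norm (characteristic f r) \<le> \<epsilon> / (2 * K) * (K * r powr \<rho>)"
        using elim eps Tf(2) by (intro mult_left_mono) auto
      also have "\<dots> = \<epsilon> / 2 * r powr \<rho>" using Tf(2) by simp
      finally have "w r \<le> \<epsilon> / 2 * r powr \<rho>" using elim by simp
      moreover have "v r \<le> \<epsilon> / 2 * r powr \<rho>" using elim by simp
      ultimately show ?case using elim(1) by (simp add: characteristic_entire[OF a(1)])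
    qed
  qed
qed

section \<open>From one-sided smallness to the quantities S(r, f)\<close>

text \<open>The null sets belonging to \<epsilon> = 1 / (n + 1) are united, so that one exceptional
  set serves every \<epsilon>, as the Landau symbol demands.\<close>

lemma upper_small_null_set:
  assumes "upper_small \<rho> u"
  obtains N where "N \<in> null_sets lborel" "\<And>\<epsilon>. 0 < \<epsilon> \<Longrightarrow> \<forall>\<^sub>F r in at_top_outside N. u r \<le> \<epsilon> * r powr \<rho>"
proof -
  have "\<forall>n. \<exists>x N. N \<in> null_sets lborel \<and> (\<forall>r\<ge>x. r \<notin> N \<longrightarrow> u r \<le> 1 / real (Suc n) * r powr \<rho>)"
  proof
    fix n
    have "\<forall>\<^sub>F r in generic_radii. u r \<le> 1 / real (Suc n) * r powr \<rho>"
      using assms unfolding upper_small_def by (rule allE[of _ "1 / real (Suc n)"]) simp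
    then show "\<exists>x N. N \<in> null_sets lborel \<and> (\<forall>r\<ge>x. r \<notin> N \<longrightarrow> u r \<le> 1 / real (Suc n) * r powr \<rho>)"
      unfolding eventually_generic_radii .
  qed
  then obtain x N where N: "\<And>n. N n \<in> null_sets lborel"
      "\<And>n r. x n \<le> r \<Longrightarrow> r \<notin> N n \<Longrightarrow> u r \<le> 1 / real (Suc n) * r powr \<rho>" by metis
  have "(\<Union>n. N n) \<in> null_sets lborel" using N(1) by auto
  moreover have "\<forall>\<^sub>F r in at_top_outside (\<Union>n. N n). u r \<le> \<epsilon> * r powr \<rho>" if eps: "0 < \<epsilon>" for \<epsilon>
  proof -
    obtain n where n: "inverse (real (Suc n)) < \<epsilon>" using reals_Archimedean[OF eps] by auto
    have "u r \<le> \<epsilon> * r powr \<rho>" if r: "x n \<le> r" "r \<notin> (\<Union>n. N n)" for r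
    proof -
      have "u r \<le> 1 / real (Suc n) * r powr \<rho>" using r by (intro N(2)) auto
      also have "\<dots> \<le> \<epsilon> * r powr \<rho>" using n by (intro mult_right_mono) (auto simp: inverse_eq_divide)
      finally show ?thesis .
    qed
    then show ?thesis unfolding eventually_at_top_outside by blast
  qed
  ultimately show ?thesis using that by blast
qed

text \<open>Smallness relative to r^\<rho> is smallness relative to T(r, g) once T(r, g) grows at
  least like r^\<rho>.\<close>

lemma S_quantityI:
  assumes u: "upper_small \<rho> u" "upper_small \<rho> (\<lambda>r. - u r)"
    and T: "\<forall>\<^sub>F r in generic_radii. c * r powr \<rho> \<le> characteristic g r" "0 < c"
  shows "S_quantity g u"
proof -
  obtain N1 where N1: "N1 \<in> null_sets lborel" "\<And>\<epsilon>. 0 < \<epsilon> \<Longrightarrow> \<forall>\<^sub>F r in at_top_outside N1. u r \<le> \<epsilon> * r powr \<rho>"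
    by (rule upper_small_null_set[OF u(1)]) (rule that)
  obtain N2 where N2: "N2 \<in> null_sets lborel" "\<And>\<epsilon>. 0 < \<epsilon> \<Longrightarrow> \<forall>\<^sub>F r in at_top_outside N2. - u r \<le> \<epsilon> * r powr \<rho>"
    by (rule upper_small_null_set[OF u(2)]) (rule that)
  obtain N3 x where N3: "N3 \<in> null_sets lborel" "\<And>r. x \<le> r \<Longrightarrow> r \<notin> N3 \<Longrightarrow> c * r powr \<rho> \<le> characteristic g r"
    using T(1) unfolding eventually_generic_radii by blast
  define N where "N = N1 \<union> N2 \<union> N3"
  have N: "N \<in> null_sets lborel" unfolding N_def by (intro null_sets.Un N1 N2 N3)
  have le: "at_top_outside N \<le> at_top_outside N1" "at_top_outside N \<le> at_top_outside N2" "at_top_outside N \<le> at_top_outside N3"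
    by (auto simp: N_def intro!: at_top_outside_mono)
  have ev3: "\<forall>\<^sub>F r in at_top_outside N3. c * r powr \<rho> \<le> characteristic g r"
    unfolding eventually_at_top_outside using N3(2) by blast
  have "u \<in> o[at_top_outside N](characteristic g)"
  proof (rule landau_o.smallI)
    fix \<epsilon> :: real assume eps: "0 < \<epsilon>"
    then have "0 < \<epsilon> * c" using T by simp
    from filter_leD[OF le(1) N1(2)[OF this]] filter_leD[OF le(2) N2(2)[OF this]] filter_leD[OF le(3) ev3]
    show "\<forall>\<^sub>F r in at_top_outside N. norm (u r) \<le> \<epsilon> * norm (characteristic g r)"
    proof eventually_elim
      case (elim r)
      have "norm (u r) \<le> \<epsilon> * (c * r powr \<rho>)" using elim by (simp add: mult.assoc)
      also have "\<dots> \<le> \<epsilon> * norm (characteristic g r)" using elim eps by (intro mult_left_mono) auto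
      finally show ?case .
    qed
  qed
  then show ?thesis unfolding S_quantity_def using finite_log_measure_null[OF N] by blast
qed

lemma S_lam_quantityI:
  assumes "S_quantity f u" shows "S_lam_quantity lam f u"
  unfolding S_lam_quantity_def
proof (intro allI impI)
  fix \<epsilon> :: real
  have "finite_log_measure {}" by (rule finite_log_measure_null) simp
  then show "\<exists>F v w. finite_log_measure F \<and> v \<in> O[at_top_outside F](\<lambda>r. r powr (lam + \<epsilon>)) \<and>
           S_quantity f w \<and> (\<forall>\<^sub>F r in at_top_outside F. u r = v r + w r)"
    using assms by (intro exI[of _ "{}"] exI[of _ "\<lambda>_. 0"] exI[of _ u]) auto
qed

section \<open>Exponential polynomials with slowly growing coefficients\<close>

lemma log_plus_le_power: "0 \<le> x \<Longrightarrow> 0 < j \<Longrightarrow> log_plus x \<le> log_plus (x ^ j)"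
proof (cases "x \<le> 1")
  case False
  assume "0 < j"
  then have "x ^ 1 \<le> x ^ j" using False by (intro power_increasing) auto
  then show ?thesis by (intro log_plus_mono) simp
qed (simp add: log_plus_def)

lemma not_upper_small_proximity_exp:
  fixes p :: "complex poly"
  assumes "0 < degree p"
  shows "\<not> upper_small (real (degree p)) (proximity (\<lambda>z. exp (poly p z)))"
proof
  assume u: "upper_small (real (degree p)) (proximity (\<lambda>z. exp (poly p z)))"
  obtain c where c: "0 < c" "\<forall>\<^sub>F r in at_top. c * r powr real (degree p) \<le> proximity (\<lambda>z. exp (poly p z)) r"
    by (rule proximity_exp_poly_ge[OF assms]) (rule that)
  have "0 < c / 2" using c by simp
  then have "\<forall>\<^sub>F r in generic_radii. proximity (\<lambda>z. exp (poly p z)) r \<le> c / 2 * r powr real (degree p)"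
    using u unfolding upper_small_def by blast
  with eventually_generic_radii_at_top[OF c(2)] eventually_generic_radii_at_top[OF eventually_gt_at_top[of 0]]
  have "\<forall>\<^sub>F r in generic_radii. False"
  proof eventually_elim
    case (elim r)
    then have "c * r powr real (degree p) \<le> c / 2 * r powr real (degree p)" by linarith
    then show ?case using elim c by simp
  qed
  then show False using generic_radii_neq_bot by simp
qed

text \<open>Otherwise a power of exp p would be a quotient of slow functions, and m(r, exp p) would
  be o(r^\<rho>), against the lower bound from the leading coefficient.\<close>

lemma exp_not_proportional:
  fixes p :: "complex poly"
  assumes \<rho>: "\<rho> = real (degree p)" "0 < degree p" and A: "slow \<rho> A" "slow \<rho> B" "\<exists>z. B z \<noteq> 0" "0 < j"
    and eq: "\<And>z. B z * exp (poly p z) ^ j = c * A z"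
  shows False
proof -
  have \<rho>0: "0 < \<rho>" using \<rho> by simp
  have "upper_small \<rho> (\<lambda>r. proximity (\<lambda>z. 1 / B z) r + proximity A r + log_plus (norm c))"
    by (intro upper_small_add upper_small_proximity_inverse upper_small_proximity upper_small_const A \<rho>0)
  then have "upper_small \<rho> (proximity (\<lambda>z. exp (poly p z)))"
  proof (rule upper_small_mono)
    show "\<forall>\<^sub>F r in generic_radii. proximity (\<lambda>z. exp (poly p z)) r \<le> proximity (\<lambda>z. 1 / B z) r + proximity A r + log_plus (norm c)"
      using eventually_generic_zero_free[OF slow_holomorphic[OF A(2)] A(3)] eventually_generic_radii_at_top[OF eventually_gt_at_top[of 0]]
    proof eventually_elim
      case (elim r)
      have "log_plus (norm (exp (poly p z))) \<le> (\<Sum>f\<leftarrow>[\<lambda>z. 1 / B z, A]. log_plus (norm (f z))) + log_plus (norm c)" if z: "norm z = r" for z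
      proof -
        have "B z \<noteq> 0" using elim(1) z by (simp add: zero_free_radius_def)
        then have "exp (poly p z) ^ j = (1 / B z) * (c * A z)" using eq[of z] by (simp add: field_simps)
        then have "norm (exp (poly p z)) ^ j = norm (1 / B z) * (norm c * norm (A z))" by (metis norm_mult norm_power)
        then have "log_plus (norm (exp (poly p z))) \<le> log_plus (norm (1 / B z) * (norm c * norm (A z)))"
          using log_plus_le_power[of "norm (exp (poly p z))" j] A(4) by simp
        also have "\<dots> \<le> log_plus (norm (1 / B z)) + (log_plus (norm c) + log_plus (norm (A z)))"
          by (intro order_trans[OF log_plus_mult] add_mono log_plus_mult order_refl) auto
        finally show ?thesis by simp
      qed
      moreover have "continuous_on (sphere 0 r) (\<lambda>z. 1 / B z)" "continuous_on (sphere 0 r) A"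
          "continuous_on (sphere 0 r) (\<lambda>z. exp (poly p z))"
        using continuous_on_sphere_inverse[OF slow_holomorphic[OF A(2)] elim(1)]
        by (auto intro!: continuous_on_sphere_holomorphic slow_holomorphic[OF A(1)] holomorphic_exp_poly simp del: norm_exp_eq_Re)
      ultimately have "proximity (\<lambda>z. exp (poly p z)) r \<le> (\<Sum>f\<leftarrow>[\<lambda>z. 1 / B z, A]. proximity f r) + log_plus (norm c)"
        by (intro proximity_le_sum_list) (use elim in \<open>auto simp del: norm_exp_eq_Re\<close>)
      then show ?case by simp
    qed
  qed
  then show False using not_upper_small_proximity_exp[OF \<rho>(2)] \<rho>(1) by simp
qed

text \<open>If the Wronskian of \<open>C\<close> and \<open>E exp(j p)\<close> vanishes identically, then \<open>E exp(j p) / C\<close> is constant,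
  which is impossible for growth reasons.\<close>

lemma wronskian_nonzero:
  fixes p :: "complex poly"
  assumes \<rho>: "\<rho> = real (degree p)" "0 < degree p" and A: "slow \<rho> C" "slow \<rho> E" "\<exists>z. C z \<noteq> 0" "\<exists>z. E z \<noteq> 0" "0 < j"
  shows "\<exists>z. (deriv E z + of_nat j * poly (pderiv p) z * E z) * C z - E z * deriv C z \<noteq> 0"
proof (rule ccontr)
  assume "\<not> ?thesis"
  then have W: "(deriv E z + of_nat j * poly (pderiv p) z * E z) * C z - E z * deriv C z = 0" for z by auto
  note h = slow_holomorphic[OF A(1)] slow_holomorphic[OF A(2)]
  define F where "F z = E z * exp (poly p z) ^ j" for z
  obtain z0 where z0: "C z0 \<noteq> 0" using A(3) by auto
  have "isCont C z0" using holomorphic_on_imp_continuous_on[OF h(1)] by (simp add: continuous_on_eq_continuous_at)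
  \<comment> \<open>The quotient by C is formed only on a disc where C has no zeros; the resulting
    relation F = c C is then continued to the plane.\<close>
  from continuous_at_avoid[OF this z0] obtain s where s: "0 < s" "\<And>y. dist z0 y < s \<Longrightarrow> C y \<noteq> 0" by blast
  have "((\<lambda>z. F z / C z) has_field_derivative 0) (at z within ball z0 s)" if z: "z \<in> ball z0 s" for z
  proof -
    have Cz: "C z \<noteq> 0" using s(2) z by simp
    have dE: "(E has_field_derivative deriv E z) (at z)" "(C has_field_derivative deriv C z) (at z)"
      using h by (auto intro!: holomorphic_derivI[of _ UNIV])
    have F_exp: "F = (\<lambda>z. E z * exp (of_nat j * poly p z))" by (simp add: F_def fun_eq_iff exp_of_nat_mult)
    have dF: "(F has_field_derivative (deriv E z + of_nat j * poly (pderiv p) z * E z) * exp (of_nat j * poly p z)) (at z)"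
      unfolding F_exp by (auto intro!: derivative_eq_intros dE poly_DERIV simp: algebra_simps)
    have "((\<lambda>z. F z / C z) has_field_derivative ((deriv E z + of_nat j * poly (pderiv p) z * E z) * exp (of_nat j * poly p z) * C z - F z * deriv C z) / (C z * C z)) (at z)"
      by (rule DERIV_divide[OF dF dE(2) Cz])
    also have "(deriv E z + of_nat j * poly (pderiv p) z * E z) * exp (of_nat j * poly p z) * C z - F z * deriv C z
        = exp (of_nat j * poly p z) * ((deriv E z + of_nat j * poly (pderiv p) z * E z) * C z - E z * deriv C z)"
      by (simp add: F_exp algebra_simps)
    also have "\<dots> = 0" by (simp only: W mult_zero_right)
    finally show ?thesis by (simp add: has_field_derivative_at_within)
  qed
  from has_field_derivative_zero_constant[OF convex_ball this]
  obtain c where c: "\<And>z. z \<in> ball z0 s \<Longrightarrow> F z / C z = c" by blast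
  have Fh: "F holomorphic_on UNIV" unfolding F_def by (intro holomorphic_intros h)
  have "F z - c * C z = 0" for z
  proof (rule analytic_continuation_open[of "ball z0 s" UNIV "\<lambda>z. F z - c * C z" "\<lambda>_. 0"])
    show "(\<lambda>z. F z - c * C z) holomorphic_on UNIV" by (intro holomorphic_intros Fh h)
    show "F z - c * C z = 0" if "z \<in> ball z0 s" for z using c[OF that] s(2)[of z] that by (simp add: field_simps)
  qed (use s in auto)
  then show False
    using exp_not_proportional[OF \<rho> A(1,2,4,5), of c] by (simp add: F_def)
qed

text \<open>Dividing the relation by X G gives 1/G = (1/X) (K - E G'/G), in which every term on the
  right has small proximity function.\<close>

lemma upper_small_inverse_elimination:
  assumes G: "finite_type \<rho> G" "0 < \<rho>" and KE: "slow \<rho> K" "slow \<rho> E"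
    and X: "X holomorphic_on UNIV" "\<exists>z. X z \<noteq> 0" "upper_small \<rho> (proximity (\<lambda>z. 1 / X z))"
    and eq: "\<And>z. X z = K z * G z - E z * deriv G z"
  shows "\<exists>z. G z \<noteq> 0" and "upper_small \<rho> (proximity (\<lambda>z. 1 / G z))"
proof -
  note Gh = finite_type_holomorphic[OF G(1)]
  show nz: "\<exists>z. G z \<noteq> 0"
  proof (rule ccontr)
    assume "\<not> ?thesis"
    then have "G = (\<lambda>_. 0)" by auto
    then show False using X(2) eq by simp
  qed
  have "upper_small \<rho> (\<lambda>r. proximity (\<lambda>z. 1 / X z) r + proximity K r + proximity E r + proximity (\<lambda>z. deriv G z / G z) r + ln 2)"
    by (intro upper_small_add upper_small_proximity upper_small_const upper_small_log_derivative KE X G nz)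
  then show "upper_small \<rho> (proximity (\<lambda>z. 1 / G z))"
  proof (rule upper_small_mono)
    show "\<forall>\<^sub>F r in generic_radii. proximity (\<lambda>z. 1 / G z) r
       \<le> proximity (\<lambda>z. 1 / X z) r + proximity K r + proximity E r + proximity (\<lambda>z. deriv G z / G z) r + ln 2"
      using eventually_generic_zero_free[OF Gh nz] eventually_generic_zero_free[OF X(1,2)]
        eventually_generic_radii_at_top[OF eventually_gt_at_top[of 0]]
    proof eventually_elim
      case (elim r)
      let ?fs = "[\<lambda>z. 1 / X z, K, E, \<lambda>z. deriv G z / G z]"
      have "log_plus (norm (1 / G z)) \<le> (\<Sum>f\<leftarrow>?fs. log_plus (norm (f z))) + ln 2" if z: "norm z = r" for z
      proof -
        have nz: "G z \<noteq> 0" "X z \<noteq> 0" using elim z by (auto simp: zero_free_radius_def)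
        have "K z - E z * (deriv G z / G z) = X z / G z"
          unfolding eq[of z] using nz by (simp add: diff_divide_distrib)
        then have "1 / G z = (1 / X z) * (K z - E z * (deriv G z / G z))"
          using nz by simp
        then have "norm (1 / G z) \<le> norm (1 / X z) * (norm (K z) + norm (E z) * norm (deriv G z / G z))"
          by (simp only: norm_mult) (metis mult_left_mono norm_ge_zero norm_mult norm_triangle_ineq4)
        then have "log_plus (norm (1 / G z)) \<le> log_plus (norm (1 / X z) * (norm (K z) + norm (E z) * norm (deriv G z / G z)))"
          by (rule log_plus_mono)
        also have "\<dots> \<le> log_plus (norm (1 / X z)) + (log_plus (norm (K z)) + (log_plus (norm (E z)) + log_plus (norm (deriv G z / G z))) + ln 2)"
          by (intro order_trans[OF log_plus_mult] add_mono order_trans[OF log_plus_add] log_plus_mult order_refl add_nonneg_nonneg mult_nonneg_nonneg norm_ge_zero)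
        finally show ?thesis by simp
      qed
      moreover have "continuous_on (sphere 0 r) (\<lambda>z. deriv G z / G z)"
        using elim(1) by (intro continuous_on_divide continuous_on_sphere_holomorphic Gh holomorphic_deriv) (auto simp: zero_free_radius_def)
      moreover note continuous_on_sphere_inverse[OF Gh elim(1)] continuous_on_sphere_inverse[OF X(1) elim(2)]
        continuous_on_sphere_holomorphic[OF slow_holomorphic[OF KE(1)], of r] continuous_on_sphere_holomorphic[OF slow_holomorphic[OF KE(2)], of r]
      ultimately have "proximity (\<lambda>z. 1 / G z) r \<le> (\<Sum>f\<leftarrow>?fs. proximity f r) + ln 2"
        by (intro proximity_le_sum_list) (use elim(3) in auto)
      then show ?case by simp
    qed
  qed
qed

text \<open>(B w)' = K w, so K G - B G' is free of w. It is therefore slow, and its reciprocal is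
  handled by Jensen's formula.\<close>

lemma slow_two_term:
  fixes p :: "complex poly"
  assumes \<rho>: "\<rho> = real (degree p)" "0 < degree p" and A: "slow \<rho> A" "slow \<rho> B" "\<exists>z. A z \<noteq> 0"
  shows "upper_small \<rho> (proximity (\<lambda>z. 1 / (A z + B z * exp (poly p z))))"
proof (cases "\<exists>z. B z \<noteq> 0")
  case False
  then show ?thesis using upper_small_proximity_inverse[OF A(1,3)] \<rho> by simp
next
  case True
  have \<rho>0: "0 < \<rho>" using \<rho> by simp
  \<comment> \<open>The factor \<open>of_nat 1\<close> matches the Wronskian lemma for j =
    1.\<close>
  define K where "K z = deriv B z + of_nat 1 * poly (pderiv p) z * B z" for z
  define X where "X z = K z * A z - B z * deriv A z" for z
  have K: "slow \<rho> K" unfolding K_def by (intro slow_add slow_mult slow_deriv slow_poly slow_const A \<rho>0)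
  have X: "slow \<rho> X" unfolding X_def by (intro slow_diff slow_mult slow_deriv K A \<rho>0)
  have Xnz: "\<exists>z. X z \<noteq> 0" unfolding X_def K_def by (rule wronskian_nonzero[OF \<rho> A True]) simp
  have w: "finite_type \<rho> (\<lambda>z. exp (poly p z))" unfolding \<rho>(1) by (rule finite_type_exp_poly)
  show ?thesis
  proof (rule upper_small_inverse_elimination(2)[OF _ \<rho>0 K A(2) slow_holomorphic[OF X] Xnz upper_small_proximity_inverse[OF X Xnz \<rho>0]])
    show "finite_type \<rho> (\<lambda>z. A z + B z * exp (poly p z))"
      by (intro finite_type_add finite_type_mult slow_imp_finite_type A w \<rho>0)
    fix z
    have d: "(A has_field_derivative deriv A z) (at z)" "(B has_field_derivative deriv B z) (at z)"
      using slow_holomorphic[OF A(1)] slow_holomorphic[OF A(2)] by (auto intro!: holomorphic_derivI[of _ UNIV])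
    have "((\<lambda>z. A z + B z * exp (poly p z)) has_field_derivative deriv A z + K z * exp (poly p z)) (at z)"
      unfolding K_def by (auto intro!: derivative_eq_intros d poly_DERIV simp: algebra_simps)
    then show "X z = K z * (A z + B z * exp (poly p z)) - B z * deriv (\<lambda>z. A z + B z * exp (poly p z)) z"
      by (simp add: DERIV_imp_deriv X_def algebra_simps)
  qed
qed

text \<open>The first elimination uses (E w^2)' = K w^2 and leaves X0 + X1 w, to which the two-term
  case applies. The constant coefficient X0 is nonzero because C is.\<close>

lemma slow_three_term:
  fixes p :: "complex poly"
  assumes \<rho>: "\<rho> = real (degree p)" "0 < degree p" and A: "slow \<rho> C" "slow \<rho> D" "slow \<rho> E" "\<exists>z. C z \<noteq> 0" "\<exists>z. E z \<noteq> 0"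
  shows "\<exists>z. C z + D z * exp (poly p z) + E z * exp (poly p z) ^ 2 \<noteq> 0"
    and "upper_small \<rho> (proximity (\<lambda>z. 1 / (C z + D z * exp (poly p z) + E z * exp (poly p z) ^ 2)))"
proof -
  have \<rho>0: "0 < \<rho>" using \<rho> by simp
  define G where "G z = C z + D z * exp (poly p z) + E z * exp (poly p z) ^ 2" for z
  define K where "K z = deriv E z + of_nat 2 * poly (pderiv p) z * E z" for z
  define X0 where "X0 z = K z * C z - E z * deriv C z" for z
  define X1 where "X1 z = K z * D z - E z * (deriv D z + poly (pderiv p) z * D z)" for z
  define X where "X z = X0 z + X1 z * exp (poly p z)" for z
  have K: "slow \<rho> K" unfolding K_def by (intro slow_add slow_mult slow_deriv slow_poly slow_const A \<rho>0)
  have X0: "slow \<rho> X0" unfolding X0_def by (intro slow_diff slow_mult slow_deriv K A \<rho>0)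
  have X1: "slow \<rho> X1" unfolding X1_def by (intro slow_diff slow_add slow_mult slow_deriv slow_poly K A \<rho>0)
  have X0nz: "\<exists>z. X0 z \<noteq> 0" unfolding X0_def K_def by (rule wronskian_nonzero[OF \<rho> A(1,3,4,5)]) simp
  have w: "finite_type \<rho> (\<lambda>z. exp (poly p z))" unfolding \<rho>(1) by (rule finite_type_exp_poly)
  have Xh: "X holomorphic_on UNIV" unfolding X_def
    by (intro holomorphic_intros slow_holomorphic[OF X0] slow_holomorphic[OF X1] holomorphic_exp_poly)
  \<comment> \<open>X = 0 would make X1 w = - X0 with slow coefficients, and X1 nonzero because X0
    is.\<close>
  have Xnz: "\<exists>z. X z \<noteq> 0"
  proof (rule ccontr)
    assume "\<not> ?thesis"
    then have X': "X1 z * exp (poly p z) ^ 1 = -1 * X0 z" for z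
      by (simp add: X_def add_eq_0_iff2)
    obtain y where "X0 y \<noteq> 0" using X0nz by auto
    then have "\<exists>z. X1 z \<noteq> 0" using X'[of y] by (intro exI[of _ y]) auto
    from exp_not_proportional[OF \<rho> X0 X1 this _ X'] show False by simp
  qed
  have Xs: "upper_small \<rho> (proximity (\<lambda>z. 1 / X z))" unfolding X_def by (rule slow_two_term[OF \<rho> X0 X1 X0nz])
  have Gt: "finite_type \<rho> G"
    unfolding G_def power2_eq_square by (intro finite_type_add finite_type_mult slow_imp_finite_type A w \<rho>0)
  have eq: "X z = K z * G z - E z * deriv G z" for z
  proof -
    have d: "(C has_field_derivative deriv C z) (at z)" "(D has_field_derivative deriv D z) (at z)" "(E has_field_derivative deriv E z) (at z)"
      using A(1-3)[THEN slow_holomorphic] by (auto intro!: holomorphic_derivI[of _ UNIV])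
    have "(G has_field_derivative deriv C z + (deriv D z + poly (pderiv p) z * D z) * exp (poly p z) + K z * exp (poly p z) ^ 2) (at z)"
      unfolding G_def K_def by (auto intro!: derivative_eq_intros d poly_DERIV simp: algebra_simps power2_eq_square)
    then show ?thesis by (simp add: DERIV_imp_deriv X_def X0_def X1_def G_def algebra_simps power2_eq_square)
  qed
  show "\<exists>z. C z + D z * exp (poly p z) + E z * exp (poly p z) ^ 2 \<noteq> 0"
    using upper_small_inverse_elimination(1)[OF Gt \<rho>0 K A(3) Xh Xnz Xs eq] by (simp add: G_def)
  show "upper_small \<rho> (proximity (\<lambda>z. 1 / (C z + D z * exp (poly p z) + E z * exp (poly p z) ^ 2)))"
    using upper_small_inverse_elimination(2)[OF Gt \<rho>0 K A(3) Xh Xnz Xs eq] by (simp add: G_def)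
qed

text \<open>Where |w| \<le> 1 nothing is to be shown; elsewhere division by w^(n-1) leaves E w
  bounded by |G| + |C| + |D|. The exponents n - 1 and n cover both cases that occur: n = 2 for G,
  and n = 1 for linear functions of w, where the middle term carries w^0.\<close>

lemma proximity_exp_le_three_term:
  fixes p :: "complex poly"
  assumes \<rho>: "0 < \<rho>" and A: "slow \<rho> C" "slow \<rho> D" "slow \<rho> E" "\<exists>z. E z \<noteq> 0" and n: "0 < n"
  shows "upper_small \<rho> (\<lambda>r. proximity (\<lambda>z. exp (poly p z)) r
      - proximity (\<lambda>z. C z + D z * exp (poly p z) ^ (n - 1) + E z * exp (poly p z) ^ n) r)"
proof -
  define G where "G z = C z + D z * exp (poly p z) ^ (n - 1) + E z * exp (poly p z) ^ n" for z
  note h = A(1-3)[THEN slow_holomorphic]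
  have Gh: "G holomorphic_on UNIV" unfolding G_def by (intro holomorphic_intros h)
  have "upper_small \<rho> (\<lambda>r. proximity (\<lambda>z. 1 / E z) r + (proximity C r + (proximity D r + 2 * ln 2)))"
    by (intro upper_small_add upper_small_proximity upper_small_proximity_inverse upper_small_const A \<rho>)
  then have "upper_small \<rho> (\<lambda>r. proximity (\<lambda>z. exp (poly p z)) r - proximity G r)"
  proof (rule upper_small_mono)
    show "\<forall>\<^sub>F r in generic_radii. proximity (\<lambda>z. exp (poly p z)) r - proximity G r
        \<le> proximity (\<lambda>z. 1 / E z) r + (proximity C r + (proximity D r + 2 * ln 2))"
      using eventually_generic_zero_free[OF h(3) A(4)] eventually_generic_radii_at_top[OF eventually_gt_at_top[of 0]]
    proof eventually_elim
      case (elim r)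
      let ?fs = "[\<lambda>z. 1 / E z, G, C, D]"
      have "log_plus (norm (exp (poly p z))) \<le> (\<Sum>f\<leftarrow>?fs. log_plus (norm (f z))) + 2 * ln 2" if z: "norm z = r" for z
      proof (cases "norm (exp (poly p z)) \<le> 1")
        case True
        then have "log_plus (norm (exp (poly p z))) = 0" by (simp add: log_plus_def)
        moreover have "0 \<le> (\<Sum>f\<leftarrow>?fs. log_plus (norm (f z)))" by (intro sum_list_nonneg) auto
        moreover have "0 \<le> 2 * ln (2::real)" by simp
        ultimately show ?thesis by linarith
      next
        case False
        define w where "w = exp (poly p z)"
        have w1: "1 < norm w" using False by (simp only: w_def not_le)
        have "E z \<noteq> 0" using elim(1) z by (simp add: zero_free_radius_def)
        have "E z * w * w ^ (n - 1) = G z - C z - D z * w ^ (n - 1)"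
          using n by (cases n) (simp_all add: G_def w_def)
        then have "norm (E z * w) * norm w ^ (n - 1) = norm (G z - C z - D z * w ^ (n - 1))"
          by (simp only: norm_mult[symmetric] norm_power[symmetric])
        also have "\<dots> \<le> norm (G z) + norm (C z) + norm (D z) * norm w ^ (n - 1)"
          by (intro order_trans[OF norm_triangle_ineq4] add_mono) (auto simp: norm_mult norm_power)
        also have "\<dots> \<le> (norm (G z) + norm (C z)) * norm w ^ (n - 1) + norm (D z) * norm w ^ (n - 1)"
        proof -
          have "1 \<le> norm w ^ (n - 1)" using w1 by (intro one_le_power) simp
          then show ?thesis using mult_left_mono[of 1 "norm w ^ (n - 1)" "norm (G z) + norm (C z)"] by simp
        qed
        also have "\<dots> = (norm (G z) + (norm (C z) + norm (D z))) * norm w ^ (n - 1)" by (simp add: algebra_simps)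
        finally have "norm (E z * w) \<le> norm (G z) + (norm (C z) + norm (D z))"
        proof (rule mult_right_le_imp_le)
          show "0 < norm w ^ (n - 1)" using w1 by (intro zero_less_power) linarith
        qed
        then have "norm w \<le> norm (1 / E z) * (norm (G z) + (norm (C z) + norm (D z)))"
          using \<open>E z \<noteq> 0\<close> by (simp add: norm_mult norm_divide field_simps)
        then have "log_plus (norm w) \<le> log_plus (norm (1 / E z) * (norm (G z) + (norm (C z) + norm (D z))))"
          by (rule log_plus_mono)
        also have "\<dots> \<le> log_plus (norm (1 / E z)) + (log_plus (norm (G z)) + (log_plus (norm (C z)) + log_plus (norm (D z)) + ln 2) + ln 2)"
          by (intro order_trans[OF log_plus_mult] add_mono order_trans[OF log_plus_add] log_plus_add order_refl add_nonneg_nonneg norm_ge_zero)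
        finally show ?thesis by (simp add: w_def del: norm_exp_eq_Re)
      qed
      moreover note continuous_on_sphere_inverse[OF h(3) elim(1)] continuous_on_sphere_holomorphic[OF Gh, of r]
        continuous_on_sphere_holomorphic[OF h(1), of r] continuous_on_sphere_holomorphic[OF h(2), of r]
        continuous_on_sphere_holomorphic[OF holomorphic_exp_poly, of r p]
      ultimately have "proximity (\<lambda>z. exp (poly p z)) r \<le> (\<Sum>f\<leftarrow>?fs. proximity f r) + 2 * ln 2"
        by (intro proximity_le_sum_list) (use elim(2) in \<open>auto simp del: norm_exp_eq_Re\<close>)
      then show ?case by simp
    qed
  qed
  then show ?thesis by (simp add: G_def[abs_def])
qed

lemma proximity_two_term_le:
  fixes p :: "complex poly"
  assumes \<rho>: "0 < \<rho>" and A: "slow \<rho> A" "slow \<rho> B"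
  shows "upper_small \<rho> (\<lambda>r. proximity (\<lambda>z. A z + B z * exp (poly p z)) r - proximity (\<lambda>z. exp (poly p z)) r)"
proof -
  note h = A[THEN slow_holomorphic]
  have "upper_small \<rho> (\<lambda>r. proximity A r + (proximity B r + ln 2))"
    by (intro upper_small_add upper_small_proximity upper_small_const A \<rho>)
  then show ?thesis
  proof (rule upper_small_mono)
    show "\<forall>\<^sub>F r in generic_radii. proximity (\<lambda>z. A z + B z * exp (poly p z)) r - proximity (\<lambda>z. exp (poly p z)) r
        \<le> proximity A r + (proximity B r + ln 2)"
      using eventually_generic_radii_at_top[OF eventually_gt_at_top[of 0]]
    proof eventually_elim
      case (elim r)
      let ?fs = "[A, B, \<lambda>z. exp (poly p z)]"
      have "log_plus (norm (A z + B z * exp (poly p z))) \<le> (\<Sum>f\<leftarrow>?fs. log_plus (norm (f z))) + ln 2" for z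
      proof -
        have "norm (A z + B z * exp (poly p z)) \<le> norm (A z) + norm (B z) * norm (exp (poly p z))"
          using norm_triangle_ineq[of "A z" "B z * exp (poly p z)"] by (simp only: norm_mult)
        then have "log_plus (norm (A z + B z * exp (poly p z))) \<le> log_plus (norm (A z) + norm (B z) * norm (exp (poly p z)))"
          by (rule log_plus_mono)
        also have "\<dots> \<le> log_plus (norm (A z)) + (log_plus (norm (B z)) + log_plus (norm (exp (poly p z)))) + ln 2"
          by (intro order_trans[OF log_plus_add] add_mono log_plus_mult order_refl mult_nonneg_nonneg norm_ge_zero)
        finally show ?thesis by (simp del: norm_exp_eq_Re)
      qed
      moreover note continuous_on_sphere_holomorphic[OF h(1), of r] continuous_on_sphere_holomorphic[OF h(2), of r]
        continuous_on_sphere_holomorphic[OF holomorphic_exp_poly, of r p]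
      ultimately have "proximity (\<lambda>z. A z + B z * exp (poly p z)) r \<le> (\<Sum>f\<leftarrow>?fs. proximity f r) + ln 2"
        by (intro proximity_le_sum_list) (use elim in \<open>auto intro!: continuous_intros simp del: norm_exp_eq_Re\<close>)
      then show ?case by simp
    qed
  qed
qed

section \<open>Counting functions from proximity functions\<close>

lemma upper_small_lower_bound:
  assumes "upper_small \<rho> (\<lambda>r. u r - v r)" "\<forall>\<^sub>F r in at_top. c * r powr \<rho> \<le> u r" "0 < c"
  shows "\<forall>\<^sub>F r in generic_radii. c / 2 * r powr \<rho> \<le> v r"
proof -
  have "0 < c / 2" using assms(3) by simp
  then have "\<forall>\<^sub>F r in generic_radii. u r - v r \<le> c / 2 * r powr \<rho>"
    using assms(1) unfolding upper_small_def by blast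
  then show ?thesis using eventually_generic_radii_at_top[OF assms(2)]
  proof eventually_elim
    case (elim r)
    have "c * r powr \<rho> = c / 2 * r powr \<rho> + c / 2 * r powr \<rho>" by simp
    then show ?case using elim by linarith
  qed
qed

text \<open>N increases, so its value at x is bounded by that at a generic r in [x, x + 1], and r
  \<le> 2x costs only a constant.\<close>

lemma zero_exponent_le_generic:
  assumes G: "G holomorphic_on UNIV" "\<exists>z. G z \<noteq> 0" and t: "0 \<le> t" "0 \<le> C"
    and N: "\<forall>\<^sub>F r in generic_radii. counting_int (\<lambda>z. 1 / G z) r \<le> C * r powr t"
  shows "zero_exponent G \<le> ereal t"
proof (rule ereal_le_epsilon2)
  fix e :: real assume e: "0 < e"
  obtain x0 where x0: "\<And>x. x0 \<le> x \<Longrightarrow> \<exists>r. x \<le> r \<and> r \<le> x + 1 \<and> counting_int (\<lambda>z. 1 / G z) r \<le> C * r powr t"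
    using generic_radii_interval[OF N] by blast
  have "\<forall>\<^sub>F r in at_top. (C * 2 powr t) * r powr t \<le> 1 * r powr (t + e)" by (rule powr_dominated) (use e in auto)
  then have "\<forall>\<^sub>F r in at_top. counting_int (\<lambda>z. 1 / G z) r \<le> r powr (t + e)"
    using eventually_ge_at_top[of "max 1 x0"]
  proof eventually_elim
    case (elim x)
    obtain r where r: "x \<le> r" "r \<le> x + 1" "counting_int (\<lambda>z. 1 / G z) r \<le> C * r powr t" using x0[of x] elim by auto
    have "counting_int (\<lambda>z. 1 / G z) x \<le> counting_int (\<lambda>z. 1 / G z) r" using elim r by (intro counting_int_mono G) auto
    also have "\<dots> \<le> C * r powr t" by (rule r)
    also have "\<dots> \<le> C * (2 * x) powr t" using r elim t by (intro mult_left_mono powr_mono2) auto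
    also have "\<dots> = (C * 2 powr t) * x powr t" using elim by (simp add: powr_mult)
    also have "\<dots> \<le> x powr (t + e)" using elim by simp
    finally show ?case .
  qed
  then have "zero_exponent G \<le> ereal (t + e)" unfolding zero_exponent_def by (rule Limsup_log_plus_le) (use t e in simp)
  then show "zero_exponent G \<le> ereal t + ereal e" by simp
qed

lemma counting_int_proximity:
  assumes G: "G holomorphic_on UNIV" "\<exists>z. G z \<noteq> 0"
  obtains c where "\<forall>\<^sub>F r in generic_radii. counting_int (\<lambda>z. 1 / G z) r = proximity G r - proximity (\<lambda>z. 1 / G z) r - c"
proof -
  obtain c where c: "\<And>R. 0 < R \<Longrightarrow> zero_free_radius G R \<Longrightarrow>
    counting_int (\<lambda>z. 1 / G z) R = circle_mean (\<lambda>z. ln (norm (G z))) R - c"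
    by (rule jensen_formula[OF G]) (rule that)
  have "\<forall>\<^sub>F r in generic_radii. counting_int (\<lambda>z. 1 / G z) r = proximity G r - proximity (\<lambda>z. 1 / G z) r - c"
    using eventually_generic_zero_free[OF G] eventually_generic_radii_at_top[OF eventually_gt_at_top[of 0]]
    by eventually_elim (use c circle_mean_ln_norm(1)[OF G(1)] in auto)
  then show ?thesis using that by blast
qed

lemma proximity_nonneg:
  assumes "0 \<le> r" "continuous_on (sphere 0 r) F" shows "0 \<le> proximity F r"
  unfolding proximity_eq_circle_mean using assms by (intro circle_mean_nonneg continuous_intros) auto

lemma zero_exponent_le_finite_type:
  assumes G: "finite_type \<rho> G" "\<exists>z. G z \<noteq> 0" "0 < \<rho>"
  shows "zero_exponent G \<le> ereal \<rho>"
proof -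
  note Gh = finite_type_holomorphic[OF G(1)]
  obtain c where c: "\<forall>\<^sub>F r in generic_radii. counting_int (\<lambda>z. 1 / G z) r = proximity G r - proximity (\<lambda>z. 1 / G z) r - c"
    by (rule counting_int_proximity[OF Gh G(2)]) (rule that)
  obtain K where K: "0 \<le> K" "\<forall>\<^sub>F r in at_top. proximity G r \<le> K * r powr \<rho>"
    by (rule proximity_finite_type[OF G(1)]) (rule that)
  show ?thesis
  proof (rule zero_exponent_le_generic[OF Gh G(2)])
    show "\<forall>\<^sub>F r in generic_radii. counting_int (\<lambda>z. 1 / G z) r \<le> (K + \<bar>c\<bar>) * r powr \<rho>"
      using c eventually_generic_radii_at_top[OF K(2)] eventually_generic_zero_free[OF Gh G(2)]
        eventually_generic_radii_at_top[OF eventually_ge_at_top[of 1]]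
    proof eventually_elim
      case (elim r)
      have "0 \<le> proximity (\<lambda>z. 1 / G z) r" using elim by (intro proximity_nonneg continuous_on_sphere_inverse Gh) auto
      moreover have "1 \<le> r powr \<rho>" using elim G(3) by (intro ge_one_powr_ge_zero) auto
      then have "\<bar>c\<bar> \<le> \<bar>c\<bar> * r powr \<rho>" using mult_left_mono[of 1 "r powr \<rho>" "\<bar>c\<bar>"] by simp
      ultimately show ?case using elim by (simp add: algebra_simps)
    qed
  qed (use G K in auto)
qed

section \<open>Zeros of \<open>L(z, f) - \<alpha> f\<^sup>2 - \<beta>\<close>\<close>

text \<open>A zero-free factor changes no order of vanishing. This is what allows the common factor
  w to be dropped when C = 0.\<close>

lemma counting_int_mult_nonzero:
  assumes H: "H holomorphic_on UNIV" "\<exists>z. H z \<noteq> 0" and w: "w holomorphic_on UNIV" "\<And>z. w z \<noteq> 0"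
  shows "counting_int (\<lambda>z. 1 / (H z * w z)) = counting_int (\<lambda>z. 1 / H z)"
proof -
  have Hw: "(\<lambda>z. H z * w z) holomorphic_on UNIV" "\<exists>z. H z * w z \<noteq> 0"
    using assms by (auto intro!: holomorphic_intros)
  have "zorder (\<lambda>z. H z * w z) a = zorder H a" for a
  proof -
    obtain g where g: "g holomorphic_on UNIV" "\<And>z. H z = (z - a) ^ nat (zorder H a) * g z" "g a \<noteq> 0"
      by (rule entire_factor_zero[OF H, of a]) (rule that)
    have "zorder (\<lambda>z. H z * w z) a = int (nat (zorder H a))"
    proof (rule zorder_factor)
      show "H z * w z = (z - a) ^ nat (zorder H a) * (g z * w z)" for z by (subst g(2)) (simp add: mult.assoc)
      show "(\<lambda>z. g z * w z) holomorphic_on UNIV" by (intro holomorphic_intros g w)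
    qed (use g w in auto)
    then show ?thesis using zorder_nonneg_entire(1)[OF H, of a] by simp
  qed
  then have "counting (\<lambda>z. 1 / (H z * w z)) = counting (\<lambda>z. 1 / H z)"
    using w(2) by (simp add: fun_eq_iff counting_inverse_entire[OF H] counting_inverse_entire[OF Hw])
  then show ?thesis by (simp add: counting_int_def fun_eq_iff)
qed

text \<open>Squaring doubles every order of vanishing; so the zeros of - \<alpha> (f - d)^2 inherit
  the small exponent of f - d.\<close>

lemma counting_int_cmult_square:
  assumes g: "g holomorphic_on UNIV" "\<exists>z. g z \<noteq> 0" and c: "c \<noteq> 0"
  shows "counting_int (\<lambda>z. 1 / (c * g z ^ 2)) r = 2 * counting_int (\<lambda>z. 1 / g z) r"
proof -
  have G: "(\<lambda>z. c * g z ^ 2) holomorphic_on UNIV" "\<exists>z. c * g z ^ 2 \<noteq> 0"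
    using assms by (auto intro!: holomorphic_intros)
  have "nat (zorder (\<lambda>z. c * g z ^ 2) a) = 2 * nat (zorder g a)" for a
  proof -
    obtain h where h: "h holomorphic_on UNIV" "\<And>z. g z = (z - a) ^ nat (zorder g a) * h z" "h a \<noteq> 0"
      by (rule entire_factor_zero[OF g, of a]) (rule that)
    have "zorder (\<lambda>z. c * g z ^ 2) a = int (2 * nat (zorder g a))"
    proof (rule zorder_factor)
      show "c * g z ^ 2 = (z - a) ^ (2 * nat (zorder g a)) * (c * h z ^ 2)" for z
        by (subst h(2)) (simp add: power_mult_distrib power_mult[symmetric] mult.commute)
      show "(\<lambda>z. c * h z ^ 2) holomorphic_on UNIV" by (intro holomorphic_intros h)
    qed (use h c in auto)
    then show ?thesis by (simp only: nat_int)
  qed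
  then have "counting (\<lambda>z. 1 / (c * g z ^ 2)) t = 2 * counting (\<lambda>z. 1 / g z) t" for t
    using c by (simp add: counting_inverse_entire[OF g] counting_inverse_entire[OF G] sum_distrib_left)
  then have "counting_int (\<lambda>z. 1 / (c * g z ^ 2)) r = integral {0..r} (\<lambda>t. 2 * ((real (counting (\<lambda>z. 1 / g z) t) - real (counting (\<lambda>z. 1 / g z) 0)) / t))
       + 2 * (real (counting (\<lambda>z. 1 / g z) 0) * ln r)"
    by (simp add: counting_int_def diff_divide_distrib algebra_simps)
  then show ?thesis by (simp only: integral_mult_right counting_int_def distrib_left)
qed

lemma entire_meromorphic: "f holomorphic_on UNIV \<Longrightarrow> f meromorphic_on UNIV"
  by (intro analytic_on_imp_meromorphic_on) (simp add: analytic_on_open)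

text \<open>Identity of entire functions is stated as equality at all points. The quotients in (a)
  are compared off the zeros of f - d, where the division is genuine, and (b) says that the
  difference of N and T is an \<open>S_lam_quantity\<close>.\<close>

theorem theorem1p3:
  fixes f \<beta> L \<Phi>\<^sub>2 :: "complex \<Rightarrow> complex"
    and b :: "nat \<Rightarrow> complex \<Rightarrow> complex"
    and c :: "nat \<Rightarrow> complex"
    and k :: "nat \<Rightarrow> nat"
    and m :: nat
    and d \<alpha> :: complex
    and \<rho> lam :: real
    and I\<^sub>1 :: "nat set"
  assumes f: "transcendental_entire f"
    and order: "growth_order f = ereal \<rho>"
    and d: "d \<noteq> 0" "borel_exceptional_value f d"
    and lam: "lam < \<rho>"
    and alpha: "\<alpha> \<noteq> 0"
    and beta: "\<beta> holomorphic_on UNIV" "lam_small_function lam f \<beta>"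
    and b: "\<And>j. j \<le> m \<Longrightarrow> b j holomorphic_on UNIV"
           "\<And>j. j \<le> m \<Longrightarrow> lam_small_function lam f (b j)"
    and c: "inj_on c {0..m}"
    and L: "L = (\<lambda>z. \<Sum>j=0..m. b j z * (deriv ^^ k j) f (z + c j))"
    and L_nonzero: "\<exists>z. L z \<noteq> 0"
    and Phi: "\<Phi>\<^sub>2 = (\<lambda>z. L z - \<alpha> * f z ^ 2)"
    and I: "I\<^sub>1 = {j. j \<le> m \<and> k j = 0}"
  shows "(\<not> (\<forall>z. \<beta> z = (\<Sum>j\<in>I\<^sub>1. b j z) * d - \<alpha> * d ^ 2) \<longrightarrow>
            zero_exponent (\<lambda>z. \<Phi>\<^sub>2 z - \<beta> z) = ereal \<rho>) \<and>
         ((\<forall>z. \<beta> z = (\<Sum>j\<in>I\<^sub>1. b j z) * d - \<alpha> * d ^ 2) \<longrightarrow>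
            (borel_exceptional_function \<Phi>\<^sub>2 \<beta> \<and>
             (\<forall>z. f z \<noteq> d \<longrightarrow>
                (\<beta> z - \<Phi>\<^sub>2 z) / (f z - d) ^ 2 = \<alpha> \<and>
                \<alpha> = (L z - \<alpha> * d ^ 2 - \<beta> z) / (2 * d * (f z - d)))) \<or>
            S_lam_quantity lam f
              (\<lambda>r. counting_int (\<lambda>z. 1 / (\<Phi>\<^sub>2 z - \<beta> z)) r - characteristic f r))"
proof -
  have fh: "f holomorphic_on UNIV" using f by (simp add: transcendental_entire_def)
  have fd: "\<exists>z. f z \<noteq> d"
  proof (rule ccontr)
    assume "\<not> ?thesis"
    then have "\<forall>z. f z = poly [:d:] z" by simp
    then show False using f unfolding transcendental_entire_def by blast
  qed
  have zeros: "zero_exponent (\<lambda>z. f z - d) < ereal \<rho>"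
    using d(2) order by (simp add: borel_exceptional_value_def borel_exceptional_function_def)
  obtain P p where P: "slow \<rho> P" "\<exists>z. P z \<noteq> 0" and \<rho>: "\<rho> = real (degree p)" "0 < degree p"
      and feq: "f = (\<lambda>z. d + P z * exp (poly p z))"
    by (rule borel_exceptional_value_factorization[OF fh fd order zeros]) (rule that)
  have \<rho>0: "0 < \<rho>" using \<rho> by simp
  define w where "w z = exp (poly p z)" for z
  have wt: "finite_type \<rho> w" unfolding w_def[abs_def] \<rho>(1) by (rule finite_type_exp_poly)
  have sc: "slow \<rho> (\<lambda>_. x)" for x by (rule slow_const[OF \<rho>0])
  have ft: "finite_type \<rho> f"
    unfolding feq by (intro finite_type_add finite_type_mult slow_imp_finite_type wt[unfolded w_def[abs_def]] P sc \<rho>0)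
  obtain K where K: "0 \<le> K" "\<forall>\<^sub>F r in at_top. proximity f r \<le> K * r powr \<rho>"
    by (rule proximity_finite_type[OF ft]) (rule that)
  \<comment> \<open>T(r, f) = O(r^\<rho>) is read off from the factorization and makes the
    \<lambda>-small coefficients slow; K + 1 provides a positive constant.\<close>
  have Tf: "\<forall>\<^sub>F r in at_top. \<bar>characteristic f r\<bar> \<le> (K + 1) * r powr \<rho>"
    using K(2) eventually_gt_at_top[of 0]
  proof eventually_elim
    case (elim r)
    have "0 \<le> proximity f r" using elim by (intro proximity_nonneg continuous_on_sphere_holomorphic fh) auto
    moreover have "0 \<le> r powr \<rho>" by simp
    ultimately show ?case using elim unfolding characteristic_entire[OF fh] distrib_right by linarith
  qed
  have K1: "0 < K + 1" using K by simp
  note to_slow = lam_small_imp_slow[OF _ _ order lam \<rho>0 Tf K1]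
  have \<beta>s: "slow \<rho> \<beta>" by (rule to_slow[OF beta])
  have bs: "slow \<rho> (b j)" if "j \<in> {0..m}" for j using that by (intro to_slow b) auto
  have bI: "slow \<rho> (b j)" if "j \<in> I\<^sub>1" for j using that by (intro bs) (simp add: I)
  obtain A where A: "slow \<rho> A"
      "\<And>z. (\<Sum>j\<in>{0..m}. b j z * (deriv ^^ k j) f (z + c j)) = (\<Sum>j\<in>{j\<in>{0..m}. k j = 0}. b j z) * d + A z * exp (poly p z)"
    by (rule linear_difference_form[OF P(1) \<rho> bs finite_atLeastAtMost feq]) (assumption | rule that)+
  have I': "{j\<in>{0..m}. k j = 0} = I\<^sub>1" by (auto simp: I)
  have Leq: "L z = (\<Sum>j\<in>I\<^sub>1. b j z) * d + A z * w z" for z by (simp only: L A(2) I' w_def)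
  \<comment> \<open>The coefficients of 1, w and w^2 after inserting f = d + P w into L - \<alpha>
    f^2 - \<beta>.\<close>
  define C where "C z = (\<Sum>j\<in>I\<^sub>1. b j z) * d - \<alpha> * d ^ 2 - \<beta> z" for z
  define D where "D z = A z - 2 * \<alpha> * d * P z" for z
  define E where "E z = - \<alpha> * P z ^ 2" for z
  define G where "G z = \<Phi>\<^sub>2 z - \<beta> z" for z
  have Cs: "slow \<rho> C" unfolding C_def by (intro slow_diff slow_mult slow_sum sc \<beta>s bI \<rho>0)
  have Ds: "slow \<rho> D" unfolding D_def by (intro slow_diff slow_cmult A P \<rho>0)
  have Es: "slow \<rho> E" unfolding E_def by (intro slow_cmult slow_power P \<rho>0)
  have Enz: "\<exists>z. E z \<noteq> 0" using P(2) alpha by (auto simp: E_def)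
  have fw: "f z = d + P z * w z" for z by (simp add: feq w_def)
  have Geq: "G z = C z + D z * w z + E z * w z ^ 2" for z
    by (simp add: G_def Phi Leq C_def D_def E_def fw power2_eq_square algebra_simps)
  have Gt: "finite_type \<rho> G"
    unfolding Geq[abs_def] power2_eq_square by (intro finite_type_add finite_type_mult slow_imp_finite_type wt Cs Ds Es \<rho>0)
  obtain \<kappa> where \<kappa>: "0 < \<kappa>" "\<forall>\<^sub>F r in at_top. \<kappa> * r powr \<rho> \<le> proximity w r"
    by (rule proximity_exp_poly_ge[OF \<rho>(2), folded \<rho>(1) w_def]) (rule that)
  note wG = proximity_exp_le_three_term[OF \<rho>0, where p = p, folded w_def]
  have "zero_exponent G = ereal \<rho>" if nz: "\<exists>z. C z \<noteq> 0"
  proof (rule antisym)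
    note three = slow_three_term[OF \<rho> Cs Ds Es nz Enz, folded w_def, folded Geq]
    show "zero_exponent G \<le> ereal \<rho>" by (rule zero_exponent_le_finite_type[OF Gt three(1) \<rho>0])
    obtain x where x: "\<forall>\<^sub>F r in generic_radii. counting_int (\<lambda>z. 1 / G z) r = proximity G r - proximity (\<lambda>z. 1 / G z) r - x"
      by (rule counting_int_proximity[OF finite_type_holomorphic[OF Gt] three(1)]) (rule that)
    \<comment> \<open>m(r, w) \<le> m(r, G) + o(r^\<rho>), and m(r, 1/G) is small, so Jensen's
      formula bounds N from below by m(r, w), which grows like r^\<rho>.\<close>
    have "upper_small \<rho> (\<lambda>r. proximity w r - proximity G r)"
      using wG[OF Cs Ds Es Enz, of 2] by (simp add: Geq[abs_def])
    from upper_small_add[OF this upper_small_add[OF three(2) upper_small_const[OF \<rho>0, of x]]]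
    have "upper_small \<rho> (\<lambda>r. proximity w r - counting_int (\<lambda>z. 1 / G z) r)"
      by (rule upper_small_mono) (use x in \<open>auto elim!: eventually_mono\<close>)
    from upper_small_lower_bound[OF this \<kappa>(2,1)]
    show "ereal \<rho> \<le> zero_exponent G"
      unfolding zero_exponent_def by (rule Limsup_log_plus_ge) (use \<kappa> in simp)
  qed
  moreover have "(borel_exceptional_function \<Phi>\<^sub>2 \<beta> \<and>
             (\<forall>z. f z \<noteq> d \<longrightarrow>
                (\<beta> z - \<Phi>\<^sub>2 z) / (f z - d) ^ 2 = \<alpha> \<and>
                \<alpha> = (L z - \<alpha> * d ^ 2 - \<beta> z) / (2 * d * (f z - d)))) \<or>
            S_lam_quantity lam f (\<lambda>r. counting_int (\<lambda>z. 1 / G z) r - characteristic f r)" if C0: "\<forall>z. C z = 0"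
  proof (cases "\<exists>z. D z \<noteq> 0")
    case False
    then have Gsq: "G z = - \<alpha> * (f z - d) ^ 2" for z
      using C0 by (simp add: Geq E_def fw power_mult_distrib)
    have gh: "(\<lambda>z. f z - d) holomorphic_on UNIV" "\<exists>z. f z - d \<noteq> 0" using fh fd by (auto intro!: holomorphic_intros)
    have Gnz: "\<exists>z. G z \<noteq> 0" using fd alpha by (auto simp: Gsq)
    note Gh = finite_type_holomorphic[OF Gt]
    \<comment> \<open>The zero term gives the shape of the three-term lemma, with \<beta> as
      constant coefficient; this yields the lower bound on T(r,
      \<open>\<Phi>\<^sub>2\<close>).\<close>
    have \<Phi>eq: "\<Phi>\<^sub>2 z = \<beta> z + 0 * w z + E z * w z ^ 2" for z
      using C0 False Geq[of z] by (simp add: G_def algebra_simps)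
    have \<Phi>t: "finite_type \<rho> \<Phi>\<^sub>2"
      unfolding \<Phi>eq[abs_def] power2_eq_square by (intro finite_type_add finite_type_mult slow_imp_finite_type wt \<beta>s Es sc \<rho>0)
    note \<Phi>h = finite_type_holomorphic[OF \<Phi>t]
    have "upper_small \<rho> (\<lambda>r. proximity w r - proximity \<Phi>\<^sub>2 r)"
      using wG[OF \<beta>s sc Es Enz, of 2 0] by (simp add: \<Phi>eq[abs_def])
    from upper_small_lower_bound[OF this \<kappa>(2,1)]
    have T\<Phi>: "\<forall>\<^sub>F r in generic_radii. \<kappa> / 2 * r powr \<rho> \<le> characteristic \<Phi>\<^sub>2 r"
      by (simp add: characteristic_entire[OF \<Phi>h])
    have \<kappa>2: "0 < \<kappa> / 2" using \<kappa> by simp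
    have low: "ereal \<rho> \<le> growth_order \<Phi>\<^sub>2"
      unfolding growth_order_def by (rule Limsup_log_plus_ge[OF T\<Phi> \<kappa>2])
    obtain K' where K': "0 \<le> K'" "\<forall>\<^sub>F r in at_top. proximity \<Phi>\<^sub>2 r \<le> K' * r powr \<rho>"
      by (rule proximity_finite_type[OF \<Phi>t]) (rule that)
    \<comment> \<open>Only finiteness of the order is at stake here, so one unit of slack in the
      exponent is enough.\<close>
    have "\<forall>\<^sub>F r in at_top. K' * r powr \<rho> \<le> 1 * r powr (\<rho> + 1)" by (rule powr_dominated) auto
    with K'(2) have "\<forall>\<^sub>F r in at_top. characteristic \<Phi>\<^sub>2 r \<le> r powr (\<rho> + 1)"
      by eventually_elim (simp add: characteristic_entire[OF \<Phi>h])
    then have "growth_order \<Phi>\<^sub>2 \<le> ereal (\<rho> + 1)"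
      unfolding growth_order_def by (rule Limsup_log_plus_le) (use \<rho>0 in simp)
    then have up: "growth_order \<Phi>\<^sub>2 < \<infinity>" by (rule le_less_trans) simp
    have "upper_small \<rho> (characteristic \<beta>)"
      using upper_small_proximity[OF \<beta>s] by (simp add: characteristic_entire[OF beta(1)] upper_small_def)
    moreover have "upper_small \<rho> (\<lambda>r. - characteristic \<beta> r)"
    proof (rule upper_small_mono[OF upper_small_const[OF \<rho>0, of 0]])
      show "\<forall>\<^sub>F r in generic_radii. - characteristic \<beta> r \<le> 0"
        using eventually_generic_radii_at_top[OF eventually_gt_at_top[of 0]]
        by eventually_elim (auto simp: characteristic_entire[OF beta(1)] intro!: proximity_nonneg continuous_on_sphere_holomorphic beta)
    qed
    ultimately have small: "small_function \<Phi>\<^sub>2 \<beta>"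
      unfolding small_function_def by (intro conjI entire_meromorphic beta S_quantityI[OF _ _ T\<Phi> \<kappa>2])
    \<comment> \<open>Equality off a sparse set would hold near 0, whereas the zeros of G are
      isolated.\<close>
    have neq: "\<not> (\<forall>\<^sub>\<approx>z\<in>UNIV. \<Phi>\<^sub>2 z = \<beta> z)"
    proof
      assume "\<forall>\<^sub>\<approx>z\<in>UNIV. \<Phi>\<^sub>2 z = \<beta> z"
      then have "\<forall>\<^sub>F z in at 0. \<Phi>\<^sub>2 z = \<beta> z" by (simp add: eventually_cosparse_open_eq)
      moreover obtain y where "G y \<noteq> 0" using Gnz by auto
      then have "\<forall>\<^sub>F z in at 0. G z \<noteq> 0 \<and> z \<in> UNIV"
        by (intro non_zero_neighbour_alt[OF Gh, where \<beta> = y]) auto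
      ultimately have "\<forall>\<^sub>F z in at (0::complex). False" by eventually_elim (simp add: G_def)
      then show False by simp
    qed
    obtain \<sigma> where \<sigma>: "0 < \<sigma>" "\<sigma> < \<rho>" and N: "\<forall>\<^sub>F r in at_top. counting_int (\<lambda>z. 1 / (f z - d)) r \<le> r powr \<sigma>"
      by (rule counting_int_le_powr[OF zeros]) (rule that)
    have "zero_exponent G \<le> ereal \<sigma>"
    proof (rule zero_exponent_le_generic[OF Gh Gnz])
      show "\<forall>\<^sub>F r in generic_radii. counting_int (\<lambda>z. 1 / G z) r \<le> 2 * r powr \<sigma>"
        using eventually_generic_radii_at_top[OF N]
        by eventually_elim (use counting_int_cmult_square[OF gh, of "- \<alpha>"] alpha in \<open>simp add: Gsq\<close>)
    qed (use \<sigma> in auto)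
    also have "\<dots> < growth_order \<Phi>\<^sub>2" by (rule less_le_trans[OF _ low]) (simp add: \<sigma>(2))
    finally have "borel_exceptional_function \<Phi>\<^sub>2 \<beta>"
      unfolding borel_exceptional_function_def using up small neq entire_meromorphic[OF \<Phi>h] by (simp add: G_def[abs_def])
    moreover have "(\<beta> z - \<Phi>\<^sub>2 z) / (f z - d) ^ 2 = \<alpha> \<and> \<alpha> = (L z - \<alpha> * d ^ 2 - \<beta> z) / (2 * d * (f z - d))" if "f z \<noteq> d" for z
    proof
      have "\<beta> z - \<Phi>\<^sub>2 z = \<alpha> * (f z - d) ^ 2" using Gsq[of z] by (simp add: G_def algebra_simps)
      then show "(\<beta> z - \<Phi>\<^sub>2 z) / (f z - d) ^ 2 = \<alpha>" using that by simp
      \<comment> \<open>Expanding L - \<alpha> f^2 - \<beta> = - \<alpha> (f - d)^2 cancels f^2 and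
        leaves a linear expression in f.\<close>
      have "L z - \<alpha> * d ^ 2 - \<beta> z = \<alpha> * (2 * d * (f z - d))"
        using Gsq[of z] by (simp add: G_def Phi power2_eq_square algebra_simps)
      then show "\<alpha> = (L z - \<alpha> * d ^ 2 - \<beta> z) / (2 * d * (f z - d))" using that d(1) by simp
    qed
    ultimately show ?thesis by blast
  next
    case True
    \<comment> \<open>Since C = 0, G is divisible by the zero-free function w, and a two-term
      function with the same zeros remains.\<close>
    define H where "H z = D z + E z * w z" for z
    have Hh: "H holomorphic_on UNIV" unfolding H_def
      by (intro holomorphic_intros slow_holomorphic[OF Ds] slow_holomorphic[OF Es] finite_type_holomorphic[OF wt])
    have Hnz: "\<exists>z. H z \<noteq> 0"
    proof (rule ccontr)
      assume "\<not> ?thesis"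
      then have "E z * exp (poly p z) ^ 1 = -1 * D z" for z by (simp add: H_def w_def add_eq_0_iff2)
      from exp_not_proportional[OF \<rho> Ds Es Enz _ this] show False by simp
    qed
    have GH: "G = (\<lambda>z. H z * w z)" using C0 by (simp add: fun_eq_iff Geq H_def power2_eq_square algebra_simps)
    have NG: "counting_int (\<lambda>z. 1 / G z) = counting_int (\<lambda>z. 1 / H z)"
      unfolding GH by (rule counting_int_mult_nonzero[OF Hh Hnz finite_type_holomorphic[OF wt]]) (simp add: w_def)
    obtain x where x: "\<forall>\<^sub>F r in generic_radii. counting_int (\<lambda>z. 1 / H z) r = proximity H r - proximity (\<lambda>z. 1 / H z) r - x"
      by (rule counting_int_proximity[OF Hh Hnz]) (rule that)
    have Hi: "upper_small \<rho> (proximity (\<lambda>z. 1 / H z))"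
      using slow_two_term[OF \<rho> Ds Es True] by (simp add: H_def w_def)
    have Hw: "upper_small \<rho> (\<lambda>r. proximity H r - proximity w r)"
      using proximity_two_term_le[OF \<rho>0 Ds Es, of p] by (simp add: H_def[abs_def] w_def[abs_def])
    \<comment> \<open>The instance n = 1: D becomes the constant coefficient, and the middle term,
      now multiplied by w^0, is 0.\<close>
    have wH: "upper_small \<rho> (\<lambda>r. proximity w r - proximity H r)"
      using wG[OF Ds sc Es Enz, of 1 0] by (simp add: H_def[abs_def])
    have fw': "upper_small \<rho> (\<lambda>r. proximity f r - proximity w r)"
      using proximity_two_term_le[OF \<rho>0 sc P(1), of d p] by (simp add: feq w_def[abs_def])
    have wf: "upper_small \<rho> (\<lambda>r. proximity w r - proximity f r)"
      using wG[OF sc sc P, of 1 d 0] by (simp add: fw[abs_def])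
    \<comment> \<open>This direction uses only m(r, 1/H) \<ge> 0; its smallness enters in the
      opposite inequality \<open>u2\<close>.\<close>
    have u1: "upper_small \<rho> (\<lambda>r. counting_int (\<lambda>z. 1 / G z) r - characteristic f r)"
    proof (rule upper_small_mono[OF upper_small_add[OF Hw upper_small_add[OF wf upper_small_const[OF \<rho>0, of "- x"]]]])
      show "\<forall>\<^sub>F r in generic_radii. counting_int (\<lambda>z. 1 / G z) r - characteristic f r
          \<le> proximity H r - proximity w r + (proximity w r - proximity f r + - x)"
        using x eventually_generic_zero_free[OF Hh Hnz] eventually_generic_radii_at_top[OF eventually_gt_at_top[of 0]]
      proof eventually_elim
        case (elim r)
        have "0 \<le> proximity (\<lambda>z. 1 / H z) r" using elim by (intro proximity_nonneg continuous_on_sphere_inverse Hh) auto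
        then show ?case using elim by (simp add: NG characteristic_entire[OF fh])
      qed
    qed
    have u2: "upper_small \<rho> (\<lambda>r. - (counting_int (\<lambda>z. 1 / G z) r - characteristic f r))"
    proof (rule upper_small_mono[OF upper_small_add[OF wH upper_small_add[OF fw' upper_small_add[OF Hi upper_small_const[OF \<rho>0, of x]]]]])
      show "\<forall>\<^sub>F r in generic_radii. - (counting_int (\<lambda>z. 1 / G z) r - characteristic f r)
          \<le> proximity w r - proximity H r + (proximity f r - proximity w r + (proximity (\<lambda>z. 1 / H z) r + x))"
        using x by eventually_elim (simp add: NG characteristic_entire[OF fh])
    qed
    \<comment> \<open>By this lower bound on T(r, f), the error o(r^\<rho>) is already an S(r, f),
      and the power term of the \<open>S_lam_quantity\<close> can be taken to be 0.\<close>
    have "\<forall>\<^sub>F r in generic_radii. \<kappa> / 2 * r powr \<rho> \<le> characteristic f r"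
      using upper_small_lower_bound[OF wf \<kappa>(2,1)] by (simp add: characteristic_entire[OF fh])
    from S_quantityI[OF u1 u2 this] \<kappa>(1) show ?thesis by (intro disjI2 S_lam_quantityI) simp
  qed
  moreover have "(\<forall>z. \<beta> z = (\<Sum>j\<in>I\<^sub>1. b j z) * d - \<alpha> * d ^ 2) \<longleftrightarrow> (\<forall>z. C z = 0)"
    by (auto simp: C_def)
  ultimately show ?thesis unfolding G_def[abs_def] by blast
qed

end
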